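(* Let $D$ be an integral domain that is not a field. The following conditions are equivalent: (i) $D$ is $w$-stable of $t$-dimension one; (ii) $D$ is Mori and $w$-stable; (iii) $D$ is Mori and Clifford $w$-regular.
   Context: For an integral domain $D$ with field of fractions $K$, "ideal" means fractional ideal, an integral ideal is an ideal contained in $D$, and $\mathcal{F}(D)$ is the set of nonzero ideals. For ideals $I,J$, $(J:I)=\{x\in K: xI\subseteq J\}$. For $I\in\mathcal F(D)$: $I^v=(D:(D:I))$; $I$ is divisorial if $I=I^v$; $I^t=\bigcup\{J^v: J\in\mathcal F(D)\text{ finitely generated}, J\subseteq I\}$; $I$ is a $t$-ideal if $I=I^t$; a $t$-prime is a (nonzero) prime $t$-ideal; a $t$-maximal ideal is an ideal maximal among the proper integral $t$-ideals (it is prime), and $t\text{-Max}(D)$ is the set of these; $I^w=\bigcap_{M\in t\text{-Max}(D)}ID_M$, equivalently $I^w=\bigcup\{(I:J): J\text{ finitely generated},(D:J)=D\}$. $I$ is $w$-stable if, with $E=(I^w:I^w)$, $(I^w(E:I^w))^w=E$; $D$ is $w$-stable if every nonzero ideal is $w$-stable. $I$ is $w$-regular if $I^w=(I^2J)^w$ for some nonzero ideal $J$ of $D$; $D$ is Clifford $w$-regular if every nonzero ideal is $w$-regular. $D$ has $t$-dimension one if each $t$-prime ideal has height one. $D$ is Mori if it satisfies the ascending chain condition on integral divisorial ideals. *)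

theory Defs
  imports Complex_Main "HOL-Library.Extended_Nat"
begin

text \<open>An integral domain is given inside its field of fractions: \<open>D\<close> is a subring of the field
  \<open>'k\<close>, and every element of \<open>'k\<close> is a quotient of elements of \<open>D\<close>. All (fractional) ideals are
  subsets of \<open>'k\<close>.\<close>

locale domain_in_fraction_field =
  fixes D :: "'k::field set"
  assumes one_mem: "1 \<in> D"
    and diff_mem: "a \<in> D \<Longrightarrow> b \<in> D \<Longrightarrow> a - b \<in> D"
    and mult_mem: "a \<in> D \<Longrightarrow> b \<in> D \<Longrightarrow> a * b \<in> D"
    and fraction: "\<exists>a\<in>D. \<exists>b\<in>D. b \<noteq> 0 \<and> x = a / b"

definition submod :: "'k::field set \<Rightarrow> 'k set \<Rightarrow> bool" where
  "submod D I \<longleftrightarrow> 0 \<in> I \<and> (\<forall>x\<in>I. \<forall>y\<in>I. x + y \<in> I) \<and> (\<forall>d\<in>D. \<forall>x\<in>I. d * x \<in> I)"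

definition frac_ideal :: "'k::field set \<Rightarrow> 'k set \<Rightarrow> bool" where
  "frac_ideal D I \<longleftrightarrow> submod D I \<and> (\<exists>d\<in>D. d \<noteq> 0 \<and> (\<forall>x\<in>I. d * x \<in> D))"

text \<open>The set \<open>\<F>(D)\<close> of nonzero (fractional) ideals.\<close>

definition nz_ideals :: "'k::field set \<Rightarrow> 'k set set" where
  "nz_ideals D = {I. frac_ideal D I \<and> I \<noteq> {0}}"

definition fin_gen :: "'k::field set \<Rightarrow> 'k set \<Rightarrow> bool" where
  "fin_gen D I \<longleftrightarrow> (\<exists>A. finite A \<and> I = submod D hull A)"

definition ideal_prod :: "'k::field set \<Rightarrow> 'k set \<Rightarrow> 'k set \<Rightarrow> 'k set" where
  "ideal_prod D I J = submod D hull {x * y | x y. x \<in> I \<and> y \<in> J}"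

text \<open>The ideal quotient \<open>(J : I)\<close>, taken in the field of fractions.\<close>

definition colon :: "'k::field set \<Rightarrow> 'k set \<Rightarrow> 'k set" where
  "colon J I = {x. \<forall>y\<in>I. x * y \<in> J}"

definition v_closure :: "'k::field set \<Rightarrow> 'k set \<Rightarrow> 'k set" where
  "v_closure D I = colon D (colon D I)"

definition divisorial :: "'k::field set \<Rightarrow> 'k set \<Rightarrow> bool" where
  "divisorial D I \<longleftrightarrow> I \<in> nz_ideals D \<and> I = v_closure D I"

definition t_closure :: "'k::field set \<Rightarrow> 'k set \<Rightarrow> 'k set" where
  "t_closure D I = \<Union>{v_closure D J | J. J \<in> nz_ideals D \<and> fin_gen D J \<and> J \<subseteq> I}"

definition t_ideal :: "'k::field set \<Rightarrow> 'k set \<Rightarrow> bool" where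
  "t_ideal D I \<longleftrightarrow> I \<in> nz_ideals D \<and> I = t_closure D I"

text \<open>Prime ideals of \<open>D\<close> in the usual sense, the zero ideal included.\<close>

definition prime_ideal :: "'k::field set \<Rightarrow> 'k set \<Rightarrow> bool" where
  "prime_ideal D P \<longleftrightarrow> submod D P \<and> P \<subset> D \<and>
     (\<forall>a\<in>D. \<forall>b\<in>D. a * b \<in> P \<longrightarrow> a \<in> P \<or> b \<in> P)"

definition t_prime :: "'k::field set \<Rightarrow> 'k set \<Rightarrow> bool" where
  "t_prime D P \<longleftrightarrow> prime_ideal D P \<and> t_ideal D P"

definition t_Max :: "'k::field set \<Rightarrow> 'k set set" where
  "t_Max D = {M. t_ideal D M \<and> M \<subset> D \<and> (\<forall>N. t_ideal D N \<and> N \<subset> D \<and> M \<subseteq> N \<longrightarrow> N = M)}"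

definition localization :: "'k::field set \<Rightarrow> 'k set \<Rightarrow> 'k set" where
  "localization D M = {a / s | a s. a \<in> D \<and> s \<in> D - M}"

definition w_closure :: "'k::field set \<Rightarrow> 'k set \<Rightarrow> 'k set" where
  "w_closure D I = (\<Inter>M\<in>t_Max D. ideal_prod D I (localization D M))"

definition w_stable_ideal :: "'k::field set \<Rightarrow> 'k set \<Rightarrow> bool" where
  "w_stable_ideal D I \<longleftrightarrow>
     (let Iw = w_closure D I; E = colon Iw Iw
      in w_closure D (ideal_prod D Iw (colon E Iw)) = E)"

definition w_stable :: "'k::field set \<Rightarrow> bool" where
  "w_stable D \<longleftrightarrow> (\<forall>I\<in>nz_ideals D. w_stable_ideal D I)"

definition w_regular_ideal :: "'k::field set \<Rightarrow> 'k set \<Rightarrow> bool" where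
  "w_regular_ideal D I \<longleftrightarrow>
     (\<exists>J\<in>nz_ideals D. w_closure D I = w_closure D (ideal_prod D (ideal_prod D I I) J))"

definition clifford_w_regular :: "'k::field set \<Rightarrow> bool" where
  "clifford_w_regular D \<longleftrightarrow> (\<forall>I\<in>nz_ideals D. w_regular_ideal D I)"

text \<open>The supremum of the lengths \<open>n\<close> of chains \<open>C 0 \<subset> \<dots> \<subset> C n = P\<close> of prime ideals.\<close>

definition height :: "'k::field set \<Rightarrow> 'k set \<Rightarrow> enat" where
  "height D P = Sup {enat n | n. \<exists>C. (\<forall>i\<le>n. prime_ideal D (C i)) \<and>
                                      (\<forall>i<n. C i \<subset> C (Suc i)) \<and> C n = P}"

definition t_dimension_one :: "'k::field set \<Rightarrow> bool" where
  "t_dimension_one D \<longleftrightarrow> (\<forall>P. t_prime D P \<longrightarrow> height D P = 1)"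

definition mori :: "'k::field set \<Rightarrow> bool" where
  "mori D \<longleftrightarrow> (\<forall>I :: nat \<Rightarrow> 'k set.
     (\<forall>n. divisorial D (I n) \<and> I n \<subseteq> D) \<and> (\<forall>n. I n \<subseteq> I (Suc n)) \<longrightarrow>
     (\<exists>N. \<forall>n\<ge>N. I n = I N))"

end

theory Submission imports Defs begin

text \<open>Stability and regularity pass to the localizations \<open>R = D\<^sub>M\<close> at the t-maximal ideals, where the
  \<open>w\<close>-operation disappears. In a local domain \<open>R\<close> all of whose ideals \<open>I\<close> satisfy \<open>I = I\<^sup>2((I : I) : I)\<close>, the
  Mori property forces dimension one. In dimension one every fractional overring is quadratic over \<open>R\<close>, which
  gives a Nakayama lemma for finitely generated ideals of such overrings acting on arbitrary fractional
  ideals. That lemma implies both that regular Mori domains are stable and that stable domains are Mori.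

  To return to \<open>D\<close> one needs that a nonzero element lies in only finitely many t-maximal ideals. In
  t-dimension one this holds as soon as each t-maximal \<open>M\<close> contains a finite set lying in no other t-maximal
  ideal; such a set exists because \<open>M\<close> is divisorial and v-finite (Mori case), or because \<open>M\<close> is invertible in
  \<open>(M : M)\<close>, which is contained in \<open>D\<^sub>N\<close> for \<open>N \<noteq> M\<close> (w-stable case).\<close>
section \<open>Products and colons of additive subgroups\<close>

text \<open>The ideals at hand need not be finitely generated over their base ring, so the
  determinant trick is out of reach: the Mori property controls ideals only up to v-closure, and
  stability gives generators only over (I : I), a ring that is unknown at first. The way around is
  that \<open>nakayama\<close> asks for finitely many multipliers \<open>Y\<close>, not for finitely
  many generators of the module \<open>A\<close>; the price is that the multiplier ring be quadratic
  over \<open>R\<close>. Finitely many multipliers are easy to get, since an equation such as 1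
  \<in> I J involves only finitely many elements of I. Quadraticity rests on dimension one, so
  dimension one has to be derived beforehand from regularity and chain conditions, without
  \<open>nakayama\<close>. The second obstacle is that colons do not commute with localization when
  ideals are not finitely generated. Passing to D_M uses only inclusions that always hold; the way
  back needs elements clearing denominators at all t-maximal ideals but one, and these are obtained
  from finite character.\<close>

inductive_set mprod :: "'k::field set \<Rightarrow> 'k set \<Rightarrow> 'k set" (infixl "\<star>" 70)
  for I J where
  zero: "0 \<in> I \<star> J"
| step: "a \<in> I \<Longrightarrow> b \<in> J \<Longrightarrow> z \<in> I \<star> J \<Longrightarrow> a * b + z \<in> I \<star> J"

text \<open>Closure under negation is not demanded: \<open>mprod_least\<close> does not need it, and
  for modules over a subring the element -1 supplies it (\<open>submod_diff\<close>).\<close>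

definition addsub :: "'k::field set \<Rightarrow> bool" where
  "addsub X \<longleftrightarrow> 0 \<in> X \<and> (\<forall>x\<in>X. \<forall>y\<in>X. x + y \<in> X)"

definition subring :: "'k::field set \<Rightarrow> bool" where
  "subring R \<longleftrightarrow> 1 \<in> R \<and> (\<forall>a\<in>R. \<forall>b\<in>R. a - b \<in> R) \<and> (\<forall>a\<in>R. \<forall>b\<in>R. a * b \<in> R)"

lemma mprodI: "a \<in> I \<Longrightarrow> b \<in> J \<Longrightarrow> a * b \<in> I \<star> J"
  using mprod.step[OF _ _ mprod.zero] by force

lemma mprod_add: "x \<in> I \<star> J \<Longrightarrow> y \<in> I \<star> J \<Longrightarrow> x + y \<in> I \<star> J"
  by (induction rule: mprod.induct) (auto simp: add.assoc intro: mprod.step)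

lemma addsub_mprod: "addsub (I \<star> J)"
  by (auto simp: addsub_def mprod.zero intro: mprod_add)

lemma addsub_add: "addsub X \<Longrightarrow> x \<in> X \<Longrightarrow> y \<in> X \<Longrightarrow> x + y \<in> X"
  by (auto simp: addsub_def)

lemma mprod_least:
  assumes "addsub L" "\<And>a b. a \<in> I \<Longrightarrow> b \<in> J \<Longrightarrow> a * b \<in> L"
  shows "I \<star> J \<subseteq> L"
proof
  fix z assume "z \<in> I \<star> J"
  then show "z \<in> L"
    by (induction rule: mprod.induct) (use assms in \<open>auto simp: addsub_def\<close>)
qed

lemma mprod_mono: "I \<subseteq> I' \<Longrightarrow> J \<subseteq> J' \<Longrightarrow> I \<star> J \<subseteq> I' \<star> J'"
  by (rule mprod_least) (auto intro: addsub_mprod mprodI)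

lemma mprod_comm: "I \<star> J = J \<star> I"
proof -
  have "A \<star> B \<subseteq> B \<star> A" for A B :: "'a set"
  proof (rule mprod_least[OF addsub_mprod])
    fix a b assume "a \<in> A" "b \<in> B"
    then show "a * b \<in> B \<star> A" using mprodI[of b B a A] by (simp add: mult.commute)
  qed
  then show ?thesis by blast
qed

lemma mprod_map:
  assumes "z \<in> I \<star> J" "\<And>a. a \<in> I \<Longrightarrow> d * a \<in> I'"
  shows "d * z \<in> I' \<star> J"
  using assms(1)
proof (induction rule: mprod.induct)
  case zero then show ?case by (simp add: mprod.zero)
next
  case (step a b z)
  have "(d * a) * b + d * z \<in> I' \<star> J"
    by (rule mprod.step) (use step assms(2) in auto)
  then show ?case by (simp add: algebra_simps)
qed

lemma mprod_assoc: "(I \<star> J) \<star> L = I \<star> (J \<star> L)"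
proof -
  have 1: "(A \<star> B) \<star> C \<subseteq> A \<star> (B \<star> C)" for A B C :: "'a set"
  proof (rule mprod_least[OF addsub_mprod])
    fix z c assume z: "z \<in> A \<star> B" and c: "c \<in> C"
    have "z \<in> B \<star> A" using z mprod_comm by blast
    then have "c * z \<in> (B \<star> C) \<star> A"
      by (rule mprod_map) (use c in \<open>metis mprodI mult.commute\<close>)
    then show "z * c \<in> A \<star> (B \<star> C)" by (simp add: mprod_comm mult.commute)
  qed
  have "I \<star> (J \<star> L) = (L \<star> J) \<star> I" by (simp add: mprod_comm)
  also have "\<dots> \<subseteq> L \<star> (J \<star> I)" by (rule 1)
  also have "\<dots> = (I \<star> J) \<star> L" by (simp add: mprod_comm)
  finally show ?thesis using 1 by blast
qed

lemma mprod_left_comm: "I \<star> (J \<star> L) = J \<star> (I \<star> L)"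
  by (metis mprod_assoc mprod_comm)

lemmas mprod_ac = mprod_assoc mprod_comm mprod_left_comm

lemma mprod_finite:
  assumes "z \<in> I \<star> J"
  shows "\<exists>A B. finite A \<and> finite B \<and> A \<subseteq> I \<and> B \<subseteq> J \<and> z \<in> A \<star> B"
  using assms
proof (induction rule: mprod.induct)
  case zero
  have "0 \<in> {} \<star> ({}::'a set)" by (rule mprod.zero)
  then show ?case by blast
next
  case (step a b z)
  then obtain A B where "finite A" "finite B" "A \<subseteq> I" "B \<subseteq> J" "z \<in> A \<star> B" by blast
  moreover from this have "z \<in> insert a A \<star> insert b B"
    using mprod_mono[of A "insert a A" B "insert b B"] by blast
  then have "a * b + z \<in> insert a A \<star> insert b B" by (intro mprod.step) auto
  ultimately show ?case using step.hyps
    by (intro exI[of _ "insert a A"] exI[of _ "insert b B"]) auto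
qed

text \<open>Elements of a product are finite sums, so a finite set in it involves only finitely many
  elements of the first factor. Most of the finite multiplier sets handed to \<open>nakayama\<close>
  arise this way.\<close>

lemma mprod_finite_set:
  assumes "finite G" "G \<subseteq> I \<star> J"
  shows "\<exists>A. finite A \<and> A \<subseteq> I \<and> G \<subseteq> A \<star> J"
  using assms
proof (induction rule: finite_induct)
  case empty then show ?case by blast
next
  case (insert g G)
  then obtain A where A: "finite A" "A \<subseteq> I" "G \<subseteq> A \<star> J" by auto
  obtain A' B where A': "finite A'" "A' \<subseteq> I" "B \<subseteq> J" "g \<in> A' \<star> B"
    using mprod_finite[of g I J] insert.prems by auto
  have "G \<subseteq> (A \<union> A') \<star> J" "g \<in> (A \<union> A') \<star> J"
    using A A' mprod_mono[of A "A \<union> A'" J J] mprod_mono[of A' "A \<union> A'" B J] by blast+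
  then show ?case using A A' by (intro exI[of _ "A \<union> A'"]) auto
qed

section \<open>Modules over subrings of the fraction field\<close>

lemma submodD:
  assumes "submod R I"
  shows "addsub I" "0 \<in> I" "x \<in> I \<Longrightarrow> y \<in> I \<Longrightarrow> x + y \<in> I" "d \<in> R \<Longrightarrow> x \<in> I \<Longrightarrow> d * x \<in> I"
    "d \<in> R \<Longrightarrow> x \<in> I \<Longrightarrow> x * d \<in> I"
  using assms by (auto simp: submod_def addsub_def mult.commute)

lemma submodI: "addsub I \<Longrightarrow> (\<And>d x. d \<in> R \<Longrightarrow> x \<in> I \<Longrightarrow> d * x \<in> I) \<Longrightarrow> submod R I"
  by (auto simp: submod_def addsub_def)

lemma subringD:
  assumes "subring R"
  shows "1 \<in> R" "0 \<in> R" "- 1 \<in> R" "a \<in> R \<Longrightarrow> b \<in> R \<Longrightarrow> a - b \<in> R" "a \<in> R \<Longrightarrow> b \<in> R \<Longrightarrow> a + b \<in> R"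
    "a \<in> R \<Longrightarrow> b \<in> R \<Longrightarrow> a * b \<in> R" "a \<in> R \<Longrightarrow> - a \<in> R" "a \<in> R \<Longrightarrow> a ^ n \<in> R"
proof -
  show 1: "1 \<in> R" and d: "a \<in> R \<Longrightarrow> b \<in> R \<Longrightarrow> a - b \<in> R" and m: "a \<in> R \<Longrightarrow> b \<in> R \<Longrightarrow> a * b \<in> R" for a b
    using assms by (auto simp: subring_def)
  show z: "0 \<in> R" using d[OF 1 1] by simp
  show n: "a \<in> R \<Longrightarrow> - a \<in> R" for a using d[OF z] by force
  show "- 1 \<in> R" using n 1 by blast
  show "a \<in> R \<Longrightarrow> b \<in> R \<Longrightarrow> a + b \<in> R" using d[of a "-b"] n[of b] by simp
  show "a \<in> R \<Longrightarrow> a ^ n \<in> R" by (induction n) (use 1 m in auto)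
qed

lemma subring_submod: "subring R \<Longrightarrow> submod R R"
  by (auto simp: submod_def intro: subringD)

lemma submod_antimono: "submod B I \<Longrightarrow> R \<subseteq> B \<Longrightarrow> submod R I"
  by (auto simp: submod_def)

lemma submod_diff: "subring R \<Longrightarrow> submod R I \<Longrightarrow> x \<in> I \<Longrightarrow> y \<in> I \<Longrightarrow> x - y \<in> I"
  using submodD(3)[of R I x "-y"] submodD(4)[of R I "-1" y] subringD(3)[of R] by simp

lemma submod_mprod_left: "submod R I \<Longrightarrow> submod R (I \<star> J)"
  by (rule submodI[OF addsub_mprod]) (auto intro: mprod_map submodD)

lemma submod_mprod_right: "submod R J \<Longrightarrow> submod R (I \<star> J)"
  using submod_mprod_left[of R J I] by (simp add: mprod_comm)

lemma mprod_submod_subset: "submod R I \<Longrightarrow> R \<star> I \<subseteq> I"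
  by (rule mprod_least) (auto intro: submodD)

lemma mprod_one_subset: "1 \<in> R \<Longrightarrow> I \<subseteq> R \<star> I"
  using mprodI[of 1 R _ I] by auto

lemma mprod_one_subset_right: "1 \<in> R \<Longrightarrow> I \<subseteq> I \<star> R"
  using mprodI[of _ I 1 R] by auto

lemma mprod_submod: "1 \<in> R \<Longrightarrow> submod R I \<Longrightarrow> R \<star> I = I"
  using mprod_submod_subset mprod_one_subset by blast

lemma submod_Inter: "(\<And>X. X \<in> \<X> \<Longrightarrow> submod R X) \<Longrightarrow> submod R (\<Inter>\<X>)"
  by (auto simp: submod_def)

lemma hull_eq_mprod:
  assumes "subring R"
  shows "submod R hull A = R \<star> A"
proof (rule hull_unique)
  show "A \<subseteq> R \<star> A" using assms by (intro mprod_one_subset subringD)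
  show "submod R (R \<star> A)" by (rule submod_mprod_left[OF subring_submod[OF assms]])
  show "R \<star> A \<subseteq> B" if "A \<subseteq> B" "submod R B" for B
    by (rule mprod_least) (use that in \<open>auto intro: submodD\<close>)
qed

text \<open>The product \<open>\<star>\<close> mentions no base ring. One commutative and
  associative operation therefore covers products of ideals over D and over its overrings, the
  generated module \<open>R \<star> A\<close>, and the extension of an ideal to a
  localization.\<close>

lemma ideal_prod_eq_mprod:
  assumes "subring R" "submod R I"
  shows "ideal_prod R I J = I \<star> J"
  unfolding ideal_prod_def
proof (rule hull_unique)
  show "{x * y |x y. x \<in> I \<and> y \<in> J} \<subseteq> I \<star> J" by (auto intro: mprodI)
  show "submod R (I \<star> J)" by (rule submod_mprod_left[OF assms(2)])
  show "I \<star> J \<subseteq> B" if "{x * y |x y. x \<in> I \<and> y \<in> J} \<subseteq> B" "submod R B" for B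
    by (rule mprod_least) (use that in \<open>auto intro: submodD\<close>)
qed

section \<open>Colons and endomorphism rings\<close>

lemma colonI: "(\<And>y. y \<in> I \<Longrightarrow> x * y \<in> J) \<Longrightarrow> x \<in> colon J I"
  and colonD: "x \<in> colon J I \<Longrightarrow> y \<in> I \<Longrightarrow> x * y \<in> J"
  by (auto simp: colon_def)

lemma colonD': "x \<in> colon J I \<Longrightarrow> y \<in> I \<Longrightarrow> y * x \<in> J"
  by (auto simp: colon_def mult.commute)

lemma colon_mono: "J \<subseteq> J' \<Longrightarrow> I' \<subseteq> I \<Longrightarrow> colon J I \<subseteq> colon J' I'"
  by (auto simp: colon_def)

lemma addsub_colon: "addsub J \<Longrightarrow> addsub (colon J I)"
  by (auto simp: addsub_def colon_def distrib_right)

lemma submod_colon: "submod R J \<Longrightarrow> submod R (colon J I)"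
  by (rule submodI[OF addsub_colon]) (auto simp: colon_def mult.assoc intro: submodD)

text \<open>The scalars act through the denominator I, while J is merely additive. This makes the
  conductor (R : E) an E-module although R need not be one.\<close>

lemma submod_colon':
  assumes "addsub J" "submod R I" shows "submod R (colon J I)"
proof (rule submodI[OF addsub_colon[OF assms(1)]], rule colonI)
  fix d x y assume "d \<in> R" "x \<in> colon J I" "y \<in> I"
  then have "x * (d * y) \<in> J" using submodD(4)[OF assms(2)] by (blast intro: colonD)
  then show "d * x * y \<in> J" by (simp add: mult_ac)
qed

lemma colon_mprod_subset: "addsub J \<Longrightarrow> colon J I \<star> I \<subseteq> J"
  by (rule mprod_least) (auto intro: colonD)

lemma mprod_subset_colon: "X \<star> I \<subseteq> J \<Longrightarrow> X \<subseteq> colon J I"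
  by (auto intro!: colonI dest: mprodI)

text \<open>Adjunction between product and colon: iterated colons become a colon by a product, whose
  factors may then be exchanged.\<close>

lemma colon_colon: 
  assumes "addsub L" shows "colon (colon L I) J = colon L (I \<star> J)"
proof
  show "colon (colon L I) J \<subseteq> colon L (I \<star> J)"
  proof
    fix z assume z: "z \<in> colon (colon L I) J"
    have "I \<star> J \<subseteq> {w. z * w \<in> L}"
    proof (rule mprod_least)
      show "addsub {w. z * w \<in> L}" using assms by (auto simp: addsub_def distrib_left)
      show "a * b \<in> {w. z * w \<in> L}" if "a \<in> I" "b \<in> J" for a b
        using colonD[OF colonD[OF z that(2)] that(1)] by (simp add: mult_ac)
    qed
    then show "z \<in> colon L (I \<star> J)" by (auto simp: colon_def)
  qed
  show "colon L (I \<star> J) \<subseteq> colon (colon L I) J"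
  proof (intro subsetI colonI)
    fix z b a assume "z \<in> colon L (I \<star> J)" "b \<in> J" "a \<in> I"
    then show "z * b * a \<in> L" using colonD[OF _ mprodI[of a I b J], of z L] by (simp add: mult_ac)
  qed
qed

lemma colon_mprod_ring:
  assumes "subring R" shows "colon R (R \<star> A) = colon R A"
proof
  show "colon R (R \<star> A) \<subseteq> colon R A"
    by (rule colon_mono) (use mprod_one_subset[of R A] subringD[OF assms] in auto)
  have "addsub R" using subring_submod[OF assms] submodD by blast
  then have "colon R (R \<star> A) = colon (colon R A) R" by (simp add: colon_colon mprod_comm)
  moreover have "submod R (colon R A)" by (rule submod_colon[OF subring_submod[OF assms]])
  ultimately show "colon R A \<subseteq> colon R (R \<star> A)"
    by (metis colonI submodD(5) subsetI)
qed

lemma subring_colon_self: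
  assumes "subring R" "submod R I" shows "subring (colon I I)" "R \<subseteq> colon I I"
proof -
  show "subring (colon I I)"
    using assms submod_diff[OF assms] by (auto simp: subring_def colon_def algebra_simps)
  show "R \<subseteq> colon I I" using submodD(4)[OF assms(2)] by (auto simp: colon_def)
qed

lemma submod_colon_self: "addsub I \<Longrightarrow> submod (colon I I) I"
  by (rule submodI) (auto dest: colonD)

lemma colon_double: "A \<subseteq> colon R (colon R A)"
  by (auto simp: colon_def mult.commute)

lemma colon_triple: "colon R (colon R (colon R A)) = colon R A"
  using colon_double[of A R] colon_double[of "colon R A" R] by (auto simp: colon_def)

section \<open>One-dimensional local domains\<close>

definition nonunits :: "'k::field set \<Rightarrow> 'k set" where
  "nonunits R = {x \<in> R. x = 0 \<or> inverse x \<notin> R}"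

text \<open>For a local domain: the Krull dimension is at most one.\<close>

definition dimension_one :: "'k::field set \<Rightarrow> bool" where
  "dimension_one R \<longleftrightarrow> (\<forall>x\<in>nonunits R. \<forall>c\<in>R. c \<noteq> 0 \<longrightarrow> (\<exists>n. x ^ n / c \<in> R))"

text \<open>Integrality of degree two: two coefficients are few enough for the explicit case
  distinction in \<open>nilpotent_up_to_unit\<close>.\<close>

definition quadratic :: "'k::field set \<Rightarrow> 'k \<Rightarrow> bool" where
  "quadratic R b \<longleftrightarrow> (\<exists>r\<in>R. \<exists>s\<in>R. b * b = r * b + s)"

definition stable :: "'k::field set \<Rightarrow> bool" where
  "stable R \<longleftrightarrow> (\<forall>I\<in>nz_ideals R. 1 \<in> I \<star> colon (colon I I) I)"

text \<open>If \<open>I = I\<^sup>2 J\<close> for some \<open>J\<close>, then \<open>J \<subseteq> ((I : I) : I)\<close>, so \<open>J\<close> may be taken to be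
  \<open>((I : I) : I)\<close>.\<close>

definition regular :: "'k::field set \<Rightarrow> bool" where
  "regular R \<longleftrightarrow> (\<forall>I\<in>nz_ideals R. I \<subseteq> I \<star> (I \<star> colon (colon I I) I))"

text \<open>The form of the Mori condition that passes to localizations. Equal colons into R amount
  to equal v-closures, by \<open>colon_triple\<close>.\<close>

definition v_finite :: "'k::field set \<Rightarrow> bool" where
  "v_finite R \<longleftrightarrow> (\<forall>I\<in>nz_ideals R. \<exists>A\<subseteq>I. finite A \<and> colon R A = colon R I)"

definition frac_overring :: "'k::field set \<Rightarrow> 'k set \<Rightarrow> bool" where
  "frac_overring R E \<longleftrightarrow> subring E \<and> R \<subseteq> E \<and> (\<exists>d. d \<noteq> 0 \<and> (\<forall>x\<in>E. d * x \<in> R))"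

lemma mprod_insert:
  assumes "addsub A" "z \<in> insert y F \<star> A"
  shows "\<exists>a\<in>A. \<exists>w\<in>F \<star> A. z = y * a + w"
  using assms(2)
proof (induction rule: mprod.induct)
  case zero
  show ?case using assms(1) by (intro bexI[of _ 0]) (auto simp: addsub_def mprod.zero)
next
  case (step a b z)
  then obtain a' w where z: "a' \<in> A" "w \<in> F \<star> A" "z = y * a' + w" by blast
  show ?case
  proof (cases "a = y")
    case True
    then show ?thesis using z step addsub_add[OF assms(1)]
      by (intro bexI[of _ "b + a'"] bexI[of _ w]) (auto simp: algebra_simps)
  next
    case False
    then show ?thesis using z step
      by (intro bexI[of _ a'] bexI[of _ "a * b + w"])
        (auto simp: add.left_commute intro: mprod.step)
  qed
qed

text \<open>For w = 1: if x and z are nilpotent modulo cB, so is x + z. The multiplier w replaces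
  the binomial theorem: one factor x + z is split, and its summand x or z is moved into w.\<close>

lemma divisible_power_add:
  fixes c :: "'k::field"
  assumes B: "subring B" and "x \<in> B" "z \<in> B"
  shows "w \<in> B \<Longrightarrow> w * x ^ i / c \<in> B \<Longrightarrow> w * z ^ j / c \<in> B \<Longrightarrow> w * (x + z) ^ (i + j) / c \<in> B"
proof (induction "i + j" arbitrary: i j w rule: less_induct)
  case less
  have xz: "x + z \<in> B" using assms by (blast intro: subringD)
  show ?case
  proof (cases "i = 0 \<or> j = 0")
    case True
    then have "w / c \<in> B" using less.prems by auto
    then have "w / c * (x + z) ^ (i + j) \<in> B" using xz B by (blast intro: subringD)
    then show ?thesis by (simp add: field_simps)
  next
    case False
    then obtain i' j' where ij: "i = Suc i'" "j = Suc j'" by (meson not0_implies_Suc)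
    have mem: "w * x \<in> B" "w * z \<in> B" using less.prems assms by (blast intro: subringD)+
    have "x * (w * z ^ j / c) \<in> B" "z * (w * x ^ i / c) \<in> B"
      using less.prems assms by (blast intro: subringD)+
    then have "(w * x) * (x + z) ^ (i' + j) / c \<in> B" "(w * z) * (x + z) ^ (i + j') / c \<in> B"
      using less.hyps[of i' j "w * x"] less.hyps[of i j' "w * z"] less.prems(2,3) ij mem
      by (simp_all add: mult_ac)
    then have "(w * x) * (x + z) ^ (i' + j) / c + (w * z) * (x + z) ^ (i + j') / c \<in> B"
      using B by (blast intro: subringD)
    moreover have "w * (x + z) ^ (i + j) / c =
        (w * x) * (x + z) ^ (i' + j) / c + (w * z) * (x + z) ^ (i + j') / c"
      by (simp add: ij add_divide_distrib[symmetric] algebra_simps)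
    ultimately show ?thesis by simp
  qed
qed

lemma frac_overring_colon_self:
  assumes "subring R" "I \<in> nz_ideals R"
  shows "frac_overring R (colon I I)"
proof -
  obtain d where I: "submod R I" "I \<noteq> {0}" and d: "d \<noteq> 0" "\<forall>x\<in>I. d * x \<in> R"
    using assms(2) by (auto simp: nz_ideals_def frac_ideal_def)
  obtain a where a: "a \<in> I" "a \<noteq> 0" using I submodD(2)[OF I(1)] by auto
  have "d * a * x \<in> R" if "x \<in> colon I I" for x
  proof -
    have "d * (x * a) \<in> R" using colonD[OF that a(1)] d(2) by blast
    then show ?thesis by (simp add: mult_ac)
  qed
  then show ?thesis unfolding frac_overring_def
    using subring_colon_self[OF assms(1) I(1)] d(1) a(2)
    by (intro conjI exI[of _ "d * a"]) auto
qed

lemma stable_imp_regular: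
  assumes "stable R" shows "regular R"
  unfolding regular_def
proof
  fix I assume "I \<in> nz_ideals R"
  then have "1 \<in> I \<star> colon (colon I I) I" using assms by (auto simp: stable_def)
  then show "I \<subseteq> I \<star> (I \<star> colon (colon I I) I)"
    using mprod_one_subset[of _ I] by (subst mprod_comm)
qed

context domain_in_fraction_field
begin

lemma D_subring: "subring D"
  using one_mem diff_mem mult_mem by (auto simp: subring_def)

lemmas Ds = subringD[OF D_subring]

lemma D_submod: "submod D D" by (rule subring_submod[OF D_subring])

lemma addsub_D: "addsub D" by (rule submodD[OF D_submod])

text \<open>The denominator d may be any nonzero element of the field; if d = p/q, then p = q d is a
  denominator in D.\<close>

lemma nz_idealI:
  assumes "submod D I" "a \<in> I" "a \<noteq> 0" "d \<noteq> 0" "\<And>x. x \<in> I \<Longrightarrow> d * x \<in> D"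
  shows "I \<in> nz_ideals D"
proof -
  obtain p q where pq: "p \<in> D" "q \<in> D" "q \<noteq> 0" "d = p / q" using fraction by blast
  have "p * x \<in> D" if "x \<in> I" for x
  proof -
    have "q * (d * x) \<in> D" using assms(5)[OF that] pq Ds by blast
    then show ?thesis using pq by simp
  qed
  moreover have "p \<noteq> 0" using pq assms by auto
  ultimately show ?thesis using assms pq by (auto simp: nz_ideals_def frac_ideal_def)
qed

lemma nz_idealE:
  assumes "I \<in> nz_ideals D"
  obtains a d where "submod D I" "a \<in> I" "a \<noteq> 0" "d \<in> D" "d \<noteq> 0" "\<And>x. x \<in> I \<Longrightarrow> d * x \<in> D"
proof -
  obtain d where I: "submod D I" "I \<noteq> {0}" and d: "d \<in> D" "d \<noteq> 0" "\<forall>x\<in>I. d * x \<in> D"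
    using assms by (auto simp: nz_ideals_def frac_ideal_def)
  obtain a where a: "a \<in> I" "a \<noteq> 0" using I submodD(2)[OF I(1)] by auto
  show thesis using that I d a by blast
qed

end

locale local_domain = domain_in_fraction_field R for R :: "'k::field set" +
  assumes nonunits_add: "x \<in> nonunits R \<Longrightarrow> y \<in> nonunits R \<Longrightarrow> x + y \<in> nonunits R"
begin

lemmas R = D_subring and Rs = Ds and R_submod = D_submod and addsub_R = addsub_D

lemma nonunits_mult: "r \<in> R \<Longrightarrow> n \<in> nonunits R \<Longrightarrow> r * n \<in> nonunits R"
proof -
  assume a: "r \<in> R" "n \<in> nonunits R"
  have "inverse n \<in> R" if "r * n \<noteq> 0" "inverse (r * n) \<in> R"
  proof -
    have "r * inverse (r * n) \<in> R" using a that Rs by blast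
    then show ?thesis using that by (simp add: field_simps)
  qed
  then show ?thesis using a Rs by (auto simp: nonunits_def)
qed

lemma zero_nonunit: "0 \<in> nonunits R" and one_not_nonunit: "1 \<notin> nonunits R"
  using Rs(1,2) by (simp_all add: nonunits_def)

lemma unitD: "x \<in> R \<Longrightarrow> x \<notin> nonunits R \<Longrightarrow> x \<noteq> 0" "x \<in> R \<Longrightarrow> x \<notin> nonunits R \<Longrightarrow> inverse x \<in> R"
  by (auto simp: nonunits_def)

lemma one_minus_nonunit:
  assumes "n \<in> nonunits R" shows "1 - n \<in> R" "1 - n \<noteq> 0" "inverse (1 - n) \<in> R"
proof -
  show 1: "1 - n \<in> R" using assms Rs by (auto simp: nonunits_def)
  have "1 - n \<notin> nonunits R" 
  proof
    assume "1 - n \<in> nonunits R"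
    from nonunits_add[OF assms this] one_not_nonunit show False by simp
  qed
  then show "1 - n \<noteq> 0" "inverse (1 - n) \<in> R" using unitD[OF 1] by auto
qed

text \<open>Let y^2 = r y + s. Since y (y - r) = s and Y B is proper, s is a nonunit. If r is a
  nonunit too, both summands of y^2 are nilpotent modulo c, and v = 1 works. If r is a unit, 1 - y/r
  multiplies y to -s/r, so its j-th power times y^j is a multiple of s^j, which c divides for large
  j.\<close>

lemma nilpotent_up_to_unit:
  assumes dim: "dimension_one R" and B: "subring B" "R \<subseteq> B" and Y: "y \<in> Y" "y \<in> B"
    and quad: "quadratic R y" and proper: "1 \<notin> Y \<star> B" and c: "c \<in> R" "c \<noteq> 0"
  shows "\<exists>v\<in>B. \<exists>n. v - 1 \<in> {y} \<star> B \<and> v * y ^ n / c \<in> B"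
proof -
  obtain r s where rs: "r \<in> R" "s \<in> R" "y * y = r * y + s" using quad by (auto simp: quadratic_def)
  have s: "s \<in> nonunits R"
  proof (rule ccontr)
    assume "s \<notin> nonunits R"
    then have s: "s \<noteq> 0" "inverse s \<in> R" using unitD rs by auto
    have "(y - r) * inverse s \<in> B" using s rs B Y by (blast intro: subringD)
    then have "y * ((y - r) * inverse s) \<in> Y \<star> B" by (rule mprodI[OF Y(1)])
    moreover have "y * ((y - r) * inverse s) = 1" using rs(3) s(1) by (simp add: field_simps)
    ultimately show False using proper by simp
  qed
  obtain j where j: "s ^ j / c \<in> R" using dim s c by (auto simp: dimension_one_def)
  show ?thesis
  proof (cases "r \<in> nonunits R")
    case True
    then obtain i where i: "r ^ i / c \<in> R" using dim c by (auto simp: dimension_one_def)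
    have "r ^ i / c * y ^ i \<in> B" using i B Y by (blast intro: subringD)
    then have "1 * (r * y) ^ i / c \<in> B" by (simp add: power_mult_distrib)
    moreover have "1 * s ^ j / c \<in> B" using j B by auto
    moreover have "r * y \<in> B" "s \<in> B" "1 \<in> B" using rs B Y by (blast intro: subringD)+
    ultimately have "1 * (r * y + s) ^ (i + j) / c \<in> B"
      by (intro divisible_power_add[OF B(1)]) auto
    then have "1 * y ^ (2 * (i + j)) / c \<in> B"
      by (simp only: rs(3)[symmetric] power_mult power2_eq_square)
    then show ?thesis using B(1)
      by (intro bexI[of _ 1] exI[of _ "2 * (i + j)"]) (auto simp: mprod.zero intro: subringD)
  next
    case False
    then have r: "r \<noteq> 0" "inverse r \<in> R" using unitD rs by auto
    define v where "v = 1 - y * inverse r"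
    have YB: "submod B ({y} \<star> B)" by (rule submod_mprod_right[OF subring_submod[OF B(1)]])
    have v: "v \<in> B" using r B Y by (auto simp: v_def intro!: subringD)
    have yr: "y * - inverse r \<in> {y} \<star> B" using r B by (intro mprodI) (auto intro!: subringD)
    have vn: "v ^ n - 1 \<in> {y} \<star> B" for n
    proof (induction n)
      case 0 then show ?case by (simp add: mprod.zero)
    next
      case (Suc n)
      have "v * (v ^ n - 1) + y * - inverse r \<in> {y} \<star> B"
        using Suc v yr YB by (blast intro: submodD)
      then show ?case by (simp add: v_def algebra_simps)
    qed
    have "v * y = - inverse r * s"
      using rs(3) r(1) by (simp add: v_def field_simps)
    then have "v ^ j * y ^ j / c = (- inverse r) ^ j * (s ^ j / c)"
      by (simp add: power_mult_distrib[symmetric])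
    also have "\<dots> \<in> B" using r j B by (blast intro: subringD)
    finally show ?thesis using v vn B(1) by (intro bexI[of _ "v ^ j"] exI[of _ j]) (auto intro: subringD)
  qed
qed

text \<open>The generators are eliminated one at a time. Iterating u A \<subseteq> c A + y A + F A
  gives u^n A \<subseteq> c A + y^n A + F A, and a factor v from \<open>nilpotent_up_to_unit\<close>
  absorbs y^n A into c A. All multipliers stay in 1 + Y B.\<close>

lemma absorb_generators:
  assumes dim: "dimension_one R" and B: "subring B" "R \<subseteq> B"
    and quad: "\<And>b. b \<in> B \<Longrightarrow> quadratic R b" and proper: "1 \<notin> Y \<star> B" and "Y \<subseteq> B"
    and c: "c \<in> R" "c \<noteq> 0" and A: "submod B A"
  shows "finite F \<Longrightarrow> F \<subseteq> Y \<Longrightarrow> u \<in> B \<Longrightarrow> u - 1 \<in> Y \<star> B \<Longrightarrow>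
    (\<And>x. x \<in> A \<Longrightarrow> \<exists>a\<in>A. \<exists>w\<in>F \<star> A. u * x = c * a + w) \<Longrightarrow>
    \<exists>v\<in>B. v - 1 \<in> Y \<star> B \<and> (\<forall>x\<in>A. \<exists>a\<in>A. v * x = c * a)"
proof (induction arbitrary: u rule: finite_induct)
  case empty
  have "{} \<star> A \<subseteq> {0}" by (rule mprod_least) (auto simp: addsub_def)
  then show ?case using empty by fastforce
next
  case (insert y F)
  note Bs = subringD[OF B(1)]
  have addA: "addsub A" and FA: "submod B (F \<star> A)"
    using A by (auto intro: submodD submod_mprod_right)
  have YB: "submod B (Y \<star> B)" by (rule submod_mprod_right[OF subring_submod[OF B(1)]])
  have y: "y \<in> Y" "y \<in> B" using insert.prems \<open>Y \<subseteq> B\<close> by auto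
  have step: "\<exists>a\<in>A. \<exists>a'\<in>A. \<exists>w\<in>F \<star> A. u * x = c * a + y * a' + w" if x: "x \<in> A" for x
  proof -
    obtain a w where aw: "a \<in> A" "w \<in> insert y F \<star> A" "u * x = c * a + w"
      using insert.prems(4)[OF x] by blast
    obtain a' w' where "a' \<in> A" "w' \<in> F \<star> A" "w = y * a' + w'"
      using mprod_insert[OF addA aw(2)] by blast
    then show ?thesis using aw
      by (intro bexI[of _ a] bexI[of _ a'] bexI[of _ w']) (auto simp: algebra_simps)
  qed
  have steps: "\<exists>a\<in>A. \<exists>a'\<in>A. \<exists>w\<in>F \<star> A. u ^ n * x = c * a + y ^ n * a' + w" if x: "x \<in> A" for x n
  proof (induction n)
    case 0
    show ?case using x submodD(2)[OF A]
      by (intro bexI[of _ 0] bexI[of _ x]) (auto simp: mprod.zero)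
  next
    case (Suc n)
    then obtain a a' w where 1: "a \<in> A" "a' \<in> A" "w \<in> F \<star> A" "u ^ n * x = c * a + y ^ n * a' + w"
      by blast
    obtain b b' w' where 2: "b \<in> A" "b' \<in> A" "w' \<in> F \<star> A" "u * a' = c * b + y * b' + w'"
      using step[OF 1(2)] by blast
    have "u ^ Suc n * x = u * (c * a + y ^ n * a' + w)" using 1(4) by (simp add: mult.assoc)
    also have "\<dots> = c * (u * a) + y ^ n * (u * a') + u * w" by (simp add: algebra_simps)
    also have "\<dots> = c * (u * a + y ^ n * b) + y ^ Suc n * b' + (y ^ n * w' + u * w)"
      by (simp only: 2(4)) (simp add: algebra_simps)
    finally have "u ^ Suc n * x = c * (u * a + y ^ n * b) + y ^ Suc n * b' + (y ^ n * w' + u * w)" .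
    moreover have "u * a + y ^ n * b \<in> A" "y ^ n * w' + u * w \<in> F \<star> A"
      using 1 2 insert.prems(2) y(2) A FA Bs(8) by (blast intro: submodD)+
    ultimately show ?case using 2(2) by blast
  qed
  obtain v n where v: "v \<in> B" "v - 1 \<in> {y} \<star> B" "v * y ^ n / c \<in> B"
    using nilpotent_up_to_unit[OF dim B y quad[OF y(2)] proper c] by blast
  have un: "u ^ n \<in> B" "u ^ n - 1 \<in> Y \<star> B" for n
  proof -
    show "u ^ n - 1 \<in> Y \<star> B"
    proof (induction n)
      case 0 then show ?case by (simp add: mprod.zero)
    next
      case (Suc n)
      have "u * (u ^ n - 1) + (u - 1) \<in> Y \<star> B"
        using Suc insert.prems YB by (blast intro: submodD)
      then show ?case by (simp add: algebra_simps)
    qed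
  qed (rule Bs(8)[OF insert.prems(2)])
  show ?case
  proof (rule insert.IH[of "v * u ^ n"])
    show "F \<subseteq> Y" using insert.prems(1) by auto
    show "v * u ^ n \<in> B" by (rule Bs(6)[OF v(1) un(1)])
    have "v - 1 \<in> Y \<star> B" using v(2) mprod_mono[of "{y}" Y B B] y(1) by blast
    then have "v * (u ^ n - 1) + (v - 1) \<in> Y \<star> B" using un v YB by (blast intro: submodD)
    then show "v * u ^ n - 1 \<in> Y \<star> B" by (simp add: algebra_simps)
    fix x assume "x \<in> A"
    then obtain a a' w where 1: "a \<in> A" "a' \<in> A" "w \<in> F \<star> A" "u ^ n * x = c * a + y ^ n * a' + w"
      using steps by blast
    have "v * u ^ n * x = v * (c * a + y ^ n * a' + w)"
      by (simp only: mult.assoc 1(4))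
    also have "\<dots> = c * (v * a + (v * y ^ n / c) * a') + v * w"
      using c(2) by (simp add: field_simps)
    finally have "v * u ^ n * x = c * (v * a + (v * y ^ n / c) * a') + v * w" .
    moreover have "v * a + (v * y ^ n / c) * a' \<in> A" "v * w \<in> F \<star> A"
      using 1 v A FA by (blast intro: submodD)+
    ultimately show "\<exists>a\<in>A. \<exists>w\<in>F \<star> A. v * u ^ n * x = c * a + w" by blast
  qed
qed

text \<open>A generator \<open>y\<close> is nilpotent modulo every nonzero \<open>c \<in> R\<close> up to a factor from \<open>1 + YB\<close>, so \<open>A \<subseteq> YA\<close>
  yields \<open>v \<in> 1 + YB\<close> with \<open>vA \<subseteq> cA\<close>. Choosing \<open>c\<close> so small that this forces \<open>v\<close> to be a nonunit of \<open>R\<close>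
  makes \<open>1 - v \<in> YB\<close> a unit.\<close>

lemma nakayama:
  assumes dim: "dimension_one R" and B: "subring B" "R \<subseteq> B"
    and quad: "\<And>b. b \<in> B \<Longrightarrow> quadratic R b"
    and A: "submod B A" "a \<in> A" "a \<noteq> 0" "d \<noteq> 0" "\<And>x. x \<in> A \<Longrightarrow> d * x \<in> R"
    and Y: "finite Y" "Y \<subseteq> B" "A \<subseteq> Y \<star> A"
  shows "1 \<in> Y \<star> B"
proof (rule ccontr)
  assume proper: "1 \<notin> Y \<star> B"
  note Bs = subringD[OF B(1)]
  have YB: "submod B (Y \<star> B)" by (rule submod_mprod_right[OF subring_submod[OF B(1)]])
  show False
  proof (cases "nonunits R \<subseteq> {0}")
    \<comment> \<open>Without nonzero nonunits R is the whole field and no small c is available, but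
      then any nonzero element of Y has its inverse in B.\<close>
    case True
    have "\<exists>y\<in>Y. y \<noteq> 0"
    proof (rule ccontr)
      assume "\<not> ?thesis"
      then have "Y \<star> A \<subseteq> {0}" by (intro mprod_least) (auto simp: addsub_def)
      then show False using A Y by auto
    qed
    then obtain y where y: "y \<in> Y" "y \<noteq> 0" by blast
    obtain p q where pq: "p \<in> R" "q \<in> R" "q \<noteq> 0" "inverse y = p / q" using fraction by blast
    then have "inverse q \<in> R" using True unitD(2) by blast
    then have "inverse y \<in> R" using pq(1,4) Rs(6)[of p "inverse q"] by (simp add: divide_inverse)
    then have "y * inverse y \<in> Y \<star> B" using y B by (intro mprodI) auto
    then show False using y proper by simp
  next
    case False
    then obtain n where n: "n \<in> nonunits R" "n \<noteq> 0" by auto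
    have da: "d * a \<in> R" "d * a \<noteq> 0" using A by auto
    \<comment> \<open>With the constant d a n, the equation v a = (d a n) a' reads v = (d a') n,
      where d a' lies in R and n is a nonunit.\<close>
    have c: "d * a * n \<in> R" "d * a * n \<noteq> 0" using n da Rs by (auto simp: nonunits_def)
    have "\<exists>v\<in>B. v - 1 \<in> Y \<star> B \<and> (\<forall>x\<in>A. \<exists>a'\<in>A. v * x = (d * a * n) * a')"
    proof (rule absorb_generators[OF dim B quad proper Y(2) c A(1) Y(1), where u = 1])
      show "\<exists>a'\<in>A. \<exists>w\<in>Y \<star> A. 1 * x = d * a * n * a' + w" if "x \<in> A" for x
        using that Y(3) submodD(2)[OF A(1)] by (intro bexI[of _ 0] bexI[of _ x]) auto
    qed (use Bs in \<open>auto simp: mprod.zero\<close>)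
    then obtain v a' where v: "v \<in> B" "v - 1 \<in> Y \<star> B" "a' \<in> A" "v * a = d * a * n * a'"
      using A(2) by blast
    have veq: "v = (d * a') * n" using v(4) A(3) by (simp add: field_simps)
    then have "v \<in> nonunits R" using nonunits_mult n A(5) v(3) by blast
    then have w: "1 - v \<noteq> 0" "inverse (1 - v) \<in> R" using one_minus_nonunit by auto
    then have "- inverse (1 - v) * (v - 1) \<in> Y \<star> B"
      using v(2) B Bs(7) by (intro submodD(4)[OF YB]) auto
    moreover have "- inverse (1 - v) * (v - 1) = 1" using w by (simp add: field_simps)
    ultimately show False using proper by simp
  qed
qed

text \<open>Regularity gives I \<subseteq> U I for the trace ideal U = I (B : I) of B = (I : I). As
  the finite set G generates I over B, finitely many elements Y of U suffice for I \<subseteq> Y I,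
  and \<open>nakayama\<close> yields 1 \<in> Y B \<subseteq> U.\<close>

lemma fin_gen_stable:
  assumes dim: "dimension_one R" and reg: "regular R" and I: "I \<in> nz_ideals R"
    and quad: "\<And>b. b \<in> colon I I \<Longrightarrow> quadratic R b"
    and G: "finite G" "G \<subseteq> I" "I \<subseteq> G \<star> colon I I"
  shows "1 \<in> I \<star> colon (colon I I) I"
proof -
  define B where "B = colon I I"
  define U where "U = I \<star> colon B I"
  obtain a d where Ia: "submod R I" "a \<in> I" "a \<noteq> 0" "d \<in> R" "d \<noteq> 0" "\<And>x. x \<in> I \<Longrightarrow> d * x \<in> R"
    using nz_idealE[OF I] by metis
  have B: "subring B" "R \<subseteq> B" using subring_colon_self[OF R Ia(1)] by (auto simp: B_def)
  have BI: "submod B I" unfolding B_def by (rule submod_colon_self) (rule submodD[OF Ia(1)])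
  have UB: "submod B U" unfolding U_def by (rule submod_mprod_left[OF BI])
  have addB: "addsub B" using B subring_submod submodD by blast
  have U: "U \<subseteq> B" using colon_mprod_subset[OF addB, of I] by (simp add: U_def mprod_comm)
  have "I \<subseteq> U \<star> I" using reg I by (auto simp: regular_def U_def B_def mprod_comm)
  then obtain Y where Y: "finite Y" "Y \<subseteq> U" "G \<subseteq> Y \<star> I" using mprod_finite_set[of G U I] G by auto
  have "I \<subseteq> (Y \<star> I) \<star> B" using G(3) mprod_mono[OF Y(3), of B B] by (auto simp: B_def)
  also have "\<dots> = Y \<star> (B \<star> I)" by (simp add: mprod_ac)
  also have "\<dots> = Y \<star> I" using mprod_submod[OF subringD(1)[OF B(1)] BI] by simp
  finally have "1 \<in> Y \<star> B"
    using Y U quad by (intro nakayama[OF dim B _ BI Ia(2,3,5,6)]) (auto simp: B_def)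
  also have "Y \<star> B \<subseteq> B \<star> U" using mprod_mono[OF Y(2), of B B] by (simp add: mprod_comm)
  also have "B \<star> U \<subseteq> U" by (rule mprod_submod_subset[OF UB])
  finally show ?thesis by (simp add: U_def B_def)
qed

text \<open>With \<open>Z = R + Rt\<close> and \<open>B = (Z : Z) \<subseteq> Z\<close>, elements of \<open>B\<close> are quadratic by Cayley--Hamilton for two
  generators. The conductor \<open>(R : E)\<close> is absorbed by \<open>(B : Z) \<subseteq> B\<close>, so \<open>(B : Z) = B\<close> and \<open>t \<in> B\<close>.\<close>

lemma frac_overring_quadratic:
  assumes dim: "dimension_one R" and reg: "regular R" and E: "frac_overring R E" and t: "t \<in> E"
  shows "quadratic R t"
proof -
  obtain d where E': "subring E" "R \<subseteq> E" and d: "d \<noteq> 0" "\<forall>x\<in>E. d * x \<in> R"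
    using E by (auto simp: frac_overring_def)
  note Es = subringD[OF E'(1)]
  define Z where "Z = {r + s * t | r s. r \<in> R \<and> s \<in> R}"
  have ZE: "Z \<subseteq> E" using t E' by (auto simp: Z_def intro!: Es)
  have Z1: "1 \<in> Z" "t \<in> Z"
    unfolding Z_def using Rs(1,2) by (auto intro: exI[of _ 0] exI[of _ 1])
      (metis add.commute add.right_neutral mult_zero_left, metis add_0 mult_1)
  have ZR: "submod R Z"
  proof (rule submodI)
    have "0 \<in> Z" unfolding Z_def using Rs(2) by (auto intro!: exI[of _ 0])
    moreover have "x + y \<in> Z" if xy: "x \<in> Z" "y \<in> Z" for x y
    proof -
      obtain r s r' s' where "r \<in> R" "s \<in> R" "x = r + s * t" "r' \<in> R" "s' \<in> R" "y = r' + s' * t"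
        using xy by (auto simp: Z_def)
      then show ?thesis unfolding Z_def using Rs(5)
        by (intro CollectI exI[of _ "r + r'"] exI[of _ "s + s'"]) (auto simp: algebra_simps)
    qed
    ultimately show "addsub Z" by (auto simp: addsub_def)
    fix e x assume ex: "e \<in> R" "x \<in> Z"
    then obtain r s where "r \<in> R" "s \<in> R" "x = r + s * t" by (auto simp: Z_def)
    then show "e * x \<in> Z" unfolding Z_def using ex Rs(6)
      by (intro CollectI exI[of _ "e * r"] exI[of _ "e * s"]) (auto simp: algebra_simps)
  qed
  have Znz: "Z \<in> nz_ideals R"
    using ZR Z1(1) d ZE by (intro nz_idealI[of Z 1 d]) auto
  define B where "B = colon Z Z"
  have B: "subring B" "R \<subseteq> B" using subring_colon_self[OF R ZR] by (auto simp: B_def)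
  have BZ: "submod B Z" unfolding B_def by (rule submod_colon_self) (rule submodD[OF ZR])
  have quad: "quadratic R b" if "b \<in> B" for b
  proof -
    have "b * 1 \<in> Z" "b * t \<in> Z" using that Z1 by (auto simp: B_def dest: colonD)
    then obtain r s r' s' where m: "r \<in> R" "s \<in> R" "r' \<in> R" "s' \<in> R"
      and b: "b = r + s * t" "b * t = r' + s' * t" by (auto simp: Z_def)
    have "(b - s') * t = r'" using b(2) by (simp add: algebra_simps)
    then have "s * ((b - s') * t) = s * r'" by simp
    then have "(b - s') * (s * t) = s * r'" by (simp add: mult_ac)
    moreover have "s * t = b - r" using b(1) by simp
    ultimately have "(b - s') * (b - r) = s * r'" by simp
    then have "b * b = (r + s') * b + (s * r' - s' * r)" by (simp add: algebra_simps)
    moreover have "r + s' \<in> R" "s * r' - s' * r \<in> R" by (simp_all add: m Rs)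
    ultimately show ?thesis unfolding quadratic_def by blast
  qed
  define Z' where "Z' = colon B Z"
  have BZ': "submod B Z'" unfolding Z'_def by (rule submod_colon[OF subring_submod[OF B(1)]])
  have "Z' \<subseteq> B" using Z1(1) by (auto simp: Z'_def dest: colonD)
  have ZG: "Z \<subseteq> {1, t} \<star> colon Z Z"
  proof
    fix x assume "x \<in> Z"
    then obtain r s where "r \<in> R" "s \<in> R" "x = 1 * r + t * s" by (auto simp: Z_def mult.commute)
    then show "x \<in> {1, t} \<star> colon Z Z" using B(2)
      by (auto simp: B_def intro!: mprod_add mprodI[of 1 _ r, simplified] mprodI)
  qed
  have "1 \<in> Z \<star> Z'" unfolding Z'_def B_def
    by (rule fin_gen_stable[OF dim reg Znz _ _ _ ZG]) (use quad Z1 in \<open>auto simp: B_def\<close>)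
  then obtain Y where Y: "finite Y" "Y \<subseteq> Z'" "1 \<in> Y \<star> Z"
    using mprod_finite_set[of "{1}" Z' Z] by (auto simp: mprod_comm)
  define A where "A = colon R E"
  have AE: "submod E A" unfolding A_def by (rule submod_colon'[OF addsub_R subring_submod[OF E'(1)]])
  have "B \<subseteq> E" using Z1(1) ZE by (auto simp: B_def dest: colonD)
  \<comment> \<open>Because Z A \<subseteq> E A \<subseteq> A, inserting 1 \<in> Y Z leaves only the
    finitely many multipliers Y in front of A.\<close>
  have "A \<subseteq> (Y \<star> Z) \<star> A" by (rule mprod_one_subset[OF Y(3)])
  also have "\<dots> = Y \<star> (Z \<star> A)" by (rule mprod_assoc)
  also have "\<dots> \<subseteq> Y \<star> A"
    using mprod_submod_subset[OF AE] mprod_mono[OF ZE, of A A] by (intro mprod_mono) auto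
  finally have AY: "A \<subseteq> Y \<star> A" .
  have "1 \<in> Y \<star> B"
  proof (rule nakayama[OF dim B quad submod_antimono[OF AE \<open>B \<subseteq> E\<close>] _ d(1) _ _ Y(1) _ AY])
    show "d \<in> A" using d by (auto simp: A_def intro: colonI)
    show "1 * x \<in> R" if "x \<in> A" for x using that Es(1) by (auto simp: A_def dest: colonD)
    show "Y \<subseteq> B" using Y \<open>Z' \<subseteq> B\<close> by blast
  qed auto
  also have "Y \<star> B \<subseteq> B \<star> Z'" using mprod_mono[OF Y(2), of B B] by (simp add: mprod_comm)
  also have "\<dots> \<subseteq> Z'" by (rule mprod_submod_subset[OF BZ'])
  \<comment> \<open>1 \<in> (B : Z) means Z \<subseteq> B, so t lies in the ring where quadraticity
    is already known.\<close>
  finally have "1 * t \<in> B" using Z1(2) unfolding Z'_def by (blast intro: colonD)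
  then show ?thesis using quad by simp
qed

end

section \<open>Stability, regularity and the Mori property in local domains\<close>

lemma finite_subset_chain:
  assumes "finite A" "A \<subseteq> (\<Union>n. L n)" "\<And>n. L n \<subseteq> L (Suc n :: nat)"
  shows "\<exists>N. A \<subseteq> L N"
  using assms(1,2)
proof (induction rule: finite_induct)
  case (insert a A)
  then obtain N M where N: "A \<subseteq> L N" "a \<in> L M" by auto
  have "L N \<subseteq> L (max N M)" "L M \<subseteq> L (max N M)" by (rule lift_Suc_mono_le[of L], rule assms(3), simp)+
  then show ?case using N by (intro exI[of _ "max N M"]) auto
qed simp

lemma submod_Union_chain:
  assumes sub: "\<And>n. submod R (L n)" and mono: "\<And>n. L n \<subseteq> L (Suc n :: nat)"
  shows "submod R (\<Union>n. L n)"
proof (rule submodI)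
  have le: "L i \<subseteq> L j" if "i \<le> j" for i j by (rule lift_Suc_mono_le[of L, OF mono that])
  have "x + y \<in> (\<Union>n. L n)" if "x \<in> L i" "y \<in> L j" for x y i j
    using that le[of i "max i j"] le[of j "max i j"] submodD(3)[OF sub, of x "max i j" y] by auto
  then show "addsub (\<Union>n. L n)" using submodD(2)[OF sub] by (auto simp: addsub_def)
qed (use sub in \<open>auto dest: submodD\<close>)

lemma colon_Un: "colon J (X \<union> Y) = colon J X \<inter> colon J Y"
  by (auto simp: colon_def)

context local_domain
begin

text \<open>The common denominator d makes the union a fractional ideal. A finite subset with the
  same colon as the union lies in some \<open>L N\<close>, and since each \<open>L n\<close> is a
  colon into R, it equals its double colon and cannot exceed \<open>L N\<close>.\<close>

lemma v_finite_stationary: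
  assumes vf: "v_finite R" and L: "\<And>n. L n = colon R (X n)" and mono: "\<And>n. L n \<subseteq> L (Suc n :: nat)"
    and d: "d \<noteq> 0" "\<And>n x. x \<in> L n \<Longrightarrow> d * x \<in> R"
  shows "\<exists>N. \<forall>n. L n \<subseteq> L N"
proof (cases "(\<Union>n. L n) \<subseteq> {0}")
  case True
  have "0 \<in> L 0" unfolding L by (rule submodD[OF submod_colon[OF R_submod]])
  then show ?thesis using True by (intro exI[of _ 0]) auto
next
  case False
  then obtain a where a: "a \<in> (\<Union>n. L n)" "a \<noteq> 0" by auto
  have sub: "submod R (L n)" for n unfolding L by (rule submod_colon[OF R_submod])
  have "submod R (\<Union>n. L n)" by (rule submod_Union_chain[where L = L, OF sub mono])
  then have "(\<Union>n. L n) \<in> nz_ideals R" using a d by (intro nz_idealI[of _ a d]) auto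
  then obtain A where A: "A \<subseteq> (\<Union>n. L n)" "finite A" "colon R A = colon R (\<Union>n. L n)"
    using vf by (auto simp: v_finite_def)
  then obtain N where N: "A \<subseteq> L N" using finite_subset_chain[OF A(2,1) mono] by blast
  have "L n \<subseteq> L N" for n
  proof -
    have "colon R (L N) \<subseteq> colon R A" by (rule colon_mono) (use N in auto)
    also have "\<dots> \<subseteq> colon R (L n)" unfolding A(3) by (rule colon_mono) auto
    finally have "colon R (colon R (L n)) \<subseteq> colon R (colon R (L N))"
      by (rule colon_mono[OF subset_refl])
    then show ?thesis by (simp add: L colon_triple)
  qed
  then show ?thesis by blast
qed

text \<open>If no power of \<open>x\<close> lies in \<open>cR\<close>, then \<open>Q\<close>, the union of the ideals \<open>(cR : x\<^sup>n)\<close>, is a proper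
  divisorial ideal with \<open>(Q : x) = Q\<close>. Regularity of \<open>Q + x\<^sup>nR\<close> for large \<open>n\<close> produces an inverse \<open>e\<close> of
  \<open>x\<close> in \<open>(Q : Q)\<close> modulo an ideal \<open>F\<close> with \<open>x\<^sup>kF \<subseteq> Q\<close>, and the powers of \<open>e\<close> contradict the chain
  condition.\<close>

lemma regular_v_finite_dimension_one:
  assumes vf: "v_finite R" and reg: "regular R"
  shows "dimension_one R"
  unfolding dimension_one_def
proof (intro ballI impI, rule ccontr)
  fix x c assume x: "x \<in> nonunits R" and c: "c \<in> R" "c \<noteq> 0" and "\<nexists>n. x ^ n / c \<in> R"
  then have xn: "x ^ n / c \<notin> R" for n by blast
  have xR: "x \<in> R" using x by (simp add: nonunits_def)
  have xnR: "x ^ n \<in> R" for n by (rule Rs(8)[OF xR])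
  have x0: "x \<noteq> 0" using xn[of 1] Rs(2) by auto
  \<comment> \<open>This is (cR : x^n) in R, written as a colon into R so that
    \<open>v_finite_stationary\<close> applies.\<close>
  define Q0 where "Q0 n = colon R {1, x ^ n / c}" for n
  have Q0: "r \<in> Q0 n \<longleftrightarrow> r \<in> R \<and> r * x ^ n / c \<in> R" for r n by (auto simp: Q0_def colon_def)
  have "\<exists>m. \<forall>n. Q0 n \<subseteq> Q0 m"
  proof (rule v_finite_stationary[OF vf, where d = 1])
    show "Q0 n = colon R {1, x ^ n / c}" for n by (rule Q0_def)
    show "Q0 n \<subseteq> Q0 (Suc n)" for n
    proof
      fix r assume "r \<in> Q0 n"
      then show "r \<in> Q0 (Suc n)" using Rs(6)[OF xR, of "r * x ^ n / c"] by (simp add: Q0 mult_ac)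
    qed
  qed (auto simp: Q0)
  then obtain m where m: "\<And>n. Q0 n \<subseteq> Q0 m" by blast
  define g where "g = x ^ m / c"
  define Q where "Q = colon R {1, g}"
  have QQ0: "Q = Q0 m" by (simp add: Q_def Q0_def g_def)
  have QR: "submod R Q" unfolding Q_def by (rule submod_colon[OF R_submod])
  have Qsub: "Q \<subseteq> R" using Q0 QQ0 by blast
  have cQ: "c \<in> Q" using c xnR by (simp add: QQ0 Q0)
  have Qx: "r \<in> Q" if "r \<in> R" "x ^ n * r \<in> Q" for r n
  proof -
    have "r \<in> Q0 (n + m)" using that by (simp add: QQ0 Q0 power_add mult_ac)
    then show ?thesis using m QQ0 by blast
  qed
  have xnQ: "x ^ n \<notin> Q" for n using xn[of "n + m"] by (simp add: QQ0 Q0 power_add)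
  \<comment> \<open>The contradiction aimed at twice below: 1 - n is a unit, so x^j itself would lie
    in Q.\<close>
  have unit: False if "n \<in> nonunits R" "x ^ j * (1 - n) \<in> Q" for n j
  proof -
    have "inverse (1 - n) * (x ^ j * (1 - n)) \<in> Q"
      using that one_minus_nonunit submodD(4)[OF QR] by blast
    moreover have "inverse (1 - n) * (x ^ j * (1 - n)) = x ^ j"
      using one_minus_nonunit(2)[OF that(1)] by (simp add: field_simps)
    ultimately show False using xnQ[of j] by simp
  qed
  define E where "E = colon Q Q"
  have E: "subring E" "R \<subseteq> E" using subring_colon_self[OF R QR] by (auto simp: E_def)
  note Es = subringD[OF E(1)]
  have EQ: "submod E Q" unfolding E_def by (rule submod_colon_self[OF submodD(1)[OF QR]])
  have Ec: "c * z \<in> R" if "z \<in> E" for z using submodD(5)[OF EQ that cQ] Qsub by blast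
  have E_eq: "E = colon R ({1, g} \<star> Q)" unfolding E_def Q_def by (rule colon_colon[OF addsub_R])
  define L where "L k = {z \<in> E. x ^ k * z \<in> Q}" for k
  have L_eq: "L k = colon R ({1, g} \<star> Q \<union> {x ^ k, x ^ k * g})" for k
    by (auto simp: L_def colon_Un E_eq Q_def) (auto simp: colon_def mult_ac)
  have L_mono: "L k \<subseteq> L (Suc k)" for k
    using submodD(4)[OF QR xR] by (auto simp: L_def mult.assoc)
  have "\<exists>k. \<forall>n. L n \<subseteq> L k"
  proof (rule v_finite_stationary[OF vf, where L = L and d = c])
    show "L k = colon R ({1, g} \<star> Q \<union> {x ^ k, x ^ k * g})" for k by (rule L_eq)
  qed (use L_mono c(2) Ec in \<open>auto simp: L_def\<close>)
  then obtain k where k: "\<And>n. L n \<subseteq> L k" by blast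
  \<comment> \<open>F consists of the elements of E that some power of x sends into Q; by
    stationarity x^k serves for all of them. It meets R exactly in Q.\<close>
  define F where "F = L k"
  have F_iff: "z \<in> F \<longleftrightarrow> z \<in> E \<and> (\<exists>n. x ^ n * z \<in> Q)" for z
    using k[of _] by (auto simp: F_def L_def)
  have FE: "submod E F"
  proof (rule submodI)
    show "addsub F" unfolding F_def L_def addsub_def
      using Es submodD[OF QR] by (auto simp: distrib_left)
    show "d * z \<in> F" if "d \<in> E" "z \<in> F" for d z
      using that submodD(4)[OF EQ, of d "x ^ k * z"] Es(6) by (auto simp: F_def L_def mult_ac)
  qed
  have FR: "submod R F" by (rule submod_antimono[OF FE E(2)])
  have Fsub: "F \<subseteq> E" by (auto simp: F_iff)
  have FQ: "r \<in> Q" if "r \<in> F" "r \<in> R" for r using that Qx by (auto simp: F_iff)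
  have QF: "Q \<subseteq> F"
  proof
    fix q assume "q \<in> Q"
    then have "q \<in> E" "x ^ 0 * q \<in> Q" using Qsub E(2) by auto
    then show "q \<in> F" unfolding F_iff by blast
  qed
  have xF: "x ^ n * f \<in> Q" if "f \<in> F" "k \<le> n" for f n
  proof -
    have "x ^ (n - k) * (x ^ k * f) \<in> Q" using that submodD(4)[OF QR xnR] by (auto simp: F_def L_def)
    then show ?thesis using that(2) by (simp add: power_add[symmetric] mult.assoc[symmetric])
  qed
  \<comment> \<open>x^k already maps F into Q; the additional factor x is the one that e is going to
    invert.\<close>
  define X where "X = x ^ Suc k"
  have X: "X \<in> R" "X \<noteq> 0" using xnR x0 by (auto simp: X_def simp del: power_Suc)
  have XF: "X * f \<in> Q" if "f \<in> F" for f using xF[OF that, of "Suc k"] by (simp add: X_def)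
  have XQ: "r \<in> Q" if "r \<in> R" "X * r \<in> Q" for r using Qx that unfolding X_def by blast
  define I where "I = {q + X * r | q r. q \<in> Q \<and> r \<in> R}"
  have QI: "Q \<subseteq> I" unfolding I_def using Rs(2) by force
  have XI: "X \<in> I" unfolding I_def using Rs(1) submodD(2)[OF QR] by force
  have IR: "submod R I"
  proof (rule submodI)
    have "u + v \<in> I" if uv: "u \<in> I" "v \<in> I" for u v
    proof -
      obtain q r q' r' where "q \<in> Q" "r \<in> R" "u = q + X * r" "q' \<in> Q" "r' \<in> R" "v = q' + X * r'"
        using uv by (auto simp: I_def)
      then show ?thesis unfolding I_def using Rs(5) submodD(3)[OF QR]
        by (intro CollectI exI[of _ "q + q'"] exI[of _ "r + r'"]) (auto simp: algebra_simps)
    qed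
    then show "addsub I" using QI submodD(2)[OF QR] by (auto simp: addsub_def)
    fix e u assume eu: "e \<in> R" "u \<in> I"
    then obtain q r where "q \<in> Q" "r \<in> R" "u = q + X * r" by (auto simp: I_def)
    then show "e * u \<in> I" unfolding I_def using eu Rs(6) submodD(4)[OF QR]
      by (intro CollectI exI[of _ "e * q"] exI[of _ "e * r"]) (auto simp: algebra_simps)
  qed
  have IsubR: "I \<subseteq> R" using Qsub X(1) Rs(5,6) by (auto simp: I_def)
  have Inz: "I \<in> nz_ideals R" using QI cQ c IsubR by (intro nz_idealI[OF IR, of c 1]) auto
  define S where "S = colon I I"
  have S: "subring S" "R \<subseteq> S" using subring_colon_self[OF R IR] by (auto simp: S_def)
  \<comment> \<open>Modulo F the multipliers of I come from R: if z X = q + X r, then f = z - r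
    satisfies X f = q. For q' in Q write f q' = q2 + X r2; multiplying by X and cancelling powers of
    x puts r2 into Q, so f maps Q into itself.\<close>
  have S_dec: "\<exists>r\<in>R. \<exists>f\<in>F. z = r + f" if z: "z \<in> S" for z
  proof -
    have "z * X \<in> I" using z XI by (auto simp: S_def dest: colonD)
    then obtain q r where qr: "q \<in> Q" "r \<in> R" "z * X = q + X * r" by (auto simp: I_def)
    define f where "f = z - r"
    have Xf: "X * f = q" using qr(3) by (simp add: f_def algebra_simps)
    have fS: "f \<in> S" unfolding f_def using subringD(4)[OF S(1)] z qr(2) S(2) by blast
    have "f * q' \<in> Q" if q': "q' \<in> Q" for q'
    proof -
      have "f * q' \<in> I" using fS q' QI by (auto simp: S_def dest: colonD)
      then obtain q2 r2 where 2: "q2 \<in> Q" "r2 \<in> R" "f * q' = q2 + X * r2" by (auto simp: I_def)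
      have "X * r2 = f * q' - q2" using 2(3) by simp
      then have "X * (X * r2) = (X * f) * q' - X * q2" by (simp add: right_diff_distrib mult.assoc)
      moreover have "(X * f) * q' \<in> Q" using submodD(4)[OF QR, of "X * f" q'] Xf qr(1) q' Qsub by auto
      moreover have "X * q2 \<in> Q" by (rule submodD(4)[OF QR X(1) 2(1)])
      ultimately have "X * (X * r2) \<in> Q" using submod_diff[OF R QR] by simp
      then have "r2 \<in> Q" using XQ[OF 2(2)] XQ[OF Rs(6)[OF X(1) 2(2)]] by blast
      then have "X * r2 \<in> Q" by (rule submodD(4)[OF QR X(1)])
      then show ?thesis using submodD(3)[OF QR 2(1)] 2(3) by simp
    qed
    then have "f \<in> E" by (auto simp: E_def intro: colonI)
    then have "f \<in> F" using Xf qr(1) unfolding F_iff X_def by blast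
    then show ?thesis using qr(2) by (intro bexI[of _ r] bexI[of _ f]) (auto simp: f_def)
  qed
  define C where "C = colon S I"
  have ab_S: "a * b \<in> S" if "a \<in> I" "b \<in> C" for a b
    using that by (auto simp: C_def dest: colonD')
  \<comment> \<open>Otherwise I (S : I) would lie in m + F, with m the maximal ideal. Multiplying by
    I = Q + X R, regularity would give X \<in> Q + X m, that is X (1 - n) \<in> Q for a nonunit
    n.\<close>
  have "\<exists>a\<in>I. \<exists>b\<in>C. \<exists>r\<in>R - nonunits R. \<exists>f\<in>F. a * b = r + f"
  proof (rule ccontr)
    assume no: "\<not> ?thesis"
    define J where "J = {n + f | n f. n \<in> nonunits R \<and> f \<in> F}"
    have "I \<star> C \<subseteq> J"
    proof (rule mprod_least)
      have "u + v \<in> J" if uv: "u \<in> J" "v \<in> J" for u v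
      proof -
        obtain n f n' f' where "n \<in> nonunits R" "f \<in> F" "u = n + f" "n' \<in> nonunits R" "f' \<in> F" "v = n' + f'"
          using uv by (auto simp: J_def)
        then show ?thesis unfolding J_def using nonunits_add submodD(3)[OF FR]
          by (intro CollectI exI[of _ "n + n'"] exI[of _ "f + f'"]) (auto simp: algebra_simps)
      qed
      moreover have "0 \<in> J" unfolding J_def using zero_nonunit submodD(2)[OF FR] by force
      ultimately show "addsub J" by (auto simp: addsub_def)
      fix a b assume ab: "a \<in> I" "b \<in> C"
      then obtain r f where rf: "r \<in> R" "f \<in> F" "a * b = r + f" using S_dec[OF ab_S[OF ab]] by blast
      then have "r \<in> nonunits R" using no ab by blast
      then show "a * b \<in> J" using rf by (auto simp: J_def)
    qed
    have "I \<star> J \<subseteq> {q + X * n | q n. q \<in> Q \<and> n \<in> nonunits R}" (is "_ \<subseteq> ?K")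
    proof (rule mprod_least)
      have "u + v \<in> ?K" if uv: "u \<in> ?K" "v \<in> ?K" for u v
      proof -
        obtain q r q' r' where "q \<in> Q" "r \<in> nonunits R" "u = q + X * r" "q' \<in> Q" "r' \<in> nonunits R" "v = q' + X * r'"
          using uv by blast
        then show ?thesis using nonunits_add submodD(3)[OF QR]
          by (intro CollectI exI[of _ "q + q'"] exI[of _ "r + r'"]) (auto simp: algebra_simps)
      qed
      moreover have "0 \<in> ?K" using zero_nonunit submodD(2)[OF QR] by force
      ultimately show "addsub ?K" by (auto simp: addsub_def)
      fix a t assume at: "a \<in> I" "t \<in> J"
      then obtain q r n f where 1: "q \<in> Q" "r \<in> R" "a = q + X * r" "n \<in> nonunits R" "f \<in> F" "t = n + f"
        by (auto simp: I_def J_def)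
      have "n \<in> R" using 1 by (auto simp: nonunits_def)
      have q1: "n * q \<in> Q" using 1 \<open>n \<in> R\<close> QR by (blast intro: submodD)
      have q2: "f * q \<in> Q" using 1 Fsub EQ by (blast intro: submodD)
      have q3: "r * (X * f) \<in> Q" using 1 XF QR by (blast intro: submodD)
      have "n * q + f * q + r * (X * f) \<in> Q" using q1 q2 q3 QR by (blast intro: submodD)
      moreover have "r * n \<in> nonunits R" using nonunits_mult 1 by blast
      moreover have "a * t = (n * q + f * q + r * (X * f)) + X * (r * n)" by (simp add: 1 algebra_simps)
      ultimately show "a * t \<in> ?K" by blast
    qed
    moreover have "X \<in> I \<star> J"
      using reg Inz XI mprod_mono[OF subset_refl \<open>I \<star> C \<subseteq> J\<close>, of I] unfolding regular_def C_def S_def by blast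
    ultimately obtain q n where qn: "q \<in> Q" "n \<in> nonunits R" "X = q + X * n" by blast
    have "X * (1 - n) = q" using qn(3) by (simp add: algebra_simps)
    then show False using unit[OF qn(2), of "Suc k"] qn(1) by (simp add: X_def)
  qed
  then obtain a b r f where ab: "a \<in> I" "b \<in> C" "r \<in> R" "r \<notin> nonunits R" "f \<in> F" "a * b = r + f" by blast
  obtain q t where a: "q \<in> Q" "t \<in> R" "a = q + X * t" using ab(1) by (auto simp: I_def)
  have bX: "X * b \<in> E"
  proof -
    obtain r1 f1 where "r1 \<in> R" "f1 \<in> F" "X * b = r1 + f1" using S_dec[OF ab_S[OF XI ab(2)]] by blast
    then show ?thesis using Es(5)[of r1 f1] E(2) Fsub by auto
  qed
  have bQ: "b * q' \<in> F" if q': "q' \<in> Q" for q'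
  proof -
    have "q' * b \<in> S" using ab_S[OF _ ab(2)] q' QI by blast
    from S_dec[OF this] obtain r1 f1 where 1: "r1 \<in> R" "f1 \<in> F" "q' * b = r1 + f1" by blast
    have "r1 = q' * b - f1" using 1(3) by simp
    then have "X * r1 = (X * b) * q' - X * f1" by (simp add: right_diff_distrib mult_ac)
    also have "\<dots> \<in> Q" by (rule submod_diff[OF R QR submodD(4)[OF EQ bX q'] XF[OF 1(2)]])
    finally have "r1 \<in> F" using XQ[OF 1(1)] QF by blast
    then show ?thesis using submodD(3)[OF FR _ 1(2)] 1(3) by (simp add: mult.commute)
  qed
  have ru: "r \<noteq> 0" "inverse r \<in> R" using unitD ab by auto
  \<comment> \<open>From a = q + X t follows t X b = a b - b q = r + (f - b q). Dividing by the unit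
    r and splitting X = x x^k makes e an inverse of x modulo F.\<close>
  define e where "e = inverse r * t * (x ^ k * b)"
  have "x ^ k * b * q' \<in> Q" if "q' \<in> Q" for q'
    using xF[OF bQ[OF that], of k] by (simp add: mult.assoc)
  then have "x ^ k * b \<in> E" by (auto simp: E_def intro: colonI)
  then have eE: "e \<in> E" unfolding e_def using E(2) Rs(6)[OF ru(2) a(2)] by (intro Es(6)[of "inverse r * t"]) auto
  have xe: "\<exists>h\<in>F. x * e = 1 + h"
  proof -
    have "f - b * q \<in> F" by (rule submod_diff[OF R FR ab(5) bQ[OF a(1)]])
    then have "inverse r * (f - b * q) \<in> F" by (rule submodD(4)[OF FR ru(2)])
    moreover have "x * e = inverse r * (t * (X * b))" by (simp add: e_def X_def mult_ac)
    moreover have "t * (X * b) = r + (f - b * q)" using ab(6) a(3) by (simp add: algebra_simps)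
    ultimately show ?thesis using ru(1) by (intro bexI[of _ "inverse r * (f - b * q)"]) (auto simp: distrib_left)
  qed
  have xej: "\<exists>h\<in>F. x ^ j * e ^ j = 1 + h" for j
  proof (induction j)
    case 0 then show ?case using submodD(2)[OF FR] by force
  next
    case (Suc j)
    then obtain h where "h \<in> F" "x ^ j * e ^ j = 1 + h" by blast
    moreover obtain h' where "h' \<in> F" "x * e = 1 + h'" using xe by blast
    ultimately have h: "h \<in> F" "x ^ j * e ^ j = 1 + h" "h' \<in> F" "x * e = 1 + h'" by simp_all
    have "x ^ Suc j * e ^ Suc j = (x * e) * (x ^ j * e ^ j)" by (simp add: mult_ac)
    also have "\<dots> = 1 + (h + h' + h' * h)" by (simp only: h) (simp add: algebra_simps)
    finally have "x ^ Suc j * e ^ Suc j = 1 + (h + h' + h' * h)" .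
    moreover have "h + h' + h' * h \<in> F"
      using h(1,3) Fsub by (intro submodD(3)[OF FR] submodD(4)[OF FE]) auto
    ultimately show ?case by blast
  qed
  \<comment> \<open>\<open>M n\<close> consists of the elements of E that x^n sends into R. Every
    power of e lies in some \<open>M n\<close>, so stationarity gives one exponent N for all of
    them.\<close>
  define M where "M n = colon R ({1, g} \<star> Q \<union> {x ^ n})" for n
  have M: "z \<in> M n \<longleftrightarrow> z \<in> E \<and> x ^ n * z \<in> R" for z n
    unfolding M_def colon_Un E_eq[symmetric] by (auto simp: colon_def mult.commute)
  have "\<exists>N. \<forall>n. M n \<subseteq> M N"
  proof (rule v_finite_stationary[OF vf, where L = M and d = c])
    show "M n = colon R ({1, g} \<star> Q \<union> {x ^ n})" for n by (rule M_def)
    show "c \<noteq> 0" by (rule c)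
    show "M n \<subseteq> M (Suc n)" for n using Rs(6)[OF xR] by (auto simp: M mult.assoc)
    show "c * z \<in> R" if "z \<in> M n" for z n using that Ec by (auto simp: M)
  qed
  then obtain N where N: "\<And>n. M n \<subseteq> M N" by blast
  \<comment> \<open>N serves the chain \<open>M\<close>, and k makes x^n h fall into Q. With \<rho>
    = x^n e^(n+1) in R this leads to x^n (1 - \<rho> x) \<in> Q.\<close>
  define n where "n = max N k"
  have "x ^ n * e ^ Suc n \<in> R"
  proof -
    obtain h where h: "h \<in> F" "x ^ Suc n * e ^ Suc n = 1 + h" using xej[of "Suc n"] by blast
    have "x ^ (Suc n + k) * e ^ Suc n = x ^ k * (x ^ Suc n * e ^ Suc n)" by (simp only: power_add mult_ac)
    also have "\<dots> = x ^ k + x ^ k * h" by (simp only: h distrib_left mult_1_right)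
    also have "\<dots> \<in> R" using xnR[of k] xF[OF h(1), of k] Qsub Rs(5) by blast
    finally have "e ^ Suc n \<in> M (Suc n + k)" using eE Es(8) by (simp add: M del: power_Suc)
    then have "x ^ N * e ^ Suc n \<in> R" using N M by blast
    then have "x ^ (n - N) * (x ^ N * e ^ Suc n) \<in> R" by (rule Rs(6)[OF xnR])
    then show ?thesis by (simp add: n_def power_add[symmetric] mult.assoc[symmetric] del: power_Suc)
  qed
  then obtain \<rho> where \<rho>: "\<rho> \<in> R" "x ^ n * e ^ Suc n = \<rho>" by blast
  obtain h where h: "h \<in> F" "x ^ Suc n * e ^ Suc n = 1 + h" using xej[of "Suc n"] by blast
  have "x ^ Suc n * \<rho> = x ^ n * (x ^ Suc n * e ^ Suc n)" by (simp only: \<rho>(2)[symmetric] mult_ac)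
  also have "\<dots> = x ^ n + x ^ n * h" by (simp only: h distrib_left mult_1_right)
  finally have "x ^ n * (1 - \<rho> * x) = - 1 * (x ^ n * h)" by (simp add: algebra_simps)
  also have "\<dots> \<in> Q" by (rule submodD(4)[OF QR Rs(3) xF[OF h(1)]]) (simp add: n_def)
  finally show False using unit[of "\<rho> * x" n] nonunits_mult[OF \<rho>(1) x] by blast
qed

section \<open>Regular v-finite domains of dimension one are stable\<close>

lemma frac_overringE:
  assumes "frac_overring R E"
  obtains d where "subring E" "R \<subseteq> E" "d \<noteq> 0" "\<And>x. x \<in> E \<Longrightarrow> d * x \<in> R"
  using assms by (auto simp: frac_overring_def)

text \<open>The trace ideal T of I satisfies T \<subseteq> T T, and the goal is 1 \<in> T. It is
  replaced by a finitely generated E-ideal T1 with the same colon A into R. T1 is invertible over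
  its endomorphism ring by \<open>fin_gen_stable\<close>, and T \<subseteq> T T makes the inverse of
  T1 map A into itself. Hence A \<subseteq> T1 A, and \<open>nakayama\<close> over E applies to A
  instead of T.\<close>

lemma regular_v_finite_stable:
  assumes dim: "dimension_one R" and vf: "v_finite R" and reg: "regular R"
  shows "stable R"
  unfolding stable_def
proof
  fix I assume I: "I \<in> nz_ideals R"
  define E where "E = colon I I"
  define T where "T = I \<star> colon E I"
  obtain a where IR: "submod R I" and a: "a \<in> I" "a \<noteq> 0" using nz_idealE[OF I] by metis
  have fE: "frac_overring R E" unfolding E_def by (rule frac_overring_colon_self[OF R I])
  then obtain d where E: "subring E" "R \<subseteq> E" and d: "d \<noteq> 0" "\<And>x. x \<in> E \<Longrightarrow> d * x \<in> R"
    using frac_overringE by blast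
  have E1: "1 \<in> E" by (rule subringD[OF E(1)])
  have EI: "submod E I" unfolding E_def by (rule submod_colon_self[OF submodD(1)[OF IR]])
  have ET: "submod E T" unfolding T_def by (rule submod_mprod_left[OF EI])
  have TE: "T \<subseteq> E"
    using colon_mprod_subset[OF submodD(1)[OF subring_submod[OF E(1)]], of I] by (simp add: T_def mprod_comm)
  have IT: "I \<subseteq> I \<star> T" using reg I by (auto simp: regular_def T_def E_def)
  have "T \<subseteq> (I \<star> T) \<star> colon E I" unfolding T_def using IT by (intro mprod_mono) (auto simp: T_def)
  also have "\<dots> = T \<star> T" by (simp add: T_def mprod_ac)
  finally have TT: "T \<subseteq> T \<star> T" .
  have "\<not> T \<subseteq> {0}"
  proof
    assume "T \<subseteq> {0}"
    then have "I \<star> T \<subseteq> {0}" by (intro mprod_least) (auto simp: addsub_def)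
    then show False using IT a by auto
  qed
  then obtain \<tau> where \<tau>: "\<tau> \<in> T" "\<tau> \<noteq> 0" by auto
  have TR: "submod R T" by (rule submod_antimono[OF ET E(2)])
  have "T \<in> nz_ideals R" using TE d by (intro nz_idealI[OF TR \<tau> d(1)]) auto
  then obtain G where G: "G \<subseteq> T" "finite G" "colon R G = colon R T" using vf by (auto simp: v_finite_def)
  \<comment> \<open>Adding the nonzero \<tau> keeps T1 nonzero and provides a denominator for
    A.\<close>
  define T0 where "T0 = insert \<tau> G"
  define T1 where "T1 = T0 \<star> E"
  have T0: "T0 \<subseteq> T" "finite T0" "\<tau> \<in> T0" using G \<tau> by (auto simp: T0_def)
  have T01: "T0 \<subseteq> T1" unfolding T1_def by (rule mprod_one_subset_right[OF E1])
  have "T1 \<subseteq> E \<star> T" using mprod_mono[OF T0(1), of E E] by (simp add: T1_def mprod_comm)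
  also have "\<dots> \<subseteq> T" by (rule mprod_submod_subset[OF ET])
  finally have T1T: "T1 \<subseteq> T" .
  have ET1: "submod E T1" unfolding T1_def by (rule submod_mprod_right[OF subring_submod[OF E(1)]])
  have T1R: "submod R T1" by (rule submod_antimono[OF ET1 E(2)])
  have T1nz: "T1 \<in> nz_ideals R" using T1T TE d T01 T0 by (intro nz_idealI[OF T1R _ \<tau>(2) d(1)]) auto
  have colT: "colon R T1 = colon R T"
  proof
    show "colon R T \<subseteq> colon R T1" using T1T by (intro colon_mono) auto
    have "colon R T1 \<subseteq> colon R G" using T01 by (intro colon_mono) (auto simp: T0_def)
    then show "colon R T1 \<subseteq> colon R T" using G(3) by simp
  qed
  define A where "A = colon R T1"
  define B where "B = colon T1 T1"
  define T' where "T' = colon B T1"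
  have B: "subring B" "R \<subseteq> B" using subring_colon_self[OF R T1R] by (auto simp: B_def)
  have BT1: "submod B T1" unfolding B_def by (rule submod_colon_self[OF submodD(1)[OF T1R]])
  have EB: "E \<subseteq> B" unfolding B_def using submodD(4)[OF ET1] by (auto intro: colonI)
  have AB: "submod B A" and AE: "submod E A"
    unfolding A_def by (auto intro: submod_colon' addsub_R BT1 ET1)
  have T1B: "T1 \<subseteq> T0 \<star> colon T1 T1" unfolding T1_def
    using mprod_mono[OF subset_refl EB, of T0] by (simp add: T1_def B_def)
  have quadB: "quadratic R b" if "b \<in> colon T1 T1" for b
    using frac_overring_quadratic[OF dim reg frac_overring_colon_self[OF R T1nz] that] .
  have inv: "1 \<in> T1 \<star> T'"
    unfolding T'_def B_def by (rule fin_gen_stable[OF dim reg T1nz quadB T0(2) T01 T1B])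
  \<comment> \<open>As (R : T1) = (R : T), the factors of T1 T1 may be exchanged for T one after the
    other inside a colon into R.\<close>
  have "colon R (T1 \<star> T1) = colon (colon R T) T1" by (simp add: colon_colon[OF addsub_R, symmetric] colT)
  also have "\<dots> = colon (colon R T1) T" by (simp add: colon_colon[OF addsub_R] mprod_comm)
  also have "\<dots> = colon R (T \<star> T)" by (simp add: colT colon_colon[OF addsub_R])
  also have "\<dots> \<subseteq> colon R T" using TT by (intro colon_mono) auto
  finally have idem: "colon A T1 \<subseteq> A" by (simp only: A_def colon_colon[OF addsub_R]) (simp only: colT)
  have "T' \<star> T1 \<subseteq> B" unfolding T'_def by (rule colon_mprod_subset[OF submodD(1)[OF subring_submod[OF B(1)]]])
  then have "(T' \<star> T1) \<star> A \<subseteq> B \<star> A" by (intro mprod_mono) auto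
  also have "\<dots> \<subseteq> A" by (rule mprod_submod_subset[OF AB])
  finally have "T' \<star> A \<subseteq> colon A T1" by (intro mprod_subset_colon) (simp add: mprod_ac)
  then have T'A: "T' \<star> A \<subseteq> A" using idem by blast
  have "A \<subseteq> (T1 \<star> T') \<star> A" by (rule mprod_one_subset[OF inv])
  also have "\<dots> = T1 \<star> (T' \<star> A)" by (rule mprod_assoc)
  also have "\<dots> \<subseteq> T1 \<star> A" using T'A by (intro mprod_mono) auto
  also have "\<dots> = T0 \<star> (E \<star> A)" by (simp add: T1_def mprod_assoc)
  also have "\<dots> \<subseteq> T0 \<star> A" using mprod_submod_subset[OF AE] by (intro mprod_mono) auto
  finally have AT: "A \<subseteq> T0 \<star> A" .
  have "1 \<in> T0 \<star> E"
  proof (rule nakayama[OF dim E _ AE _ d(1) \<tau>(2) _ T0(2) _ AT])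
    show "quadratic R b" if "b \<in> E" for b by (rule frac_overring_quadratic[OF dim reg fE that])
    show "d \<in> A" using d T1T TE by (auto simp: A_def intro: colonI)
    show "\<tau> * x \<in> R" if "x \<in> A" for x using that T0 T01 by (auto simp: A_def dest: colonD')
    show "T0 \<subseteq> E" using T0 TE by blast
  qed
  then show "1 \<in> I \<star> colon (colon I I) I" using T1T by (auto simp: T1_def T_def E_def)
qed

text \<open>F + F e is closed under multiplication because e^2 = r e + s. As an R-module it is
  generated by A and e A, so finite generation survives.\<close>

lemma adjoin_quadratic:
  assumes F: "subring (R \<star> A)" and e: "quadratic R e" and A1: "1 \<in> A"
  shows "subring (R \<star> (A \<union> (\<lambda>a. e * a) ` A))" "e \<in> R \<star> (A \<union> (\<lambda>a. e * a) ` A)"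
proof -
  let ?F = "R \<star> A" and ?A' = "A \<union> (\<lambda>a. e * a) ` A"
  note Fs = subringD[OF F]
  have RF: "R \<subseteq> ?F" by (rule mprod_one_subset_right[OF A1])
  obtain r s where rs: "r \<in> R" "s \<in> R" "e * e = r * e + s" using e by (auto simp: quadratic_def)
  define F' where "F' = {f + g * e | f g. f \<in> ?F \<and> g \<in> ?F}"
  have F'I: "f + g * e \<in> F'" if "f \<in> ?F" "g \<in> ?F" for f g using that by (auto simp: F'_def)
  have sub: "?F \<subseteq> F'" using F'I[OF _ Fs(2)] by auto
  have "R \<star> ?A' = F'"
  proof
    show "R \<star> ?A' \<subseteq> F'"
    proof (rule mprod_least)
      have "x + y \<in> F'" if xy: "x \<in> F'" "y \<in> F'" for x y
      proof -
        obtain f g f' g' where "f \<in> ?F" "g \<in> ?F" "x = f + g * e" "f' \<in> ?F" "g' \<in> ?F" "y = f' + g' * e"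
          using xy by (auto simp: F'_def)
        then show ?thesis using F'I[OF Fs(5)[of f f'] Fs(5)[of g g']] by (simp add: algebra_simps)
      qed
      then show "addsub F'" using sub Fs(2) by (auto simp: addsub_def)
      fix x a assume x: "x \<in> R" and "a \<in> ?A'"
      then consider "a \<in> A" | b where "b \<in> A" "a = e * b" by auto
      then show "x * a \<in> F'"
      proof cases
        case 1 then show ?thesis using mprodI[OF x 1] sub by blast
      next
        case 2 then show ?thesis using F'I[OF Fs(2) mprodI[OF x 2(1)]] by (simp add: mult_ac)
      qed
    qed
    show "F' \<subseteq> R \<star> ?A'"
    proof
      fix x assume "x \<in> F'"
      then obtain f g where fg: "f \<in> ?F" "g \<in> ?F" "x = f + g * e" by (auto simp: F'_def)
      have "e * g \<in> ?A' \<star> R" by (rule mprod_map[of g A R]) (use fg in \<open>auto simp: mprod_comm\<close>)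
      moreover have "f \<in> R \<star> ?A'" using fg(1) mprod_mono[of R R A ?A'] by auto
      ultimately show "x \<in> R \<star> ?A'" using fg(3) mprod_add by (simp add: mprod_comm mult.commute)
    qed
  qed
  moreover have "subring F'"
    unfolding subring_def
  proof (intro conjI ballI)
    show "1 \<in> F'" using sub Fs(1) by blast
    fix x y assume xy: "x \<in> F'" "y \<in> F'"
    obtain f g f' g' where m: "f \<in> ?F" "g \<in> ?F" "f' \<in> ?F" "g' \<in> ?F"
      and eq: "x = f + g * e" "y = f' + g' * e"
      using xy by (auto simp: F'_def)
    show "x - y \<in> F'" using F'I[OF Fs(4)[of f f'] Fs(4)[of g g']] m by (simp add: eq algebra_simps)
    have "x * y = f * f' + (f * g' + g * f') * e + g * g' * (e * e)" by (simp add: eq algebra_simps)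
    also have "\<dots> = (f * f' + g * g' * s) + (f * g' + g * f' + g * g' * r) * e"
      by (simp only: rs(3)) (simp add: algebra_simps)
    also have "\<dots> \<in> F'" using m rs RF Fs(5,6) by (intro F'I) (auto intro!: Fs(5,6))
    finally show "x * y \<in> F'" .
  qed
  ultimately show "subring (R \<star> ?A')" by simp
  have "0 + 1 * e \<in> F'" by (rule F'I[OF Fs(2,1)])
  then show "e \<in> R \<star> ?A'" using \<open>R \<star> ?A' = F'\<close> by simp
qed

text \<open>Otherwise there are finite extension rings \<open>F\<^sub>n \<subseteq> E\<close> of \<open>R\<close> with strictly decreasing conductors
  \<open>C\<^sub>n = (R : F\<^sub>n)\<close>, each invertible over \<open>G\<^sub>n = (C\<^sub>n : C\<^sub>n)\<close>. With \<open>Z\<^sub>n = C\<^sub>n\<^sub>+\<^sub>1 C\<^sub>n\<^sup>-\<^sup>1\<close>, a proper ideal of \<open>G\<^sub>n\<close>,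
  and \<open>W\<^sub>n = (\<Inter>C\<^sub>i) C\<^sub>n\<^sup>-\<^sup>1\<close> one has \<open>W\<^sub>n = Z\<^sub>n W\<^sub>n\<^sub>+\<^sub>1\<close>. Stability makes the union \<open>V\<close> of the \<open>W\<^sub>n\<close> finitely
  generated over its endomorphism ring, so \<open>V = Z\<^sub>n V\<close> for some \<open>n\<close>, contradicting the Nakayama argument.\<close>

lemma stable_overring_v_finite:
  assumes dim: "dimension_one R" and st: "stable R" and fE: "frac_overring R E"
  shows "\<exists>A\<subseteq>E. finite A \<and> colon R A = colon R E"
proof (rule ccontr)
  assume no: "\<not> ?thesis"
  have reg: "regular R" by (rule stable_imp_regular[OF st])
  obtain d where E: "subring E" "R \<subseteq> E" and d: "d \<noteq> 0" "\<And>x. x \<in> E \<Longrightarrow> d * x \<in> R"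
    using frac_overringE[OF fE] by blast
  note Es = subringD[OF E(1)]
  define P where "P A \<longleftrightarrow> finite A \<and> A \<subseteq> E \<and> 1 \<in> A \<and> subring (R \<star> A)" for A
  have "\<exists>f. \<forall>n::nat. P (f n) \<and> (R \<star> f n \<subseteq> R \<star> f (Suc n) \<and> colon R (f n) \<noteq> colon R (f (Suc n)))"
  proof (rule dependent_nat_choice)
    have "R \<star> {1} = R" by (metis mprod_comm mprod_one_subset mprod_submod R_submod Rs(1) mprod_mono subset_antisym
        empty_subsetI insert_subset insertI1 subset_refl)
    then show "\<exists>A. P A" using R Es(1) by (intro exI[of _ "{1}"]) (auto simp: P_def)
    fix A assume A: "P A"
    then have "colon R A \<noteq> colon R E" "colon R E \<subseteq> colon R A"
      using no colon_mono[OF subset_refl, of A E R] by (auto simp: P_def)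
    \<comment> \<open>This c makes the conductor drop strictly: some e in E has c e \<notin> R, and
      adjoining that e removes c from the colon.\<close>
    then obtain c where c: "c \<in> colon R A" "c \<notin> colon R E" by blast
    then obtain e where e: "e \<in> E" "c * e \<notin> R" by (auto simp: colon_def)
    have q: "quadratic R e" by (rule frac_overring_quadratic[OF dim reg fE e(1)])
    let ?A' = "A \<union> (\<lambda>a. e * a) ` A"
    have "subring (R \<star> ?A')" "e \<in> R \<star> ?A'" using adjoin_quadratic[OF _ q] A by (auto simp: P_def)
    moreover have "R \<star> A \<subseteq> R \<star> ?A'" by (intro mprod_mono) auto
    moreover have "c \<notin> colon R ?A'"
      using calculation(2) e(2) colonD[of c R "R \<star> ?A'" e] by (auto simp: colon_mprod_ring[OF R])
    ultimately show "\<exists>B. P B \<and> (R \<star> A \<subseteq> R \<star> B \<and> colon R A \<noteq> colon R B)"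
      using A e(1) Es(6) c(1) by (intro exI[of _ ?A']) (auto simp: P_def)
  qed
  then obtain f where f: "\<And>n. P (f n)" "\<And>n. R \<star> f n \<subseteq> R \<star> f (Suc n)"
    "\<And>n. colon R (f n) \<noteq> colon R (f (Suc n))" by blast
  define F where "F n = R \<star> f n" for n
  define C where "C n = colon R (F n)" for n
  define G where "G n = colon (C n) (C n)" for n
  define C' where "C' n = colon (G n) (C n)" for n
  have F: "subring (F n)" "1 \<in> f n" "f n \<subseteq> E" for n using f(1)[of n] by (auto simp: F_def P_def)
  have C_neq: "C n \<noteq> C (Suc n)" for n using f(3)[of n] by (simp add: C_def F_def colon_mprod_ring[OF R])
  have C_mono: "C m \<subseteq> C n" if "n \<le> m" for m n
    using lift_Suc_mono_le[of F n m] that f(2) unfolding C_def by (intro colon_mono) (auto simp: F_def)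
  have FE: "F n \<subseteq> E" for n
    using mprod_mono[OF E(2) F(3)] mprod_submod_subset[OF subring_submod[OF E(1)]] unfolding F_def by blast
  have dC: "d \<in> C n" for n using FE d by (auto simp: C_def intro: colonI)
  have C_R: "C n \<subseteq> R" for n using colonD[OF _ subringD(1)[OF F(1)], of _ R n] by (auto simp: C_def)
  have CsR: "submod R (C n)" for n unfolding C_def by (rule submod_colon[OF R_submod])
  have Cnz: "C n \<in> nz_ideals R" for n
    using C_R by (intro nz_idealI[OF CsR dC d(1), where d = 1]) auto
  have G: "subring (G n)" "R \<subseteq> G n" for n using subring_colon_self[OF R CsR] by (auto simp: G_def)
  \<comment> \<open>\<open>C n\<close> is stable under \<open>F n\<close>, so (C n : C n) = (R : F n
    C n) = (R : C n).\<close>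
  have G_eq: "G n = colon R (C n)" for n
  proof -
    have "submod (F n) (C n)" unfolding C_def by (rule submod_colon'[OF addsub_R subring_submod[OF F(1)]])
    then have "F n \<star> C n = C n" by (rule mprod_submod[OF subringD(1)[OF F(1)]])
    then show ?thesis unfolding G_def by (subst (1) C_def) (simp add: colon_colon[OF addsub_R])
  qed
  have G_mono: "G n \<subseteq> G m" if "n \<le> m" for m n
    unfolding G_eq using C_mono[OF that] by (intro colon_mono) auto
  have GC: "submod (G n) (C n)" for n unfolding G_def by (rule submod_colon_self[OF submodD(1)[OF CsR]])
  have GC': "submod (G n) (C' n)" for n unfolding C'_def by (rule submod_colon[OF subring_submod[OF G(1)]])
  have inv: "1 \<in> C n \<star> C' n" for n using st Cnz[of n] by (auto simp: stable_def C'_def G_def)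
  have CC'G: "C n \<star> C' n \<subseteq> G n" for n
    using colon_mprod_subset[OF submodD(1)[OF subring_submod[OF G(1)]], of n "C n"] by (simp add: C'_def mprod_comm)
  define C\<^sub>\<omega> where "C\<^sub>\<omega> = (\<Inter>n. C n)"
  define W where "W n = C\<^sub>\<omega> \<star> C' n" for n
  define Z where "Z n = C (Suc n) \<star> C' n" for n
  have ZG: "Z n \<subseteq> G n" for n
    using mprod_mono[OF C_mono subset_refl, of n "Suc n" "C' n"] CC'G[of n] by (simp add: Z_def)
  have GZ: "submod (G n) (Z n)" for n unfolding Z_def by (rule submod_mprod_right[OF GC'])
  have GW: "submod (G n) (W n)" for n unfolding W_def by (rule submod_mprod_right[OF GC'])
  have WG: "W n \<subseteq> G n" for n
    using mprod_mono[of "C\<^sub>\<omega>" "C n" "C' n" "C' n"] CC'G[of n] by (auto simp: W_def C\<^sub>\<omega>_def)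
  \<comment> \<open>Inserting 1 \<in> C' C at index n + 1 and regrouping the four factors gives the
    product of \<open>Z n\<close> and \<open>W (Suc n)\<close>.\<close>
  have WZ: "W n \<subseteq> Z n \<star> W (Suc n)" for n
  proof -
    have "W n \<subseteq> (C (Suc n) \<star> C' (Suc n)) \<star> W n" by (rule mprod_one_subset[OF inv])
    also have "\<dots> = Z n \<star> W (Suc n)" by (simp add: Z_def W_def mprod_ac)
    finally show ?thesis .
  qed
  have W_mono: "W n \<subseteq> W (Suc n)" for n
  proof -
    have "Z n \<subseteq> G (Suc n)" using ZG[of n] G_mono[of n "Suc n"] by simp
    then have "W n \<subseteq> G (Suc n) \<star> W (Suc n)" using WZ[of n] mprod_mono[OF _ subset_refl, of "Z n" "G (Suc n)" "W (Suc n)"] by blast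
    then show ?thesis using mprod_submod_subset[OF GW] by blast
  qed
  have W_le: "W n \<subseteq> W m" if "n \<le> m" for n m by (rule lift_Suc_mono_le[of W, OF W_mono that])
  define V where "V = (\<Union>n. W n)"
  have VR: "submod R V" unfolding V_def by (rule submod_Union_chain[where L = W, OF submod_antimono[OF GW G(2)] W_mono])
  have "1 \<in> C' 0" unfolding C'_def using C_R[of 0] G(2)[of 0] by (auto intro!: colonI)
  then have "d * 1 \<in> W 0" unfolding W_def using dC by (intro mprodI) (auto simp: C\<^sub>\<omega>_def)
  then have dV: "d \<in> V" by (auto simp: V_def)
  have Vd: "d * x \<in> R" if "x \<in> V" for x
    using that WG dC by (auto simp: V_def G_eq dest: colonD')
  have Vnz: "V \<in> nz_ideals R" by (rule nz_idealI[OF VR dV d(1) d(1) Vd])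
  define H where "H = colon V V"
  have HV: "submod H V" unfolding H_def by (rule submod_colon_self[OF submodD(1)[OF VR]])
  have "1 \<in> V \<star> colon H V" using st Vnz by (auto simp: stable_def H_def)
  then obtain V0 where V0: "finite V0" "V0 \<subseteq> V" "1 \<in> V0 \<star> colon H V"
    using mprod_finite_set[of "{1}" V] by auto
  obtain N where N: "V0 \<subseteq> W N" using finite_subset_chain[where L = W, OF V0(1) _ W_mono] V0(2) unfolding V_def by blast
  \<comment> \<open>The finite set \<open>V0\<close>, found inside \<open>W N\<close>, thus lies in
    \<open>Z N \<star> V\<close>; since 1 lies in \<open>V0 \<star> colon H V\<close>, the finitely
    many multipliers needed for \<open>V0\<close> serve for all of V.\<close>
  have "W (Suc N) \<subseteq> V" by (auto simp: V_def)
  then have V0Z: "V0 \<subseteq> Z N \<star> V" using N WZ[of N] mprod_mono[OF subset_refl, of "W (Suc N)" V "Z N"] by blast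
  obtain Y where Y: "finite Y" "Y \<subseteq> Z N" "V0 \<subseteq> Y \<star> V" using mprod_finite_set[OF V0(1) V0Z] by blast
  have "V \<subseteq> (V0 \<star> colon H V) \<star> V" by (rule mprod_one_subset[OF V0(3)])
  also have "\<dots> = V0 \<star> (colon H V \<star> V)" by (rule mprod_assoc)
  also have "\<dots> \<subseteq> (Y \<star> V) \<star> H"
  proof (rule mprod_mono[OF Y(3)])
    have "subring H" using subring_colon_self[OF R VR] by (simp add: H_def)
    from colon_mprod_subset[OF submodD(1)[OF subring_submod[OF this]]]
    show "colon H V \<star> V \<subseteq> H" .
  qed
  also have "\<dots> = Y \<star> (H \<star> V)" by (simp add: mprod_ac)
  also have "\<dots> \<subseteq> Y \<star> V" using mprod_submod_subset[OF HV] by (intro mprod_mono) auto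
  finally have VY: "V \<subseteq> Y \<star> V" .
  have GV: "submod (G N) V"
  proof (rule submodI[OF submodD(1)[OF VR]])
    fix g v assume g: "g \<in> G N" and "v \<in> V"
    then obtain n where "v \<in> W n" by (auto simp: V_def)
    then have "v \<in> W (max n N)" "g \<in> G (max n N)" using W_le[of n "max n N"] G_mono[of N "max n N"] g by auto
    then have "g * v \<in> W (max n N)" by (intro submodD(4)[OF GW])
    then show "g * v \<in> V" by (auto simp: V_def)
  qed
  have "1 \<in> Y \<star> G N"
  proof (rule nakayama[OF dim G _ GV dV d(1) d(1) Vd Y(1) _ VY])
    show "quadratic R b" if "b \<in> G N" for b
      using frac_overring_quadratic[OF dim reg frac_overring_colon_self[OF R Cnz], of b N] that by (simp add: G_def)
    show "Y \<subseteq> G N" using Y ZG by blast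
  qed
  also have "Y \<star> G N \<subseteq> G N \<star> Z N" using mprod_mono[OF Y(2) subset_refl, of "G N"] by (simp add: mprod_comm)
  also have "\<dots> \<subseteq> Z N" by (rule mprod_submod_subset[OF GZ])
  \<comment> \<open>1 \<in> \<open>Z N\<close> collapses the strict inclusion of
    \<open>C (Suc N)\<close> in \<open>C N\<close>.\<close>
  finally have "C N \<subseteq> Z N \<star> C N" by (rule mprod_one_subset)
  also have "\<dots> = (C N \<star> C' N) \<star> C (Suc N)" by (simp add: Z_def mprod_ac)
  also have "\<dots> \<subseteq> G (Suc N) \<star> C (Suc N)" using CC'G[of N] G_mono[of N "Suc N"] by (intro mprod_mono) auto
  also have "\<dots> \<subseteq> C (Suc N)" by (rule mprod_submod_subset[OF GC])
  finally show False using C_mono[of N "Suc N"] C_neq[of N] by auto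
qed

text \<open>Stability gives I = I0 E with I0 finite and E = (I : I), and E has a finite subset A
  with the same colon. Since (R : I0 E) = ((R : E) : I0), the finitely many products of I0 with A
  serve for I.\<close>

lemma stable_v_finite:
  assumes dim: "dimension_one R" and st: "stable R"
  shows "v_finite R"
  unfolding v_finite_def
proof
  fix I assume I: "I \<in> nz_ideals R"
  define E where "E = colon I I"
  have IR: "submod R I" using nz_idealE[OF I] by metis
  have fE: "frac_overring R E" unfolding E_def by (rule frac_overring_colon_self[OF R I])
  then have E: "subring E" using frac_overringE by blast
  have EI: "submod E I" unfolding E_def by (rule submod_colon_self[OF submodD(1)[OF IR]])
  obtain A where A: "A \<subseteq> E" "finite A" "colon R A = colon R E"
    using stable_overring_v_finite[OF dim st fE] by blast
  have "1 \<in> I \<star> colon E I" using st I by (auto simp: stable_def E_def)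
  then obtain I0 where I0: "finite I0" "I0 \<subseteq> I" "1 \<in> I0 \<star> colon E I"
    using mprod_finite_set[of "{1}" I] by auto
  have "I \<subseteq> (I0 \<star> colon E I) \<star> I" by (rule mprod_one_subset[OF I0(3)])
  also have "\<dots> = I0 \<star> (colon E I \<star> I)" by (rule mprod_assoc)
  also have "\<dots> \<subseteq> I0 \<star> E"
    using colon_mprod_subset[OF submodD(1)[OF subring_submod[OF E]]] by (intro mprod_mono) auto
  finally have I_sub: "I \<subseteq> I0 \<star> E" .
  define X where "X = (\<lambda>(i, a). a * i) ` (I0 \<times> A)"
  have XI: "X \<subseteq> I" using I0(2) A(1) submodD(4)[OF EI] by (auto simp: X_def)
  have "colon R X \<subseteq> colon R I"
  proof
    fix z assume z: "z \<in> colon R X"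
    have "z * i \<in> colon R A" if "i \<in> I0" for i
    proof (rule colonI)
      fix a assume "a \<in> A"
      then have "a * i \<in> X" using that by (force simp: X_def)
      then have "z * (a * i) \<in> R" by (rule colonD[OF z])
      then show "z * i * a \<in> R" by (simp add: mult_ac)
    qed
    then have "z \<in> colon (colon R E) I0" by (auto simp: A(3) intro: colonI)
    then have "z \<in> colon R (E \<star> I0)" by (simp add: colon_colon[OF addsub_R])
    then show "z \<in> colon R I" using I_sub colon_mono[of R R I "E \<star> I0"] by (auto simp: mprod_comm)
  qed
  moreover have "colon R I \<subseteq> colon R X" using XI by (intro colon_mono) auto
  ultimately show "\<exists>A\<subseteq>I. finite A \<and> colon R A = colon R I"
    using XI I0(1) A(2) by (intro exI[of _ X]) (auto simp: X_def)
qed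

end

section \<open>Maximal t-ideals and localizations\<close>

lemma submod_zero: "submod R {0}"
  by (auto simp: submod_def)

section \<open>The v-closure and the t-closure\<close>

lemma v_closure_mono: "X \<subseteq> Y \<Longrightarrow> v_closure D X \<subseteq> v_closure D Y"
  unfolding v_closure_def by (intro colon_mono subset_refl)

lemma v_closure_extensive: "X \<subseteq> v_closure D X"
  unfolding v_closure_def by (rule colon_double)

lemma v_closure_idem: "v_closure D (v_closure D X) = v_closure D X"
  by (simp add: v_closure_def colon_triple)

context domain_in_fraction_field
begin

lemma submod_v_closure: "submod D (v_closure D X)"
  unfolding v_closure_def by (rule submod_colon[OF D_submod])

lemma v_closure_mprod: "v_closure D (D \<star> X) = v_closure D X"
  by (simp add: v_closure_def colon_mprod_ring[OF D_subring])

lemma v_closure_subset_D: "X \<subseteq> D \<Longrightarrow> v_closure D X \<subseteq> D"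
proof
  fix z assume "X \<subseteq> D" "z \<in> v_closure D X"
  then have "1 \<in> colon D X" by (auto simp: colon_def)
  with \<open>z \<in> v_closure D X\<close> have "z * 1 \<in> D" unfolding v_closure_def by (rule colonD)
  then show "z \<in> D" by simp
qed

text \<open>A v-closure depends only on generators, so finite sets X replace finitely generated
  ideals; that X contains a nonzero element records that the generated ideal is nonzero.\<close>

lemma t_closure_iff:
  assumes I: "I \<in> nz_ideals D"
  shows "z \<in> t_closure D I \<longleftrightarrow> (\<exists>X. finite X \<and> X \<subseteq> I \<and> \<not> X \<subseteq> {0} \<and> z \<in> v_closure D X)"
proof
  assume "z \<in> t_closure D I"
  then obtain J A where J: "J \<in> nz_ideals D" "J \<subseteq> I" "z \<in> v_closure D J" and A: "finite A" "J = D \<star> A"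
    by (auto simp: t_closure_def fin_gen_def hull_eq_mprod[OF D_subring])
  have "\<not> A \<subseteq> {0}"
  proof
    assume "A \<subseteq> {0}"
    then have "D \<star> A \<subseteq> {0}" by (intro mprod_least) (auto simp: addsub_def)
    then show False using J(1) A(2) mprod.zero[of D A] by (auto simp: nz_ideals_def)
  qed
  moreover have "A \<subseteq> I" using J(2) A(2) mprod_one_subset[OF Ds(1), of A] by blast
  ultimately show "\<exists>X. finite X \<and> X \<subseteq> I \<and> \<not> X \<subseteq> {0} \<and> z \<in> v_closure D X"
    using J(3) A v_closure_mprod by blast
next
  assume "\<exists>X. finite X \<and> X \<subseteq> I \<and> \<not> X \<subseteq> {0} \<and> z \<in> v_closure D X"
  then obtain X where X: "finite X" "X \<subseteq> I" "\<not> X \<subseteq> {0}" "z \<in> v_closure D X" by blast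
  obtain d where d: "submod D I" "d \<noteq> 0" "\<And>x. x \<in> I \<Longrightarrow> d * x \<in> D" using nz_idealE[OF I] by metis
  obtain x where x: "x \<in> X" "x \<noteq> 0" using X(3) by blast
  have XJ: "X \<subseteq> D \<star> X" by (rule mprod_one_subset[OF Ds(1)])
  have "D \<star> X \<subseteq> D \<star> I" using X(2) by (intro mprod_mono) auto
  then have JI: "D \<star> X \<subseteq> I" using mprod_submod_subset[OF d(1)] by blast
  have "D \<star> X \<in> nz_ideals D"
    using XJ x d JI by (intro nz_idealI[OF submod_mprod_left[OF D_submod] _ x(2) d(2)]) auto
  moreover have "fin_gen D (D \<star> X)" using X(1) hull_eq_mprod[OF D_subring] by (auto simp: fin_gen_def)
  ultimately show "z \<in> t_closure D I"
    using JI X(4) v_closure_mprod[of X] unfolding t_closure_def by blast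
qed

lemma t_closure_extensive: "I \<in> nz_ideals D \<Longrightarrow> I \<subseteq> t_closure D I"
proof
  fix x assume I: "I \<in> nz_ideals D" and x: "x \<in> I"
  obtain a where a: "a \<in> I" "a \<noteq> 0" using nz_idealE[OF I] by metis
  have "x \<in> v_closure D {x, a}" using v_closure_extensive[of "{x, a}"] by auto
  then show "x \<in> t_closure D I" unfolding t_closure_iff[OF I]
    using x a by (intro exI[of _ "{x, a}"]) auto
qed

lemma t_idealD:
  assumes "t_ideal D M"
  shows "M \<in> nz_ideals D" "submod D M" "finite X \<Longrightarrow> X \<subseteq> M \<Longrightarrow> v_closure D X \<subseteq> M"
proof -
  show M: "M \<in> nz_ideals D" and "submod D M"
    using assms by (auto simp: t_ideal_def nz_ideals_def frac_ideal_def)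
  obtain a where a: "a \<in> M" "a \<noteq> 0" using nz_idealE[OF M] by metis
  assume X: "finite X" "X \<subseteq> M"
  have "v_closure D (insert a X) \<subseteq> t_closure D M"
    using t_closure_iff[OF M] X a by (auto intro!: exI[of _ "insert a X"])
  then show "v_closure D X \<subseteq> M"
    using assms v_closure_mono[of X "insert a X"] by (auto simp: t_ideal_def)
qed

lemma t_idealI:
  assumes M: "M \<in> nz_ideals D" and "\<And>X. finite X \<Longrightarrow> X \<subseteq> M \<Longrightarrow> v_closure D X \<subseteq> M"
  shows "t_ideal D M"
proof -
  have "t_closure D M \<subseteq> M"
  proof
    fix z assume "z \<in> t_closure D M"
    then obtain X where "finite X" "X \<subseteq> M" "z \<in> v_closure D X" unfolding t_closure_iff[OF M] by blast
    then show "z \<in> M" using assms(2) by blast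
  qed
  then show ?thesis using t_closure_extensive[OF M] M by (auto simp: t_ideal_def)
qed

lemma t_ideal_t_closure:
  assumes I: "I \<in> nz_ideals D"
  shows "t_ideal D (t_closure D I)"
proof (rule t_idealI)
  note iff = t_closure_iff[OF I]
  obtain d a where d: "submod D I" "a \<in> I" "a \<noteq> 0" "d \<noteq> 0" "\<And>x. x \<in> I \<Longrightarrow> d * x \<in> D"
    using nz_idealE[OF I] by metis
  \<comment> \<open>The finitely many witnesses are merged into their union, so a finite subset of
    the t-closure lies in a single v-closure.\<close>
  have fin: "\<exists>Y. finite Y \<and> Y \<subseteq> I \<and> \<not> Y \<subseteq> {0} \<and> X \<subseteq> v_closure D Y"
    if "finite X" "X \<subseteq> t_closure D I" for X using that
  proof (induction rule: finite_induct)
    case empty then show ?case using d by (intro exI[of _ "{a}"]) auto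
  next
    case (insert x X)
    then obtain Y where Y: "finite Y" "Y \<subseteq> I" "\<not> Y \<subseteq> {0}" "X \<subseteq> v_closure D Y" by blast
    have "x \<in> t_closure D I" using insert.prems by blast
    then obtain Y' where Y': "finite Y'" "Y' \<subseteq> I" "x \<in> v_closure D Y'" unfolding iff by blast
    have "v_closure D Y \<subseteq> v_closure D (Y \<union> Y')" "v_closure D Y' \<subseteq> v_closure D (Y \<union> Y')"
      by (intro v_closure_mono; blast)+
    then have "insert x X \<subseteq> v_closure D (Y \<union> Y')" using Y(4) Y'(3) by blast
    then show ?case using Y Y' by (intro exI[of _ "Y \<union> Y'"]) blast
  qed
  show "t_closure D I \<in> nz_ideals D"
  proof (rule nz_idealI[OF _ _ d(3,4)])
    show "a \<in> t_closure D I" using t_closure_extensive[OF I] d(2) by blast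
    show "submod D (t_closure D I)"
    proof (rule submodI)
      have "x + y \<in> t_closure D I" if xy: "x \<in> t_closure D I" "y \<in> t_closure D I" for x y
      proof -
        obtain Y where Y: "finite Y" "Y \<subseteq> I" "\<not> Y \<subseteq> {0}" "{x, y} \<subseteq> v_closure D Y" using fin[of "{x, y}"] xy by auto
        then have "x + y \<in> v_closure D Y" using submodD(3)[OF submod_v_closure] by auto
        then show ?thesis using Y unfolding iff by blast
      qed
      moreover have "0 \<in> t_closure D I" using t_closure_extensive[OF I] submodD(2)[OF d(1)] by blast
      ultimately show "addsub (t_closure D I)" by (auto simp: addsub_def)
      show "e * x \<in> t_closure D I" if ex: "e \<in> D" "x \<in> t_closure D I" for e x
      proof -
        obtain X where "finite X" "X \<subseteq> I" "\<not> X \<subseteq> {0}" "x \<in> v_closure D X"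
          using ex(2) unfolding iff by blast
        moreover from this have "e * x \<in> v_closure D X" using submodD(4)[OF submod_v_closure ex(1)] by blast
        ultimately show ?thesis unfolding iff by blast
      qed
    qed
    show "d * x \<in> D" if x: "x \<in> t_closure D I" for x
    proof -
      obtain X where X: "X \<subseteq> I" "x \<in> v_closure D X" using x unfolding iff by blast
      have "d \<in> colon D X" using X d(5) by (auto intro: colonI)
      then show ?thesis using colonD'[OF X(2)[unfolded v_closure_def]] by blast
    qed
  qed
  fix X assume "finite X" "X \<subseteq> t_closure D I"
  from fin[OF this] obtain Y where Y: "finite Y" "Y \<subseteq> I" "\<not> Y \<subseteq> {0}" "X \<subseteq> v_closure D Y" by blast
  then have XY: "v_closure D X \<subseteq> v_closure D Y"
    using v_closure_mono[of X "v_closure D Y" D] by (simp add: v_closure_idem)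
  show "v_closure D X \<subseteq> t_closure D I"
  proof
    fix z assume "z \<in> v_closure D X"
    then have "z \<in> v_closure D Y" using XY by blast
    then show "z \<in> t_closure D I" unfolding iff using Y(1-3) by blast
  qed
qed

lemma v_ideal_t_ideal:
  assumes "J \<in> nz_ideals D" "v_closure D J = J" shows "t_ideal D J"
proof (rule t_idealI[OF assms(1)])
  fix X assume "X \<subseteq> J"
  then show "v_closure D X \<subseteq> J" using v_closure_mono[of X J D] assms(2) by simp
qed

section \<open>Maximal t-ideals: existence, compactness, primeness\<close>

lemma t_MaxD:
  assumes "M \<in> t_Max D"
  shows "t_ideal D M" "M \<subseteq> D" "1 \<notin> M" "submod D M" "M \<in> nz_ideals D"
    "t_ideal D N \<Longrightarrow> N \<subset> D \<Longrightarrow> M \<subseteq> N \<Longrightarrow> N = M"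
proof -
  show *: "t_ideal D M" "M \<subseteq> D" "t_ideal D N \<Longrightarrow> N \<subset> D \<Longrightarrow> M \<subseteq> N \<Longrightarrow> N = M" for N
    using assms by (auto simp: t_Max_def)
  show sub: "submod D M" and "M \<in> nz_ideals D" using t_idealD[OF *(1)] by auto
  show "1 \<notin> M"
  proof
    assume "1 \<in> M"
    then have "D \<subseteq> M" using submodD(5)[OF sub, of _ 1] by auto
    then show False using assms by (auto simp: t_Max_def)
  qed
qed

text \<open>Zorn's lemma applies because being a t-ideal is tested on finite subsets: a union of a
  chain of t-ideals is again one, and 1 stays outside.\<close>

lemma ex_t_Max:
  assumes J: "t_ideal D J" "J \<subseteq> D" "1 \<notin> J"
  shows "\<exists>M\<in>t_Max D. J \<subseteq> M"
proof -
  define \<A> where "\<A> = {N. t_ideal D N \<and> N \<subseteq> D \<and> 1 \<notin> N \<and> J \<subseteq> N}"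
  have "\<exists>M\<in>\<A>. \<forall>X\<in>\<A>. M \<subseteq> X \<longrightarrow> X = M"
  proof (rule subset_Zorn_nonempty)
    show "\<A> \<noteq> {}" using J by (auto simp: \<A>_def)
    fix \<C> assume C: "\<C> \<noteq> {}" "subset.chain \<A> \<C>"
    then have CA: "\<C> \<subseteq> \<A>" by (auto simp: subset.chain_def)
    obtain a where a: "a \<in> J" "a \<noteq> 0" using nz_idealE[OF t_idealD(1)[OF J(1)]] by metis
    have fin: "\<exists>N\<in>\<C>. X \<subseteq> N" if "finite X" "X \<subseteq> \<Union>\<C>" for X
      using finite_subset_Union_chain[OF that C(1)] C(2) by blast
    have sub: "submod D N" if "N \<in> \<C>" for N using that CA t_idealD(2) by (auto simp: \<A>_def)
    have "submod D (\<Union>\<C>)"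
    proof (rule submodI)
      have "x + y \<in> \<Union>\<C>" if xy: "x \<in> \<Union>\<C>" "y \<in> \<Union>\<C>" for x y
        using fin[of "{x, y}"] xy submodD(3)[OF sub] by auto
      then show "addsub (\<Union>\<C>)" using C(1) submodD(2)[OF sub] by (auto simp: addsub_def)
    qed (use submodD(4)[OF sub] in blast)
    moreover have "a \<in> \<Union>\<C>" using C(1) CA a(1) by (auto simp: \<A>_def)
    moreover have D: "\<Union>\<C> \<subseteq> D" "1 \<notin> \<Union>\<C>" using CA by (auto simp: \<A>_def)
    ultimately have nz: "\<Union>\<C> \<in> nz_ideals D" using a by (intro nz_idealI[of _ a 1]) auto
    have "t_ideal D (\<Union>\<C>)"
    proof (rule t_idealI[OF nz])
      fix X assume X: "finite X" "X \<subseteq> \<Union>\<C>"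
      then obtain N where N: "N \<in> \<C>" "X \<subseteq> N" using fin by blast
      then have "v_closure D X \<subseteq> N" using CA X(1) by (intro t_idealD(3)) (auto simp: \<A>_def)
      then show "v_closure D X \<subseteq> \<Union>\<C>" using N by blast
    qed
    moreover obtain N where "N \<in> \<C>" using C(1) by blast
    moreover from this have "J \<subseteq> N" using CA by (auto simp: \<A>_def)
    ultimately show "\<Union>\<C> \<in> \<A>" using D unfolding \<A>_def by blast
  qed
  then obtain M where M: "M \<in> \<A>" "\<And>X. X \<in> \<A> \<Longrightarrow> M \<subseteq> X \<Longrightarrow> X = M" by blast
  have "N = M" if N: "t_ideal D N" "N \<subset> D" "M \<subseteq> N" for N
  proof (rule M(2)[OF _ N(3)])
    have "1 \<notin> N"
    proof
      assume "1 \<in> N"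
      then have "D \<subseteq> N" using submodD(5)[OF t_idealD(2)[OF N(1)], of _ 1] by auto
      then show False using N(2) by blast
    qed
    then show "N \<in> \<A>" using N M(1) by (auto simp: \<A>_def)
  qed
  then have "M \<in> t_Max D" using M(1) Ds(1) by (auto simp: \<A>_def t_Max_def)
  then show ?thesis using M(1) by (auto simp: \<A>_def)
qed

text \<open>Quasi-compactness of the set of t-maximal ideals: the t-closure of the ideal generated
  by G contains 1, and this is witnessed by a finite subset of that ideal, hence by finitely many
  elements of G.\<close>

lemma t_Max_compact:
  assumes G: "G \<subseteq> D" "\<not> G \<subseteq> {0}" and no: "\<And>M. M \<in> t_Max D \<Longrightarrow> \<not> G \<subseteq> M"
  shows "\<exists>X. finite X \<and> X \<subseteq> G \<and> (\<forall>M\<in>t_Max D. \<not> X \<subseteq> M)"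
proof -
  obtain g where g: "g \<in> G" "g \<noteq> 0" using G by blast
  have GI: "G \<subseteq> D \<star> G" by (rule mprod_one_subset[OF Ds(1)])
  have ID: "D \<star> G \<subseteq> D" using mprod_mono[OF subset_refl G(1), of D] mprod_submod_subset[OF D_submod] by blast
  have I: "D \<star> G \<in> nz_ideals D"
    using GI ID g by (intro nz_idealI[OF submod_mprod_left[OF D_submod], where a = g and d = 1]) auto
  have "t_closure D (D \<star> G) \<subseteq> D"
  proof
    fix z assume "z \<in> t_closure D (D \<star> G)"
    then obtain X where "X \<subseteq> D \<star> G" "z \<in> v_closure D X" unfolding t_closure_iff[OF I] by blast
    then show "z \<in> D" using v_closure_subset_D[of X] ID by blast
  qed
  moreover have "\<not> t_closure D (D \<star> G) \<subseteq> M" if "M \<in> t_Max D" for M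
    using no[OF that] t_closure_extensive[OF I] GI by blast
  ultimately have "1 \<in> t_closure D (D \<star> G)"
    using ex_t_Max[OF t_ideal_t_closure[OF I]] by blast
  then obtain Y where Y: "finite Y" "Y \<subseteq> D \<star> G" "1 \<in> v_closure D Y" unfolding t_closure_iff[OF I] by blast
  then obtain X where X: "finite X" "X \<subseteq> G" "Y \<subseteq> X \<star> D"
    using mprod_finite_set[of Y G D] by (auto simp: mprod_comm)
  have "\<not> X \<subseteq> M" if M: "M \<in> t_Max D" for M
  proof
    assume "X \<subseteq> M"
    then have "X \<star> D \<subseteq> D \<star> M" using mprod_mono[of X M D D] by (simp add: mprod_comm)
    also have "\<dots> \<subseteq> M" by (rule mprod_submod_subset[OF t_MaxD(4)[OF M]])
    finally have "v_closure D Y \<subseteq> M" using t_idealD(3)[OF t_MaxD(1)[OF M] Y(1)] X(3) by blast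
    then show False using Y(3) t_MaxD(3)[OF M] by blast
  qed
  then show ?thesis using X by blast
qed

text \<open>For a outside M, the ideal of all d in D with a d \<in> M is a t-ideal, since
  multiplication by a carries v-closures into v-closures. It is proper and contains M, hence equals
  M.\<close>

lemma t_Max_prime:
  assumes M: "M \<in> t_Max D" and ab: "a \<in> D" "b \<in> D" "a * b \<in> M" and a: "a \<notin> M"
  shows "b \<in> M"
proof -
  note Ms = t_MaxD[OF M]
  define N where "N = {d \<in> D. a * d \<in> M}"
  have MN: "M \<subseteq> N" using Ms(2) submodD(4)[OF Ms(4) ab(1)] by (auto simp: N_def)
  have "submod D N"
    using Ds submodD[OF Ms(4)] by (auto simp: N_def submod_def distrib_left mult.left_commute)
  moreover obtain m where "m \<in> M" "m \<noteq> 0" using nz_idealE[OF Ms(5)] by metis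
  ultimately have nz: "N \<in> nz_ideals D" using MN by (intro nz_idealI[of N m 1]) (auto simp: N_def)
  have "t_ideal D N"
  proof (rule t_idealI[OF nz], rule subsetI)
    fix X z assume X: "finite X" "X \<subseteq> N" and z: "z \<in> v_closure D X"
    have "a * z \<in> v_closure D ((\<lambda>x. a * x) ` X)"
      unfolding v_closure_def
    proof (rule colonI)
      fix y assume y: "y \<in> colon D ((\<lambda>x. a * x) ` X)"
      have "y * a \<in> colon D X" using y by (auto simp: colon_def mult.assoc)
      then have "z * (y * a) \<in> D" using z by (auto simp: v_closure_def dest: colonD)
      then show "a * z * y \<in> D" by (simp add: mult_ac)
    qed
    moreover have "v_closure D ((\<lambda>x. a * x) ` X) \<subseteq> M"
      using X by (intro t_idealD(3)[OF Ms(1)]) (auto simp: N_def)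
    moreover have "z \<in> D" using v_closure_subset_D[of X] X(2) z by (auto simp: N_def)
    ultimately show "z \<in> N" by (auto simp: N_def)
  qed
  moreover have "1 \<notin> N" using a by (simp add: N_def)
  then have "N \<noteq> D" using Ds(1) by blast
  then have "N \<subset> D" by (auto simp: N_def)
  ultimately have "N = M" using Ms(6) MN by blast
  moreover have "b \<in> N" using ab by (simp add: N_def)
  ultimately show ?thesis by simp
qed

lemma t_Max_prime_ideal: "M \<in> t_Max D \<Longrightarrow> prime_ideal D M"
proof -
  assume M: "M \<in> t_Max D"
  have "M \<noteq> D" using t_MaxD(3)[OF M] Ds(1) by blast
  moreover have "\<forall>a\<in>D. \<forall>b\<in>D. a * b \<in> M \<longrightarrow> a \<in> M \<or> b \<in> M"
  proof (intro ballI impI)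
    fix a b assume "a \<in> D" "b \<in> D" "a * b \<in> M"
    then show "a \<in> M \<or> b \<in> M" using t_Max_prime[OF M, of a b] by blast
  qed
  ultimately show ?thesis using t_MaxD(2,4)[OF M] by (simp add: prime_ideal_def psubset_eq)
qed

lemma t_Max_power:
  assumes "M \<in> t_Max D" "x \<in> D" "x ^ n \<in> M" shows "x \<in> M"
  using assms(3)
proof (induction n)
  case 0 then show ?case using t_MaxD(3)[OF assms(1)] by simp
next
  case (Suc n) then show ?case using t_Max_prime[OF assms(1,2), of "x ^ n"] Ds(8)[OF assms(2)] by auto
qed

text \<open>If z were outside D, its ideal of denominators (D : {1, z}) would be divisorial and
  proper, hence inside some t-maximal M; but z \<in> D_M has a denominator outside M.\<close>

lemma localization_Int:
  assumes "\<And>M. M \<in> t_Max D \<Longrightarrow> z \<in> localization D M"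
  shows "z \<in> D"
proof (rule ccontr)
  assume z: "z \<notin> D"
  define J where "J = colon D {1, z}"
  have J: "x \<in> J \<longleftrightarrow> x \<in> D \<and> z * x \<in> D" for x by (auto simp: J_def colon_def mult.commute)
  obtain a b where ab: "a \<in> D" "b \<in> D" "b \<noteq> 0" "z = a / b" using fraction by blast
  have "J \<in> nz_ideals D"
    using ab J submod_colon[OF D_submod] by (intro nz_idealI[of J b 1]) (auto simp: J_def)
  moreover have "v_closure D J = J" by (simp add: v_closure_def J_def colon_triple)
  ultimately have "t_ideal D J" by (rule v_ideal_t_ideal)
  moreover have "J \<subseteq> D" "1 \<notin> J" using J z by auto
  ultimately obtain M where M: "M \<in> t_Max D" "J \<subseteq> M" using ex_t_Max by blast
  then obtain a s where "a \<in> D" "s \<in> D" "s \<notin> M" "z = a / s" using assms[OF M(1)] by (auto simp: localization_def)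
  moreover have "s \<noteq> 0" using calculation(3) submodD(2)[OF t_MaxD(4)[OF M(1)]] by blast
  ultimately have "s \<in> J" by (simp add: J)
  then show False using M(2) \<open>s \<notin> M\<close> by blast
qed

text \<open>An empty intersection of localizations would be the whole field, and D would be a
  field.\<close>

lemma t_Max_nonempty:
  assumes "\<not> (\<forall>x\<in>D. x \<noteq> 0 \<longrightarrow> inverse x \<in> D)"
  shows "t_Max D \<noteq> {}"
proof
  assume "t_Max D = {}"
  then have "x \<in> D" for x using localization_Int[of x] by blast
  then show False using assms by blast
qed

section \<open>Localizations at t-maximal ideals\<close>

lemma localizationI: "a \<in> D \<Longrightarrow> s \<in> D \<Longrightarrow> s \<notin> M \<Longrightarrow> a / s \<in> localization D M"
  by (auto simp: localization_def)

lemma localizationE: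
  assumes "x \<in> localization D M" "M \<in> t_Max D"
  obtains a s where "a \<in> D" "s \<in> D" "s \<notin> M" "s \<noteq> 0" "x = a / s"
proof -
  obtain a s where as: "a \<in> D" "s \<in> D" "s \<notin> M" "x = a / s"
    using assms(1) by (auto simp: localization_def)
  moreover have "s \<noteq> 0" using as(3) submodD(2)[OF t_MaxD(4)[OF assms(2)]] by blast
  ultimately show thesis using that by blast
qed

lemma t_Max_mult: "M \<in> t_Max D \<Longrightarrow> s \<in> D \<Longrightarrow> t \<in> D \<Longrightarrow> s \<notin> M \<Longrightarrow> t \<notin> M \<Longrightarrow> s * t \<in> D \<and> s * t \<notin> M"
  using t_Max_prime[of M s t] Ds(6)[of s t] by auto

lemma D_subset_localization: "M \<in> t_Max D \<Longrightarrow> D \<subseteq> localization D M"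
proof
  fix a assume "M \<in> t_Max D" "a \<in> D"
  then have "a / 1 \<in> localization D M" by (intro localizationI Ds(1) t_MaxD(3))
  then show "a \<in> localization D M" by simp
qed

lemma subring_localization:
  assumes M: "M \<in> t_Max D" shows "subring (localization D M)"
  unfolding subring_def
proof (intro conjI ballI)
  show "1 \<in> localization D M" using D_subset_localization[OF M] Ds(1) by blast
  fix x y assume "x \<in> localization D M" "y \<in> localization D M"
  then obtain a s b t where as: "a \<in> D" "s \<in> D" "s \<notin> M" "s \<noteq> 0" "x = a / s"
    and bt: "b \<in> D" "t \<in> D" "t \<notin> M" "t \<noteq> 0" "y = b / t" using localizationE[OF _ M] by metis
  have "x - y = (a * t - b * s) / (s * t)" "x * y = (a * b) / (s * t)"
    using as bt by (auto simp: field_simps)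
  moreover have "a * t - b * s \<in> D" "a * b \<in> D" using as bt Ds(4,6) by auto
  ultimately show "x - y \<in> localization D M" "x * y \<in> localization D M"
    using t_Max_mult[OF M, of s t] as bt localizationI by auto
qed

lemma nonunits_localization:
  assumes M: "M \<in> t_Max D"
  shows "x \<in> nonunits (localization D M) \<longleftrightarrow> (\<exists>m\<in>M. \<exists>s\<in>D - M. x = m / s)"
proof
  assume x: "x \<in> nonunits (localization D M)"
  then obtain a s where as: "a \<in> D" "s \<in> D" "s \<notin> M" "x = a / s"
    using localizationE[of x M] M unfolding nonunits_def by blast
  have "a \<in> M"
  proof (rule ccontr)
    assume a: "a \<notin> M"
    then have "s / a \<in> localization D M" "a \<noteq> 0"
      using as localizationI submodD(2)[OF t_MaxD(4)[OF M]] by auto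
    then show False using x as submodD(2)[OF t_MaxD(4)[OF M]] by (auto simp: nonunits_def)
  qed
  then show "\<exists>m\<in>M. \<exists>s\<in>D - M. x = m / s" using as by blast
next
  assume "\<exists>m\<in>M. \<exists>s\<in>D - M. x = m / s"
  then obtain m s where ms: "m \<in> M" "s \<in> D" "s \<notin> M" "x = m / s" by blast
  have s0: "s \<noteq> 0" using ms submodD(2)[OF t_MaxD(4)[OF M]] by auto
  have "inverse x \<notin> localization D M" if "x \<noteq> 0"
  proof
    assume "inverse x \<in> localization D M"
    then obtain b t where bt: "b \<in> D" "t \<in> D" "t \<notin> M" "t \<noteq> 0" "inverse x = b / t"
      using localizationE[OF _ M] by metis
    then have "s * t = m * b" using that ms s0 by (simp add: field_simps)
    then have "s * t \<in> M" using submodD(5)[OF t_MaxD(4)[OF M] bt(1) ms(1)] by simp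
    then show False using t_Max_mult[OF M] ms bt by blast
  qed
  moreover have "x \<in> localization D M" using ms t_MaxD(2)[OF M] localizationI by auto
  ultimately show "x \<in> nonunits (localization D M)" by (auto simp: nonunits_def)
qed

lemma local_domain_localization:
  assumes M: "M \<in> t_Max D" shows "local_domain (localization D M)"
proof
  note sr = subringD[OF subring_localization[OF M]]
  show "1 \<in> localization D M" "\<And>a b. a \<in> localization D M \<Longrightarrow> b \<in> localization D M \<Longrightarrow> a - b \<in> localization D M"
    "\<And>a b. a \<in> localization D M \<Longrightarrow> b \<in> localization D M \<Longrightarrow> a * b \<in> localization D M" by (auto intro: sr)
  show "\<exists>a\<in>localization D M. \<exists>b\<in>localization D M. b \<noteq> 0 \<and> x = a / b" for x
    using fraction[of x] D_subset_localization[OF M] by blast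
  fix x y assume "x \<in> nonunits (localization D M)" "y \<in> nonunits (localization D M)"
  then obtain m s n t where mn: "m \<in> M" "s \<in> D" "s \<notin> M" "x = m / s" "n \<in> M" "t \<in> D" "t \<notin> M" "y = n / t"
    by (auto simp: nonunits_localization[OF M])
  have "s \<noteq> 0" "t \<noteq> 0" using mn submodD(2)[OF t_MaxD(4)[OF M]] by auto
  then have "x + y = (m * t + n * s) / (s * t)" using mn by (simp add: field_simps)
  moreover have "m * t + n * s \<in> M" using mn submodD(3,5)[OF t_MaxD(4)[OF M]] by blast
  ultimately show "x + y \<in> nonunits (localization D M)"
    using t_Max_mult[OF M, of s t] mn nonunits_localization[OF M] by blast
qed

lemma mem_mprod_localization:
  assumes M: "M \<in> t_Max D" and I: "submod D I"
  shows "z \<in> I \<star> localization D M \<longleftrightarrow> (\<exists>s\<in>D - M. s * z \<in> I)"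
proof
  have 1: "1 \<in> D - M" using Ds(1) t_MaxD(3)[OF M] by blast
  have "I \<star> localization D M \<subseteq> {z. \<exists>s\<in>D - M. s * z \<in> I}"
  proof (rule mprod_least)
    have "\<exists>u\<in>D - M. u * (x + y) \<in> I" if st: "s \<in> D - M" "t \<in> D - M" "s * x \<in> I" "t * y \<in> I" for s t x y
    proof
      show "s * t \<in> D - M" using t_Max_mult[OF M] st by blast
      have "t * (s * x) + s * (t * y) \<in> I"
        using submodD(3)[OF I submodD(4)[OF I _ st(3)] submodD(4)[OF I _ st(4)]] st(1,2) by blast
      then show "s * t * (x + y) \<in> I" by (simp add: algebra_simps)
    qed
    then show "addsub {z. \<exists>s\<in>D - M. s * z \<in> I}" using 1 submodD(2)[OF I] by (auto simp: addsub_def)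
    fix i x assume i: "i \<in> I" and "x \<in> localization D M"
    then obtain a s where as: "a \<in> D" "s \<in> D" "s \<notin> M" "s \<noteq> 0" "x = a / s" using localizationE[OF _ M] by metis
    then have "s * (i * x) = a * i" by (simp add: field_simps)
    then have "s * (i * x) \<in> I" using submodD(4)[OF I as(1) i] by (simp only:)
    then show "i * x \<in> {z. \<exists>s\<in>D - M. s * z \<in> I}" using as(2,3) by blast
  qed
  then show "z \<in> I \<star> localization D M \<Longrightarrow> \<exists>s\<in>D - M. s * z \<in> I" by blast
  assume "\<exists>s\<in>D - M. s * z \<in> I"
  then obtain s where s: "s \<in> D" "s \<notin> M" "s * z \<in> I" by blast
  have "s \<noteq> 0" using s submodD(2)[OF t_MaxD(4)[OF M]] by auto
  then have "z = (s * z) * (1 / s)" by simp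
  then show "z \<in> I \<star> localization D M" using mprodI[OF s(3) localizationI[OF Ds(1) s(1,2)]] by simp
qed

lemma subset_mprod_localization: "M \<in> t_Max D \<Longrightarrow> I \<subseteq> I \<star> localization D M"
proof
  fix x assume "M \<in> t_Max D" "x \<in> I"
  then have "x * 1 \<in> I \<star> localization D M" by (intro mprodI subringD(1) subring_localization)
  then show "x \<in> I \<star> localization D M" by simp
qed

lemma submod_mprod_localization: "M \<in> t_Max D \<Longrightarrow> submod (localization D M) (I \<star> localization D M)"
  by (intro submod_mprod_right subring_submod subring_localization)

lemma mprod_localization_least:
  "M \<in> t_Max D \<Longrightarrow> submod (localization D M) L \<Longrightarrow> I \<subseteq> L \<Longrightarrow> I \<star> localization D M \<subseteq> L"
  using mprod_mono[of "localization D M" "localization D M" I L]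
    mprod_submod_subset[of "localization D M" L] by (subst mprod_comm) blast

section \<open>The w-closure seen through localizations\<close>

lemma w_closure_eq: "submod D I \<Longrightarrow> w_closure D I = (\<Inter>M\<in>t_Max D. I \<star> localization D M)"
  by (simp add: w_closure_def ideal_prod_eq_mprod[OF D_subring])

lemma w_closure_extensive: "submod D I \<Longrightarrow> I \<subseteq> w_closure D I"
  by (simp add: w_closure_eq INT_greatest subset_mprod_localization)

lemma submod_w_closure: "submod D I \<Longrightarrow> submod D (w_closure D I)"
  unfolding w_closure_eq by (rule submod_Inter) (auto intro: submod_mprod_left)

lemma w_closure_localization:
  assumes M: "M \<in> t_Max D" and I: "submod D I"
  shows "w_closure D I \<star> localization D M = I \<star> localization D M"
proof
  have "w_closure D I \<subseteq> I \<star> localization D M" using M by (auto simp: w_closure_eq[OF I])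
  then show "w_closure D I \<star> localization D M \<subseteq> I \<star> localization D M"
    by (rule mprod_localization_least[OF M submod_mprod_localization[OF M]])
  show "I \<star> localization D M \<subseteq> w_closure D I \<star> localization D M"
    by (rule mprod_mono[OF w_closure_extensive[OF I] subset_refl])
qed

lemma w_closure_nz_ideal:
  assumes I: "I \<in> nz_ideals D"
  shows "w_closure D I \<in> nz_ideals D"
proof -
  obtain a d where d: "submod D I" "a \<in> I" "a \<noteq> 0" "d \<in> D" "d \<noteq> 0" "\<And>x. x \<in> I \<Longrightarrow> d * x \<in> D"
    using nz_idealE[OF I] by metis
  have "d * x \<in> D" if x: "x \<in> w_closure D I" for x
  proof (rule localization_Int)
    fix M assume M: "M \<in> t_Max D"
    then obtain s where s: "s \<in> D" "s \<notin> M" "s * x \<in> I"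
      using x mem_mprod_localization[OF M d(1)] by (auto simp: w_closure_eq[OF d(1)])
    have "s \<noteq> 0" using s submodD(2)[OF t_MaxD(4)[OF M]] by auto
    then have "d * x = (d * (s * x)) / s" by simp
    then show "d * x \<in> localization D M" using localizationI[OF d(6)[OF s(3)] s(1,2)] by simp
  qed
  then show ?thesis
    using d w_closure_extensive[OF d(1)] by (intro nz_idealI[OF submod_w_closure[OF d(1)], of a d]) auto
qed

text \<open>Intersecting with D would lose the part of L outside D_M. The condition d x \<in> D,
  with d a denominator of L, cuts out a fractional ideal of D instead, and every x in L enters it
  after multiplication by some s outside M.\<close>

lemma nz_ideal_contract:
  assumes M: "M \<in> t_Max D" and L: "L \<in> nz_ideals (localization D M)"
  shows "\<exists>I\<in>nz_ideals D. I \<subseteq> L \<and> I \<star> localization D M = L"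
proof -
  interpret loc: local_domain "localization D M" by (rule local_domain_localization[OF M])
  obtain a d where a: "submod (localization D M) L" "a \<in> L" "a \<noteq> 0" "d \<noteq> 0"
    and d: "\<And>x. x \<in> L \<Longrightarrow> d * x \<in> localization D M" using loc.nz_idealE[OF L] by metis
  have LD: "submod D L" by (rule submod_antimono[OF a(1) D_subset_localization[OF M]])
  define I where "I = {x \<in> L. d * x \<in> D}"
  have sub: "submod D I"
    using submodD[OF LD] Ds by (auto simp: I_def submod_def distrib_left mult.left_commute)
  have mem: "\<exists>s\<in>D - M. s * x \<in> I" if x: "x \<in> L" for x
  proof -
    obtain b s where bs: "b \<in> D" "s \<in> D" "s \<notin> M" "s \<noteq> 0" "d * x = b / s"
      using localizationE[OF d[OF x] M] by metis
    then have "d * (s * x) = b" by (simp add: field_simps)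
    then show ?thesis using bs submodD(4)[OF LD bs(2) x] by (auto simp: I_def)
  qed
  obtain s where s: "s \<in> D - M" "s * a \<in> I" using mem[OF a(2)] by blast
  have "s \<noteq> 0" using s submodD(2)[OF t_MaxD(4)[OF M]] by auto
  then have "I \<in> nz_ideals D" using a s by (intro nz_idealI[OF sub s(2) _ a(4)]) (auto simp: I_def)
  moreover have "I \<star> localization D M \<subseteq> L"
    by (rule mprod_localization_least[OF M a(1)]) (auto simp: I_def)
  moreover have "L \<subseteq> I \<star> localization D M" using mem mem_mprod_localization[OF M sub] by blast
  ultimately show ?thesis by (intro bexI[of _ I]) (auto simp: I_def)
qed

end

section \<open>Passing between the domain and its localizations\<close>

definition isolated :: "'k::field set \<Rightarrow> 'k set \<Rightarrow> bool" where
  "isolated D M \<longleftrightarrow> (\<exists>A\<subseteq>M. finite A \<and> (\<forall>M'\<in>t_Max D. A \<subseteq> M' \<longrightarrow> M' = M))"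

context domain_in_fraction_field
begin

lemma w_stable_ideal_eq:
  assumes "submod D I" "W = w_closure D I" "E = colon W W"
  shows "w_stable_ideal D I \<longleftrightarrow> w_closure D (W \<star> colon E W) = E"
  using assms submod_w_closure by (simp add: w_stable_ideal_def Let_def ideal_prod_eq_mprod[OF D_subring])

text \<open>Only E \<subseteq> (L : L) and (E : W) \<subseteq> ((L : L) : L) are used. Both hold
  without any finiteness, because L = W D_M.\<close>

lemma w_stable_localization:
  assumes st: "w_stable D" and M: "M \<in> t_Max D"
  shows "stable (localization D M)"
  unfolding stable_def
proof
  fix L assume L: "L \<in> nz_ideals (localization D M)"
  obtain I where I: "I \<in> nz_ideals D" "I \<star> localization D M = L" using nz_ideal_contract[OF M L] by blast
  have sI: "submod D I" using nz_idealE[OF I(1)] by metis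
  have sL: "submod (localization D M) L" using submod_mprod_localization[OF M, of I] I(2) by simp
  define W where "W = w_closure D I"
  define E where "E = colon W W"
  have WL: "W \<star> localization D M = L" using w_closure_localization[OF M sI] I(2) by (simp add: W_def)
  have sW: "submod D W" unfolding W_def by (rule submod_w_closure[OF sI])
  have "w_closure D (W \<star> colon E W) = E"
    using st I(1) w_stable_ideal_eq[OF sI W_def E_def] by (auto simp: w_stable_def)
  moreover have "1 \<in> E" by (auto simp: E_def intro: colonI)
  ultimately have "1 \<in> (W \<star> colon E W) \<star> localization D M"
    using M by (auto simp: w_closure_eq[OF submod_mprod_left[OF sW]])
  also have "\<dots> = L \<star> colon E W" by (simp add: WL[symmetric] mprod_ac)
  also have "\<dots> \<subseteq> L \<star> colon (colon L L) L"
  proof (rule mprod_mono[OF subset_refl])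
    have addL: "addsub L" by (rule submodD[OF sL])
    have "E \<star> L = (E \<star> W) \<star> localization D M" by (simp add: WL[symmetric] mprod_assoc)
    also have "\<dots> \<subseteq> W \<star> localization D M"
      unfolding E_def by (intro mprod_mono colon_mprod_subset subset_refl submodD(1)[OF sW])
    finally have "E \<star> L \<subseteq> L" by (simp add: WL)
    then have EL: "E \<subseteq> colon L L" by (rule mprod_subset_colon)
    have "submod (localization D M) (colon L L)" by (rule submod_colon[OF sL])
    then have LL: "(colon L L) \<star> localization D M \<subseteq> colon L L"
      using mprod_submod_subset by (subst mprod_comm)
    have addE: "addsub E" unfolding E_def by (rule addsub_colon[OF submodD(1)[OF sW]])
    have "colon E W \<star> L = (colon E W \<star> W) \<star> localization D M" by (simp add: WL[symmetric] mprod_assoc)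
    also have "\<dots> \<subseteq> colon L L \<star> localization D M"
      using colon_mprod_subset[OF addE, of W] EL by (intro mprod_mono) auto
    also note LL
    finally show "colon E W \<subseteq> colon (colon L L) L" by (rule mprod_subset_colon)
  qed
  finally show "1 \<in> L \<star> colon (colon L L) L" .
qed

lemma w_closure_mprod_localization:
  assumes M: "M \<in> t_Max D" and I: "submod D I"
  shows "w_closure D I \<subseteq> I \<star> localization D M"
  using M by (auto simp: w_closure_eq[OF I])

text \<open>The w-equation localizes to L = L L J, and this forces J into ((L : L) : L).\<close>

lemma clifford_localization:
  assumes cl: "clifford_w_regular D" and M: "M \<in> t_Max D"
  shows "regular (localization D M)"
  unfolding regular_def
proof
  fix L assume L: "L \<in> nz_ideals (localization D M)"
  let ?R = "localization D M"
  obtain I where I: "I \<in> nz_ideals D" "I \<star> ?R = L" using nz_ideal_contract[OF M L] by blast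
  have sI: "submod D I" using nz_idealE[OF I(1)] by metis
  have sL: "submod ?R L" using submod_mprod_localization[OF M, of I] I(2) by simp
  have addL: "addsub L" by (rule submodD[OF sL])
  have RR: "?R \<star> ?R = ?R"
    using subring_localization[OF M] by (intro mprod_submod subringD(1) subring_submod)
  obtain J where J: "J \<in> nz_ideals D" "w_closure D I = w_closure D (I \<star> I \<star> J)"
    using cl I(1) ideal_prod_eq_mprod[OF D_subring] sI submod_mprod_left[OF sI]
    by (auto simp: clifford_w_regular_def w_regular_ideal_def)
  have sIIJ: "submod D (I \<star> I \<star> J)" by (intro submod_mprod_left sI)
  have "I \<star> I \<star> J \<star> ?R = I \<star> ?R"
    using w_closure_localization[OF M sI] w_closure_localization[OF M sIIJ] J(2) by simp
  moreover have "L \<star> L \<star> J = I \<star> I \<star> J \<star> ?R"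
  proof -
    have "L \<star> L \<star> J = I \<star> I \<star> J \<star> (?R \<star> ?R)" by (simp add: I(2)[symmetric] mprod_ac)
    then show ?thesis by (simp add: RR)
  qed
  ultimately have LLJ: "L \<star> L \<star> J = L" using I(2) by simp
  have "J \<subseteq> colon L (L \<star> L)" by (rule mprod_subset_colon) (use LLJ in \<open>simp add: mprod_ac\<close>)
  then have "J \<subseteq> colon (colon L L) L" by (simp add: colon_colon[OF addL])
  then have "L \<star> (L \<star> J) \<subseteq> L \<star> (L \<star> colon (colon L L) L)" by (intro mprod_mono subset_refl)
  then show "L \<subseteq> L \<star> (L \<star> colon (colon L L) L)" using LLJ by (simp add: mprod_assoc)
qed

text \<open>A counterexample I would have finite subsets with strictly decreasing colons. A
  denominator d of I moves their v-closures into D, where they form a strictly ascending chain of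
  divisorial ideals.\<close>

lemma mori_v_finite:
  assumes mori: "mori D" shows "v_finite D"
  unfolding v_finite_def
proof (rule ballI, rule ccontr)
  fix I assume I: "I \<in> nz_ideals D" and no: "\<not> (\<exists>A\<subseteq>I. finite A \<and> colon D A = colon D I)"
  obtain a d where d: "submod D I" "a \<in> I" "a \<noteq> 0" "d \<in> D" "d \<noteq> 0" "\<And>x. x \<in> I \<Longrightarrow> d * x \<in> D"
    using nz_idealE[OF I] by metis
  define P where "P A \<longleftrightarrow> finite A \<and> A \<subseteq> I \<and> a \<in> A" for A
  have "\<exists>f. \<forall>n::nat. P (f n) \<and> (f n \<subseteq> f (Suc n) \<and> colon D (f n) \<noteq> colon D (f (Suc n)))"
  proof (rule dependent_nat_choice)
    show "\<exists>A. P A" using d(2) by (intro exI[of _ "{a}"]) (auto simp: P_def)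
    fix A assume A: "P A"
    then have "colon D A \<noteq> colon D I" "colon D I \<subseteq> colon D A"
      using no colon_mono[OF subset_refl, of A I D] by (auto simp: P_def)
    then obtain z where z: "z \<in> colon D A" "z \<notin> colon D I" by blast
    then obtain e where e: "e \<in> I" "z * e \<notin> D" by (auto simp: colon_def)
    have "z \<notin> colon D (insert e A)" using e(2) colonD[of z D "insert e A" e] by auto
    then show "\<exists>B. P B \<and> (A \<subseteq> B \<and> colon D A \<noteq> colon D B)"
      using A e(1) z(1) by (intro exI[of _ "insert e A"]) (auto simp: P_def)
  qed
  then obtain f where f: "\<And>n. P (f n)" "\<And>n. f n \<subseteq> f (Suc n)" "\<And>n. colon D (f n) \<noteq> colon D (f (Suc n))"
    by blast
  define G where "G n = v_closure D ((\<lambda>x. d * x) ` f n)" for n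
  have GD: "G n \<subseteq> D" for n
    unfolding G_def using f(1)[of n] d(6) by (intro v_closure_subset_D) (auto simp: P_def)
  have "divisorial D (G n)" for n
  proof -
    have "d * a \<in> G n" using f(1)[of n] v_closure_extensive[of "(\<lambda>x. d * x) ` f n" D] by (auto simp: G_def P_def)
    then have "G n \<in> nz_ideals D"
      using GD[of n] d by (intro nz_idealI[of "G n" "d * a" 1]) (auto simp: G_def intro: submod_v_closure)
    then show ?thesis by (simp add: divisorial_def G_def v_closure_idem)
  qed
  moreover have "G n \<subseteq> G (Suc n)" for n unfolding G_def using f(2) by (intro v_closure_mono image_mono)
  ultimately obtain N where N: "\<forall>n\<ge>N. G n = G N" using mori GD unfolding mori_def by meson
  \<comment> \<open>Scaling by d loses nothing: the colon of \<open>f n\<close> is recovered from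
    \<open>G n\<close>.\<close>
  have scale: "colon D (f n) = {z. z / d \<in> colon D (G n)}" for n
    unfolding G_def v_closure_def colon_triple using d(5) by (auto simp: colon_def)
  have "G (Suc N) = G N" by (rule N[rule_format]) simp
  then show False using f(3)[of N] by (simp add: scale)
qed

lemma localization_finite:
  assumes M: "M \<in> t_Max D" and X: "finite X" "X \<subseteq> I \<star> localization D M" and I: "submod D I"
  shows "\<exists>s\<in>D - M. \<forall>x\<in>X. s * x \<in> I"
  using X
proof (induction rule: finite_induct)
  case empty then show ?case using Ds(1) t_MaxD(3)[OF M] by auto
next
  case (insert x X)
  then obtain s where s: "s \<in> D - M" "\<forall>x\<in>X. s * x \<in> I" by auto
  obtain t where t: "t \<in> D - M" "t * x \<in> I" using mem_mprod_localization[OF M I] insert.prems by auto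
  have "s * t * y \<in> I" if "y \<in> insert x X" for y
  proof (cases "y = x")
    case True
    then show ?thesis using submodD(4)[OF I, of s "t * x"] s t by (simp add: mult.assoc)
  next
    case False
    then have "t * (s * y) \<in> I" using submodD(4)[OF I, of t "s * y"] s t that by auto
    then show ?thesis by (simp add: mult_ac)
  qed
  then show ?case using t_Max_mult[OF M, of s t] s t by (intro bexI[of _ "s * t"]) auto
qed

lemma localization_eq: "M \<in> t_Max D \<Longrightarrow> D \<star> localization D M = localization D M"
  using mprod_submod[OF Ds(1) submod_antimono[OF subring_submod D_subset_localization]] subring_localization by blast

text \<open>For z in (D_M : A), finiteness of A gives one s outside M with s z \<in> (D : A) = (D :
  I), and dividing by s returns to (D_M : I).\<close>

lemma v_finite_localization:
  assumes vf: "v_finite D" and M: "M \<in> t_Max D"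
  shows "v_finite (localization D M)"
  unfolding v_finite_def
proof
  fix L assume L: "L \<in> nz_ideals (localization D M)"
  let ?R = "localization D M"
  obtain I where I: "I \<in> nz_ideals D" "I \<subseteq> L" "I \<star> ?R = L" using nz_ideal_contract[OF M L] by blast
  obtain A where A: "A \<subseteq> I" "finite A" "colon D A = colon D I" using vf I(1) by (auto simp: v_finite_def)
  have "colon ?R A \<subseteq> colon ?R L"
  proof
    fix z assume z: "z \<in> colon ?R A"
    have "(\<lambda>a. z * a) ` A \<subseteq> D \<star> ?R" using z by (auto simp: localization_eq[OF M] dest: colonD)
    then obtain s where s: "s \<in> D - M" "\<forall>x\<in>(\<lambda>a. z * a) ` A. s * x \<in> D"
      using localization_finite[OF M _ _ D_submod] A(2) by blast
    then have "s * z \<in> colon D A" by (auto simp: mult.assoc intro: colonI)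
    then have sz: "s * z \<in> colon D I" using A(3) by simp
    have "z \<in> colon ?R I"
    proof (rule colonI)
      fix i assume "i \<in> I"
      then have "s * (z * i) \<in> D" using colonD[OF sz] by (simp add: mult.assoc)
      then have "z * i \<in> D \<star> ?R" using mem_mprod_localization[OF M D_submod] s by blast
      then show "z * i \<in> ?R" by (simp add: localization_eq[OF M])
    qed
    then have "z \<in> colon ?R (?R \<star> I)" by (simp add: colon_mprod_ring[OF subring_localization[OF M]])
    then show "z \<in> colon ?R L" using I(3) by (simp add: mprod_comm)
  qed
  moreover have "colon ?R L \<subseteq> colon ?R A" using A(1) I(2) by (intro colon_mono) auto
  ultimately show "\<exists>A\<subseteq>L. finite A \<and> colon ?R A = colon ?R L"
    using A I(2) by (intro exI[of _ A]) auto
qed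

text \<open>The hypothesis on the powers of m says that cD avoids the multiplicative set S of all s
  m^n with s in D outside M. An ideal maximal among those containing c and avoiding S is prime, lies
  in M, and misses m.\<close>

lemma ex_prime_avoiding:
  assumes M: "M \<in> t_Max D" and c: "c \<in> D" "c \<noteq> 0" and m: "m \<in> M"
    and no: "\<And>n. m ^ n / c \<notin> localization D M"
  shows "\<exists>P. prime_ideal D P \<and> c \<in> P \<and> P \<subset> M"
proof -
  define S where "S = {s * m ^ n | s n. s \<in> D - M}"
  have mD: "m \<in> D" using m t_MaxD(2)[OF M] by blast
  have SI: "s * m ^ n \<in> S" if "s \<in> D - M" for s n using that by (auto simp: S_def)
  have S_mult: "s * t \<in> S" if st: "s \<in> S" "t \<in> S" for s t
  proof -
    obtain a i b j where "s = a * m ^ i" "t = b * m ^ j" "a \<in> D - M" "b \<in> D - M"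
      using st by (auto simp: S_def)
    moreover from this have "a * b \<in> D - M" using t_Max_mult[OF M, of a b] by blast
    ultimately show ?thesis using SI[of "a * b" "i + j"] by (simp add: power_add mult_ac)
  qed
  have one: "1 \<in> D - M" using Ds(1) t_MaxD(3)[OF M] by blast
  define \<A> where "\<A> = {I. submod D I \<and> I \<subseteq> D \<and> c \<in> I \<and> I \<inter> S = {}}"
  have "\<exists>P\<in>\<A>. \<forall>X\<in>\<A>. P \<subseteq> X \<longrightarrow> X = P"
  proof (rule subset_Zorn_nonempty)
    define I where "I = {x \<in> D. x / c \<in> D}"
    have "submod D I" using Ds by (auto simp: I_def submod_def add_divide_distrib simp flip: times_divide_eq_right)
    moreover have "I \<inter> S = {}"
    proof (rule ccontr)
      assume "I \<inter> S \<noteq> {}"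
      then obtain s n where s: "s \<in> D" "s \<notin> M" "s * m ^ n / c \<in> D" by (auto simp: I_def S_def)
      then have "s \<noteq> 0" using submodD(2)[OF t_MaxD(4)[OF M]] by auto
      then have "m ^ n / c = (s * m ^ n / c) / s" by simp
      then show False using localizationI[OF s(3,1,2)] no[of n] by simp
    qed
    ultimately have "I \<in> \<A>" using c Ds(1) by (auto simp: \<A>_def I_def)
    then show "\<A> \<noteq> {}" by blast
    fix \<C> assume C: "\<C> \<noteq> {}" "subset.chain \<A> \<C>"
    then have CA: "\<C> \<subseteq> \<A>" by (auto simp: subset.chain_def)
    have sub: "submod D N" if "N \<in> \<C>" for N using that CA by (auto simp: \<A>_def)
    have "submod D (\<Union>\<C>)"
    proof (rule submodI)
      have "x + y \<in> \<Union>\<C>" if xy: "x \<in> \<Union>\<C>" "y \<in> \<Union>\<C>" for x y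
      proof -
        obtain N where "N \<in> \<C>" "{x, y} \<subseteq> N"
          using finite_subset_Union_chain[of "{x, y}" \<C> \<A>] xy C by auto
        then show ?thesis using submodD(3)[OF sub, of N x y] by auto
      qed
      then show "addsub (\<Union>\<C>)" using C(1) submodD(2)[OF sub] by (auto simp: addsub_def)
      show "e * x \<in> \<Union>\<C>" if "e \<in> D" "x \<in> \<Union>\<C>" for e x
        using that submodD(4)[OF sub, of _ e x] by auto
    qed
    moreover obtain N where "N \<in> \<C>" using C(1) by blast
    ultimately show "\<Union>\<C> \<in> \<A>" using CA unfolding \<A>_def by blast
  qed
  then obtain P where "P \<in> \<A>" and max: "\<And>X. X \<in> \<A> \<Longrightarrow> P \<subseteq> X \<Longrightarrow> X = P" by blast
  then have P: "submod D P" "P \<subseteq> D" "c \<in> P" "P \<inter> S = {}" by (auto simp: \<A>_def)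
  have meets: "\<exists>p\<in>P. \<exists>d\<in>D. p + d * a \<in> S" if a: "a \<in> D" "a \<notin> P" for a
  proof (rule ccontr)
    assume disj: "\<not> ?thesis"
    define Q where "Q = {p + d * a | p d. p \<in> P \<and> d \<in> D}"
    have QI: "p + d * a \<in> Q" if "p \<in> P" "d \<in> D" for p d using that by (auto simp: Q_def)
    have PQ: "P \<subseteq> Q" using QI[OF _ Ds(2)] by auto
    have "submod D Q"
    proof (rule submodI)
      have "x + y \<in> Q" if xy: "x \<in> Q" "y \<in> Q" for x y
      proof -
        obtain p d p' d' where "x = p + d * a" "y = p' + d' * a" "p \<in> P" "d \<in> D" "p' \<in> P" "d' \<in> D"
          using xy by (auto simp: Q_def)
        then show ?thesis using QI[OF submodD(3)[OF P(1), of p p'] Ds(5)[of d d']] by (simp add: algebra_simps)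
      qed
      then show "addsub Q" using PQ submodD(2)[OF P(1)] by (auto simp: addsub_def)
      fix e x assume "e \<in> D" "x \<in> Q"
      then obtain p d where "x = p + d * a" "p \<in> P" "d \<in> D" by (auto simp: Q_def)
      then show "e * x \<in> Q" using QI[OF submodD(4)[OF P(1), of e p] Ds(6)[of e d]] \<open>e \<in> D\<close> by (simp add: algebra_simps)
    qed
    moreover have "Q \<subseteq> D" using P(2) a(1) Ds(5,6) by (auto simp: Q_def)
    moreover have "Q \<inter> S = {}" using disj by (auto simp: Q_def)
    ultimately have "Q = P" using PQ P(3) by (intro max) (auto simp: \<A>_def)
    moreover have "a \<in> Q" using QI[OF submodD(2)[OF P(1)] Ds(1)] by simp
    ultimately show False using a by blast
  qed
  have "a \<in> P \<or> b \<in> P" if ab: "a \<in> D" "b \<in> D" "a * b \<in> P" for a b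
  proof (rule ccontr)
    assume "\<not> ?thesis"
    then obtain p d p' d' where 1: "p \<in> P" "d \<in> D" "p + d * a \<in> S" "p' \<in> P" "d' \<in> D" "p' + d' * b \<in> S"
      using meets[OF ab(1)] meets[OF ab(2)] by blast
    have "(p + d * a) * (p' + d' * b) = (p' + d' * b) * p + (d * a) * p' + (d * d') * (a * b)"
      by (simp add: algebra_simps)
    also have "\<dots> \<in> P"
    proof -
      have "p' + d' * b \<in> D" "d * a \<in> D" "d * d' \<in> D" using 1 P(2) ab Ds(5,6) by auto
      then show ?thesis
        using submodD(3)[OF P(1) submodD(3)[OF P(1) submodD(4)[OF P(1) _ 1(1)] submodD(4)[OF P(1) _ 1(4)]]
            submodD(4)[OF P(1) _ ab(3)]] by blast
    qed
    finally show False using S_mult[OF 1(3,6)] P(4) by blast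
  qed
  moreover have PM: "P \<subseteq> M"
  proof
    fix x assume x: "x \<in> P"
    show "x \<in> M"
    proof (rule ccontr)
      assume "x \<notin> M"
      then have "x \<in> S" using SI[of x 0] x P(2) by auto
      then show False using x P(4) by blast
    qed
  qed
  moreover have "m \<notin> P" using SI[OF one, of 1] P(4) by auto
  moreover have "P \<noteq> D" using PM one by blast
  ultimately have "prime_ideal D P" "P \<subset> M" using P(1,2) m by (auto simp: prime_ideal_def)
  then show ?thesis using P(3) by blast
qed

lemma prime_zero: "prime_ideal D {0}"
  using Ds(1,2) submod_zero[of D] by (auto simp: prime_ideal_def)

text \<open>A failure of \<open>dimension_one\<close> produces a prime strictly between {0} and the
  t-prime M, which would then have height at least 2.\<close>

lemma t_dimension_one_localization:
  assumes dim: "t_dimension_one D" and M: "M \<in> t_Max D"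
  shows "dimension_one (localization D M)"
  unfolding dimension_one_def
proof (intro ballI impI, rule ccontr)
  fix x c assume x: "x \<in> nonunits (localization D M)" and c: "c \<in> localization D M" "c \<noteq> 0"
    and no: "\<nexists>n. x ^ n / c \<in> localization D M"
  obtain m s where ms: "m \<in> M" "s \<in> D" "s \<notin> M" "x = m / s" using x nonunits_localization[OF M] by auto
  obtain b t where bt: "b \<in> D" "t \<in> D" "t \<notin> M" "t \<noteq> 0" "c = b / t" using localizationE[OF c(1) M] by metis
  have s0: "s \<noteq> 0" using ms submodD(2)[OF t_MaxD(4)[OF M]] by auto
  \<comment> \<open>The failure for x = m/s and c = b/t is transferred to m and b, which lie in D;
    s^n stays outside M and can be inverted.\<close>
  have no': "m ^ n / b \<notin> localization D M" for n
  proof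
    assume 1: "m ^ n / b \<in> localization D M"
    have "s ^ n \<notin> M" using t_Max_power[OF M ms(2)] ms(3) by blast
    then have "t / s ^ n \<in> localization D M" using localizationI[OF bt(2) Ds(8)[OF ms(2)]] by blast
    then have "(m ^ n / b) * (t / s ^ n) \<in> localization D M"
      using 1 subringD(6)[OF subring_localization[OF M]] by blast
    moreover have "(m ^ n / b) * (t / s ^ n) = x ^ n / c"
      by (simp add: ms(4) bt(5) power_divide)
    ultimately show False using no by auto
  qed
  have "b \<noteq> 0" using c(2) bt(5) by auto
  then obtain P where P: "prime_ideal D P" "b \<in> P" "P \<subset> M" using ex_prime_avoiding[OF M bt(1) _ ms(1) no'] by blast
  define C where "C i = (if i = 0 then {0} else if i = 1 then P else M)" for i :: nat
  have C: "C 2 = M" "\<forall>i\<le>2. prime_ideal D (C i)" "\<forall>i<2. C i \<subset> C (Suc i)"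
    using P \<open>b \<noteq> 0\<close> t_Max_prime_ideal[OF M] prime_zero submodD(2)[of D P]
    by (auto simp: C_def prime_ideal_def less_Suc_eq numeral_2_eq_2)
  have "enat 2 \<le> height D M" unfolding height_def by (rule Sup_upper) (use C in blast)
  moreover have "height D M = 1"
    using dim t_Max_prime_ideal[OF M] t_MaxD(1)[OF M] by (auto simp: t_dimension_one_def t_prime_def)
  ultimately show False by (simp add: one_enat_def)
qed

text \<open>For x in M some x^n is a multiple of y in D_M. Clearing the denominator gives s x^n
  \<in> P with s outside M, hence outside P.\<close>

lemma dimension_one_prime_eq:
  assumes M: "M \<in> t_Max D" and dim: "dimension_one (localization D M)"
    and P: "prime_ideal D P" "P \<subseteq> M" and y: "y \<in> P" "y \<noteq> 0"
  shows "P = M"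
proof
  show "M \<subseteq> P"
  proof
    fix x assume x: "x \<in> M"
    have prime: "a \<in> P \<or> b \<in> P" if "a \<in> D" "b \<in> D" "a * b \<in> P" for a b
      using that P(1) by (auto simp: prime_ideal_def)
    have subs: "submod D P" "P \<subseteq> D" using P(1) by (auto simp: prime_ideal_def)
    have xD: "x \<in> D" using x t_MaxD(2)[OF M] by blast
    have "x / 1 \<in> nonunits (localization D M)"
      using x Ds(1) t_MaxD(3)[OF M] nonunits_localization[OF M] by blast
    moreover have "y \<in> localization D M" using y subs D_subset_localization[OF M] by blast
    ultimately obtain n where "x ^ n / y \<in> localization D M" using dim y(2) by (auto simp: dimension_one_def)
    then obtain a s where as: "a \<in> D" "s \<in> D" "s \<notin> M" "s \<noteq> 0" "x ^ n / y = a / s"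
      using localizationE[OF _ M] by metis
    then have "s * x ^ n = a * y" using y(2) by (simp add: field_simps)
    then have "s * x ^ n \<in> P" using submodD(4)[OF subs(1) as(1) y(1)] by simp
    then have xn: "x ^ n \<in> P" using prime[OF as(2) Ds(8)[OF xD]] as(3) P(2) by blast
    have "1 \<notin> P" using P(2) t_MaxD(3)[OF M] by blast
    then have "x ^ k \<in> P \<Longrightarrow> x \<in> P" for k
      by (induction k) (use prime[OF xD Ds(8)[OF xD]] in auto)
    then show "x \<in> P" using xn by blast
  qed
qed (rule P(2))

text \<open>By \<open>dimension_one_prime_eq\<close> a nonzero prime inside a t-maximal M is M
  itself, so t-primes are t-maximal and only {0} lies strictly below them.\<close>

lemma localization_t_dimension_one:
  assumes dim: "\<And>M. M \<in> t_Max D \<Longrightarrow> dimension_one (localization D M)"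
  shows "t_dimension_one D"
  unfolding t_dimension_one_def
proof (intro allI impI)
  fix P assume "t_prime D P"
  then have P: "prime_ideal D P" "t_ideal D P" by (auto simp: t_prime_def)
  have subs: "submod D P" "P \<subset> D" using P(1) by (auto simp: prime_ideal_def)
  have "1 \<notin> P" using subs submodD(5)[OF subs(1), of _ 1] by auto
  then obtain M where M: "M \<in> t_Max D" "P \<subseteq> M" using ex_t_Max[OF P(2)] subs by blast
  obtain y where y: "y \<in> P" "y \<noteq> 0" using nz_idealE[OF t_idealD(1)[OF P(2)]] by metis
  note prime_eq = dimension_one_prime_eq[OF M(1) dim[OF M(1)]]
  have PM: "P = M" by (rule prime_eq[OF P(1) M(2) y])
  show "height D P = 1"
  proof (rule antisym)
    show "height D P \<le> 1" unfolding height_def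
    proof (rule Sup_least)
      fix h assume "h \<in> {enat n |n. \<exists>C. (\<forall>i\<le>n. prime_ideal D (C i)) \<and> (\<forall>i<n. C i \<subset> C (Suc i)) \<and> C n = P}"
      then obtain n C where h: "h = enat n" and C: "\<forall>i\<le>n. prime_ideal D (C i)" "\<forall>i<n. C i \<subset> C (Suc i)" "C n = P"
        by blast
      have "n \<le> 1"
      proof (rule ccontr)
        assume "\<not> n \<le> 1"
        then obtain k where k: "n = Suc (Suc k)" by (metis One_nat_def less_one not_less_eq_eq old.nat.exhaust le_0_eq le_SucE order_refl zero_le)
        then have 1: "C k \<subset> C (Suc k)" "C (Suc k) \<subset> P" "prime_ideal D (C k)" "prime_ideal D (C (Suc k))"
          using C by auto
        then have "0 \<in> C k" by (auto simp: prime_ideal_def submod_def)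
        then obtain z where "z \<in> C (Suc k)" "z \<noteq> 0" using 1(1) by blast
        then have "C (Suc k) = M" using prime_eq[OF 1(4)] 1(2) PM by blast
        then show False using 1(2) PM by blast
      qed
      then show "h \<le> 1" by (simp add: h one_enat_def)
    qed
    have "{0} \<subset> P" using y submodD(2)[OF subs(1)] by auto
    then show "1 \<le> height D P" unfolding height_def one_enat_def
      using P(1) prime_zero
      by (intro Sup_upper CollectI exI[of _ 1] conjI exI[of _ "\<lambda>i. if i = 0 then {0} else P"]) auto
  qed
qed

text \<open>Let W be the w-closure of M, which turns out to be M. For N other than M, an element of
  M outside N is a unit of D_N, and this puts E and H = (E : W) into D_N. Stability puts 1 into W H
  D_N for every N, so W H \<inter> D lies in no N; by compactness a finite part X of it lies in no
  N, and X involves only a finite A \<subseteq> W. If A \<subseteq> N with N other than M, then X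
  \<subseteq> N D_N \<inter> D = N, a contradiction.\<close>

lemma w_stable_isolated:
  assumes st: "w_stable D" and M: "M \<in> t_Max D"
  shows "isolated D M"
proof -
  define W where "W = w_closure D M"
  define E where "E = colon W W"
  define H where "H = colon E W"
  have sM: "submod D M" by (rule t_MaxD(4)[OF M])
  have sW: "submod D W" unfolding W_def by (rule submod_w_closure[OF sM])
  have sX: "submod D (W \<star> H)" by (rule submod_mprod_left[OF sW])
  have WD: "W \<subseteq> localization D N" if N: "N \<in> t_Max D" for N
  proof -
    have "M \<star> localization D N \<subseteq> localization D N"
      using t_MaxD(2)[OF M] D_subset_localization[OF N]
      by (intro mprod_localization_least[OF N subring_submod[OF subring_localization[OF N]]]) blast
    then show ?thesis using w_closure_mprod_localization[OF N sM] by (auto simp: W_def)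
  qed
  have HN: "H \<subseteq> localization D N" if N: "N \<in> t_Max D" "N \<noteq> M" for N
  proof -
    have "\<not> M \<subseteq> N" using t_MaxD(6)[OF M t_MaxD(1)[OF N(1)]] t_MaxD(2,3)[OF N(1)] Ds(1) N(2) by blast
    then obtain m where m: "m \<in> M" "m \<notin> N" by blast
    have mW: "m \<in> W" using w_closure_extensive[OF sM] m by (auto simp: W_def)
    have "m \<in> D" "m \<noteq> 0" using m t_MaxD(2)[OF M] submodD(2)[OF t_MaxD(4)[OF N(1)]] by auto
    then have im: "1 / m \<in> localization D N" using localizationI[OF Ds(1)] m by blast
    have col: "z \<in> localization D N" if "z * m \<in> localization D N" for z
      using subringD(6)[OF subring_localization[OF N(1)] that im] \<open>m \<noteq> 0\<close> by simp
    have "E \<subseteq> localization D N" using col mW WD[OF N(1)] by (auto simp: E_def dest!: colonD)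
    then show ?thesis using col mW by (auto simp: H_def dest!: colonD)
  qed
  have "w_closure D (W \<star> H) = E"
    using st t_MaxD(5)[OF M] w_stable_ideal_eq[OF sM W_def E_def] by (auto simp: w_stable_def H_def)
  moreover have "1 \<in> E" by (auto simp: E_def intro: colonI)
  ultimately have 1: "1 \<in> W \<star> H \<star> localization D N" if "N \<in> t_Max D" for N
    using that by (auto simp: w_closure_eq[OF sX])
  define G where "G = (W \<star> H) \<inter> D"
  have noG: "\<not> G \<subseteq> N" if N: "N \<in> t_Max D" for N
    using 1[OF N] mem_mprod_localization[OF N sX, of 1] by (auto simp: G_def)
  moreover have "\<not> G \<subseteq> {0}" using noG[OF M] submodD(2)[OF sM] by blast
  moreover have "G \<subseteq> D" by (auto simp: G_def)
  ultimately have "\<exists>X. finite X \<and> X \<subseteq> G \<and> (\<forall>N\<in>t_Max D. \<not> X \<subseteq> N)"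
    by (intro t_Max_compact)
  then obtain X where X: "finite X" "X \<subseteq> G" "\<And>N. N \<in> t_Max D \<Longrightarrow> \<not> X \<subseteq> N" by blast
  obtain A where A: "finite A" "A \<subseteq> W" "X \<subseteq> A \<star> H" using mprod_finite_set[OF X(1), of W H] X(2) by (auto simp: G_def)
  have WM: "W \<subseteq> M"
  proof
    fix w assume w: "w \<in> W"
    then have "w \<in> D" using WD localization_Int[of w] by blast
    have "w \<in> M \<star> localization D M" using w w_closure_mprod_localization[OF M sM] by (auto simp: W_def)
    then obtain s where "s \<in> D" "s \<notin> M" "s * w \<in> M" using mem_mprod_localization[OF M sM] by blast
    then show "w \<in> M" using t_Max_prime[OF M _ \<open>w \<in> D\<close>, of s] by blast
  qed
  have "N = M" if N: "N \<in> t_Max D" "A \<subseteq> N" for N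
  proof (rule ccontr)
    assume neq: "N \<noteq> M"
    have "X \<subseteq> N \<star> localization D N" using A(3) mprod_mono[OF N(2) HN[OF N(1) neq]] by blast
    have "X \<subseteq> N"
    proof
      fix x assume x: "x \<in> X"
      then obtain s where "s \<in> D" "s \<notin> N" "s * x \<in> N"
        using \<open>X \<subseteq> N \<star> localization D N\<close> mem_mprod_localization[OF N(1) t_MaxD(4)[OF N(1)]] by blast
      moreover have "x \<in> D" using x X(2) by (auto simp: G_def)
      ultimately show "x \<in> N" using t_Max_prime[OF N(1), of s x] by blast
    qed
    then show False using X(3)[OF N(1)] by blast
  qed
  moreover have "A \<subseteq> M" using A(2) WM by blast
  ultimately show ?thesis using A(1) by (auto simp: isolated_def)
qed

text \<open>A t-ideal containing the finite set A contains its v-closure, and therefore M.\<close>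

lemma v_finite_isolated:
  assumes vf: "v_finite D" and M: "M \<in> t_Max D"
  shows "isolated D M"
proof -
  obtain A where A: "A \<subseteq> M" "finite A" "colon D A = colon D M"
    using vf t_MaxD(5)[OF M] by (auto simp: v_finite_def)
  have "N = M" if N: "N \<in> t_Max D" "A \<subseteq> N" for N
  proof -
    have "v_closure D A \<subseteq> N" by (rule t_idealD(3)[OF t_MaxD(1)[OF N(1)] A(2) N(2)])
    then have "M \<subseteq> N" using v_closure_extensive[of M D] A(3) by (simp add: v_closure_def)
    moreover have "N \<subset> D" using t_MaxD(2,3)[OF N(1)] Ds(1) by blast
    ultimately show ?thesis using t_MaxD(6)[OF M t_MaxD(1)[OF N(1)]] by blast
  qed
  then show ?thesis using A(1,2) by (auto simp: isolated_def)
qed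

text \<open>Dimension one yields \<open>s M\<close> outside M such that x divides \<open>s M\<close>
  times some power of each a in the finite set \<open>A M\<close> isolating M. The element x and all
  \<open>s M\<close> with x \<in> M lie together in no t-maximal ideal, so finitely many of them
  already do. Any N containing x misses one of these finitely many \<open>s M\<close>; then the
  products just mentioned lie in N, so \<open>A M\<close> \<subseteq> N and N = M.\<close>

lemma t_finite_character:
  assumes iso: "\<And>M. M \<in> t_Max D \<Longrightarrow> isolated D M"
    and dim: "\<And>M. M \<in> t_Max D \<Longrightarrow> dimension_one (localization D M)"
    and x: "x \<in> D" "x \<noteq> 0"
  shows "finite {M \<in> t_Max D. x \<in> M}"
proof -
  define A where "A M = (SOME A. A \<subseteq> M \<and> finite A \<and> (\<forall>M'\<in>t_Max D. A \<subseteq> M' \<longrightarrow> M' = M))" for M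
  have "A M \<subseteq> M \<and> finite (A M) \<and> (\<forall>M'\<in>t_Max D. A M \<subseteq> M' \<longrightarrow> M' = M)" if "M \<in> t_Max D" for M
    unfolding A_def by (rule someI_ex) (rule iso[OF that, unfolded isolated_def])
  then have A: "\<And>M. M \<in> t_Max D \<Longrightarrow> A M \<subseteq> M" "\<And>M. M \<in> t_Max D \<Longrightarrow> finite (A M)"
    "\<And>M M'. M \<in> t_Max D \<Longrightarrow> M' \<in> t_Max D \<Longrightarrow> A M \<subseteq> M' \<Longrightarrow> M' = M" by simp_all
  have ex_s: "\<exists>s\<in>D - M. \<forall>a\<in>B. \<exists>n. s * a ^ n / x \<in> D"
    if M: "M \<in> t_Max D" and B: "finite B" "B \<subseteq> M" for M B
    using B
  proof (induction rule: finite_induct)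
    case empty then show ?case using Ds(1) t_MaxD(3)[OF M] by auto
  next
    case (insert a B)
    then obtain s where s: "s \<in> D - M" "\<forall>a\<in>B. \<exists>n. s * a ^ n / x \<in> D" by auto
    have "a / 1 \<in> nonunits (localization D M)"
      using insert.prems Ds(1) t_MaxD(3)[OF M] nonunits_localization[OF M] by blast
    moreover have "x \<in> localization D M" using x(1) D_subset_localization[OF M] by blast
    ultimately obtain n where "a ^ n / x \<in> localization D M"
      using dim[OF M] x(2) by (auto simp: dimension_one_def)
    then obtain b t where bt: "b \<in> D" "t \<in> D" "t \<notin> M" "t \<noteq> 0" "a ^ n / x = b / t"
      using localizationE[OF _ M] by metis
    have ta: "t * a ^ n / x = b" using bt x(2) by (simp add: field_simps)
    have "\<exists>n. s * t * c ^ n / x \<in> D" if c: "c \<in> insert a B" for c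
    proof (cases "c = a")
      case True
      have "s * (t * a ^ n / x) \<in> D" unfolding ta using s bt Ds(6) by blast
      then show ?thesis using True by (intro exI[of _ n]) (simp add: mult.assoc)
    next
      case False
      then obtain k where "s * c ^ k / x \<in> D" using s c by auto
      then have "t * (s * c ^ k / x) \<in> D" using bt Ds(6) by blast
      then show ?thesis by (intro exI[of _ k]) (simp add: mult_ac)
    qed
    then show ?case using t_Max_mult[OF M, of s t] s bt by (intro bexI[of _ "s * t"]) auto
  qed
  define s where "s M = (SOME s. s \<in> D - M \<and> (\<forall>a\<in>A M. \<exists>n. s * a ^ n / x \<in> D))" for M
  have "s M \<in> D - M \<and> (\<forall>a\<in>A M. \<exists>n. s M * a ^ n / x \<in> D)" if "M \<in> t_Max D" for M
    unfolding s_def by (rule someI_ex) (use ex_s[OF that A(2,1)[OF that]] in \<open>simp only: Bex_def\<close>)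
  then have s: "\<And>M. M \<in> t_Max D \<Longrightarrow> s M \<in> D - M"
    "\<And>M a. M \<in> t_Max D \<Longrightarrow> a \<in> A M \<Longrightarrow> \<exists>n. s M * a ^ n / x \<in> D" by simp_all
  define T where "T = {M \<in> t_Max D. x \<in> M}"
  define G where "G = insert x (s ` T)"
  have "\<exists>X. finite X \<and> X \<subseteq> G \<and> (\<forall>M\<in>t_Max D. \<not> X \<subseteq> M)"
  proof (rule t_Max_compact)
    show "G \<subseteq> D" "\<not> G \<subseteq> {0}" using x s(1) by (auto simp: G_def T_def)
    show "\<not> G \<subseteq> M" if "M \<in> t_Max D" for M using s(1)[OF that] that by (auto simp: G_def T_def)
  qed
  then obtain X where X: "finite X" "X \<subseteq> G" "\<And>M. M \<in> t_Max D \<Longrightarrow> \<not> X \<subseteq> M" by blast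
  have "finite (X - {x})" "X - {x} \<subseteq> s ` T" using X by (auto simp: G_def)
  then obtain T0 where T0: "T0 \<subseteq> T" "finite T0" "X - {x} = s ` T0" using finite_subset_image by metis
  have "T \<subseteq> T0"
  proof
    fix N assume "N \<in> T"
    then have N: "N \<in> t_Max D" "x \<in> N" by (auto simp: T_def)
    obtain y where y: "y \<in> X" "y \<notin> N" using X(3)[OF N(1)] by blast
    then have "y \<in> X - {x}" using N(2) by blast
    then obtain M where M: "M \<in> T0" "s M \<notin> N" using y(2) unfolding T0(3) by blast
    have Mt: "M \<in> t_Max D" using M T0 by (auto simp: T_def)
    have "A M \<subseteq> N"
    proof
      fix a assume a: "a \<in> A M"
      then have aD: "a \<in> D" using A(1)[OF Mt] t_MaxD(2)[OF Mt] by blast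
      obtain n where "s M * a ^ n / x \<in> D" using s(2)[OF Mt a] by blast
      then have "(s M * a ^ n / x) * x \<in> N" using N(2) by (rule submodD(4)[OF t_MaxD(4)[OF N(1)]])
      then have "s M * a ^ n \<in> N" using x(2) by simp
      then have "a ^ n \<in> N" using t_Max_prime[OF N(1), of "s M" "a ^ n"] s(1)[OF Mt] Ds(8)[OF aD] M(2) by blast
      then show "a \<in> N" by (rule t_Max_power[OF N(1) aD])
    qed
    then show "N \<in> T0" using A(3)[OF Mt N(1)] M(1) by simp
  qed
  then show ?thesis using T0(2) finite_subset unfolding T_def by blast
qed

text \<open>A nonzero x in the union U is a unit in all but finitely many D_M, and each exceptional
  M contributes a finite subset of U. Together with x these have the same colon as U, tested locally
  by \<open>localization_Int\<close>. They lie in some \<open>I N\<close>, and divisoriality of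
  \<open>I N\<close> gives U \<subseteq> \<open>I N\<close>.\<close>

lemma v_finite_localizations_mori:
  assumes fc: "\<And>x. x \<in> D \<Longrightarrow> x \<noteq> 0 \<Longrightarrow> finite {M \<in> t_Max D. x \<in> M}"
    and vf: "\<And>M. M \<in> t_Max D \<Longrightarrow> v_finite (localization D M)"
  shows "mori D"
  unfolding mori_def
proof (intro allI impI)
  fix I :: "nat \<Rightarrow> 'k set"
  assume "(\<forall>n. divisorial D (I n) \<and> I n \<subseteq> D) \<and> (\<forall>n. I n \<subseteq> I (Suc n))"
  then have I: "\<And>n. I n \<in> nz_ideals D" "\<And>n. I n = v_closure D (I n)" "\<And>n. I n \<subseteq> D" "\<And>n. I n \<subseteq> I (Suc n)"
    by (auto simp: divisorial_def)
  define U where "U = (\<Union>n. I n)"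
  have sI: "submod D (I n)" for n using nz_idealE[OF I(1)] by metis
  have sU: "submod D U" unfolding U_def by (rule submod_Union_chain[where L = I, OF sI I(4)])
  have UD: "U \<subseteq> D" using I(3) by (auto simp: U_def)
  obtain x where x: "x \<in> U" "x \<noteq> 0" using nz_idealE[OF I(1)[of 0]] by (metis U_def UN_I UNIV_I)
  have ex_A: "\<exists>A\<subseteq>U. finite A \<and> colon (localization D M) A \<subseteq> colon (localization D M) U" if M: "M \<in> t_Max D" for M
  proof -
    let ?R = "localization D M"
    interpret loc: local_domain ?R by (rule local_domain_localization[OF M])
    have UL: "U \<subseteq> U \<star> ?R" by (rule subset_mprod_localization[OF M])
    have "U \<star> ?R \<subseteq> ?R"
      using UD D_subset_localization[OF M] by (intro mprod_localization_least[OF M loc.R_submod]) blast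
    then have "U \<star> ?R \<in> nz_ideals ?R"
      using x UL by (intro loc.nz_idealI[OF submod_mprod_localization[OF M], of x _ 1]) auto
    then obtain A where A: "A \<subseteq> U \<star> ?R" "finite A" "colon ?R A = colon ?R (U \<star> ?R)"
      using vf[OF M] by (auto simp: v_finite_def)
    obtain s where s: "s \<in> D - M" "\<forall>a\<in>A. s * a \<in> U" using localization_finite[OF M A(2,1) sU] by blast
    have s0: "s \<noteq> 0" using s submodD(2)[OF t_MaxD(4)[OF M]] by auto
    have inv_s: "1 / s \<in> ?R" using localizationI[OF Ds(1)] s by blast
    have "colon ?R ((\<lambda>a. s * a) ` A) \<subseteq> colon ?R A"
    proof (intro subsetI colonI)
      fix z a assume "z \<in> colon ?R ((\<lambda>a. s * a) ` A)" "a \<in> A"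
      then have "z * (s * a) \<in> ?R" by (auto dest: colonD)
      then have "z * (s * a) * (1 / s) \<in> ?R" using inv_s loc.Rs(6) by blast
      then show "z * a \<in> ?R" using s0 by simp
    qed
    also have "\<dots> \<subseteq> colon ?R U" unfolding A(3) using UL by (intro colon_mono) auto
    finally show ?thesis using s(2) A(2) by (intro exI[of _ "(\<lambda>a. s * a) ` A"]) auto
  qed
  define A where "A M = (SOME A. A \<subseteq> U \<and> finite A \<and>
    colon (localization D M) A \<subseteq> colon (localization D M) U)" for M
  have "A M \<subseteq> U \<and> finite (A M) \<and> colon (localization D M) (A M) \<subseteq> colon (localization D M) U"
    if "M \<in> t_Max D" for M
    unfolding A_def by (rule someI_ex) (rule ex_A[OF that])
  then have A: "\<And>M. M \<in> t_Max D \<Longrightarrow> A M \<subseteq> U" "\<And>M. M \<in> t_Max D \<Longrightarrow> finite (A M)"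
    "\<And>M. M \<in> t_Max D \<Longrightarrow> colon (localization D M) (A M) \<subseteq> colon (localization D M) U" by simp_all
  define B where "B = insert x (\<Union>M\<in>{M \<in> t_Max D. x \<in> M}. A M)"
  have B: "finite B" "B \<subseteq> U" using fc[of x] x UD A(1,2) by (auto simp: B_def)
  have colB: "colon D B \<subseteq> colon D U"
  proof (intro subsetI colonI)
    fix z u assume z: "z \<in> colon D B" and u: "u \<in> U"
    show "z * u \<in> D"
    proof (rule localization_Int)
      fix M assume M: "M \<in> t_Max D"
      note DR = D_subset_localization[OF M]
      show "z * u \<in> localization D M"
      proof (cases "x \<in> M")
        case True
        then have "A M \<subseteq> B" using M by (auto simp: B_def)
        then have "z \<in> colon (localization D M) (A M)" using z DR by (auto simp: colon_def)
        then show ?thesis using A(3)[OF M] u by (auto dest: colonD)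
      next
        case False
        have "z * x \<in> D" using z by (auto simp: B_def dest: colonD)
        then have "z * x * u \<in> D" using u UD Ds(6) by blast
        moreover have "x \<in> D" using x(1) UD by blast
        ultimately have "(z * x * u) / x \<in> localization D M" using False by (rule localizationI)
        then show ?thesis using x(2) by simp
      qed
    qed
  qed
  have "\<exists>N. B \<subseteq> I N" by (rule finite_subset_chain[where L = I, OF B(1) _ I(4)]) (use B(2) in \<open>simp add: U_def\<close>)
  then obtain N where N: "B \<subseteq> I N" by blast
  have "U \<subseteq> I N"
  proof
    fix u assume u: "u \<in> U"
    have "u \<in> v_closure D (I N)" unfolding v_closure_def
    proof (rule colonI)
      fix z assume "z \<in> colon D (I N)"
      then have "z \<in> colon D U" using colon_mono[OF subset_refl N, of D] colB by blast
      then show "u * z \<in> D" using u by (rule colonD')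
    qed
    then show "u \<in> I N" using I(2) by blast
  qed
  moreover have "I N \<subseteq> I n" if "N \<le> n" for n by (rule lift_Suc_mono_le[of I, OF I(4) that])
  ultimately show "\<exists>N. \<forall>n\<ge>N. I n = I N" by (intro exI[of _ N]) (auto simp: U_def)
qed

text \<open>Only the finitely many N containing q matter, q being a unit in the other localizations.
  For each of them a power of an element of N outside M is divisible by q in D_N, and the product of
  these powers stays outside M because M is prime.\<close>

lemma ex_separating:
  assumes fc: "\<And>x. x \<in> D \<Longrightarrow> x \<noteq> 0 \<Longrightarrow> finite {M \<in> t_Max D. x \<in> M}"
    and dim: "\<And>M. M \<in> t_Max D \<Longrightarrow> dimension_one (localization D M)"
    and M: "M \<in> t_Max D" and q: "q \<in> D" "q \<noteq> 0"
  shows "\<exists>s\<in>D - M. \<forall>N\<in>t_Max D. N \<noteq> M \<longrightarrow> s / q \<in> localization D N"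
proof -
  have one: "\<exists>s\<in>D - M. s / q \<in> localization D N" if N: "N \<in> t_Max D" "N \<noteq> M" for N
  proof -
    have "M \<subset> D" using t_MaxD(2,3)[OF M] Ds(1) by blast
    then have "\<not> N \<subseteq> M" using t_MaxD(6)[OF N(1) t_MaxD(1)[OF M]] N(2) by blast
    then obtain m where m: "m \<in> N" "m \<notin> M" by blast
    have mD: "m \<in> D" using m t_MaxD(2)[OF N(1)] by blast
    have "m / 1 \<in> nonunits (localization D N)"
      using m Ds(1) t_MaxD(3)[OF N(1)] nonunits_localization[OF N(1)] by blast
    moreover have "q \<in> localization D N" using q(1) D_subset_localization[OF N(1)] by blast
    ultimately obtain n where "m ^ n / q \<in> localization D N"
      using dim[OF N(1)] q(2) by (auto simp: dimension_one_def)
    moreover have "m ^ n \<in> D - M" using t_Max_power[OF M mD] m(2) Ds(8)[OF mD] by blast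
    ultimately show ?thesis by blast
  qed
  have "\<exists>s\<in>D - M. \<forall>N\<in>F. s / q \<in> localization D N" if "finite F" "F \<subseteq> t_Max D - {M}" for F
    using that
  proof (induction rule: finite_induct)
    case empty then show ?case using Ds(1) t_MaxD(3)[OF M] by auto
  next
    case (insert N F)
    then obtain s where s: "s \<in> D - M" "\<forall>N\<in>F. s / q \<in> localization D N" by auto
    obtain t where t: "t \<in> D - M" "t / q \<in> localization D N" using one[of N] insert.prems by auto
    have "s * t / q \<in> localization D N'" if N': "N' \<in> insert N F" for N'
    proof -
      have N't: "N' \<in> t_Max D" using N' insert.prems by auto
      note Rs = subringD(6)[OF subring_localization[OF N't]]
      have "s \<in> localization D N'" "t \<in> localization D N'" using s t D_subset_localization[OF N't] by auto
      moreover have "t / q \<in> localization D N' \<or> s / q \<in> localization D N'" using N' s(2) t(2) by blast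
      ultimately have "s * (t / q) \<in> localization D N' \<or> t * (s / q) \<in> localization D N'"
        using Rs[of s "t / q"] Rs[of t "s / q"] by blast
      then show ?thesis by (simp add: mult.commute)
    qed
    then show ?case using t_Max_mult[OF M, of s t] s t by (intro bexI[of _ "s * t"]) auto
  qed
  from this[of "{N \<in> t_Max D. q \<in> N} - {M}"] fc[OF q]
  obtain s where s: "s \<in> D - M" "\<forall>N\<in>{N \<in> t_Max D. q \<in> N} - {M}. s / q \<in> localization D N" by auto
  have "s / q \<in> localization D N" if "N \<in> t_Max D" "N \<noteq> M" for N
    using that s localizationI[OF _ q(1), of s N] by (cases "q \<in> N") auto
  then show ?thesis using s(1) by blast
qed

text \<open>The substance is 1 \<in> X D_M for each M. Locally 1 is a sum of products a b with b in
  ((L : L) : L), but such a b need not respect W at the other t-maximal ideals. A factor t from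
  \<open>ex_separating\<close> repairs this at every N other than M and brings t b into (E : W),
  while t is a unit in D_M.\<close>

lemma stable_localizations_w_stable:
  assumes fc: "\<And>x. x \<in> D \<Longrightarrow> x \<noteq> 0 \<Longrightarrow> finite {M \<in> t_Max D. x \<in> M}"
    and dim: "\<And>M. M \<in> t_Max D \<Longrightarrow> dimension_one (localization D M)"
    and st: "\<And>M. M \<in> t_Max D \<Longrightarrow> stable (localization D M)"
  shows "w_stable D"
  unfolding w_stable_def
proof
  fix I assume I: "I \<in> nz_ideals D"
  obtain a d where d: "submod D I" "a \<in> I" "a \<noteq> 0" "d \<in> D" "d \<noteq> 0" "\<And>x. x \<in> I \<Longrightarrow> d * x \<in> D"
    using nz_idealE[OF I] by metis
  define W where "W = w_closure D I"
  define E where "E = colon W W"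
  define X where "X = W \<star> colon E W"
  have sW: "submod D W" unfolding W_def by (rule submod_w_closure[OF d(1)])
  have addW: "addsub W" by (rule submodD[OF sW])
  have IW: "I \<subseteq> W" unfolding W_def by (rule w_closure_extensive[OF d(1)])
  have WL: "W \<star> localization D M = I \<star> localization D M" if "M \<in> t_Max D" for M
    unfolding W_def by (rule w_closure_localization[OF that d(1)])
  have W_iff: "z \<in> W \<longleftrightarrow> (\<forall>M\<in>t_Max D. z \<in> I \<star> localization D M)" for z
    by (auto simp: W_def w_closure_eq[OF d(1)])
  have E: "subring E" "D \<subseteq> E" using subring_colon_self[OF D_subring sW] by (auto simp: E_def)
  have sX: "submod D X" unfolding X_def by (rule submod_mprod_left[OF sW])
  have EX: "submod E X" unfolding X_def E_def by (rule submod_mprod_left[OF submod_colon_self[OF addW]])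
  have addE: "addsub E" by (rule submodD[OF subring_submod[OF E(1)]])
  have XE: "X \<subseteq> E" using colon_mprod_subset[OF addE, of W] by (simp add: X_def mprod_comm)
  have "w_closure D X \<subseteq> E"
  proof
    fix z assume z: "z \<in> w_closure D X"
    have "z * w \<in> W" if w: "w \<in> W" for w
      unfolding W_iff
    proof
      fix M assume M: "M \<in> t_Max D"
      have "z \<in> X \<star> localization D M" using z M by (auto simp: w_closure_eq[OF sX])
      then have "z * w \<in> (X \<star> localization D M) \<star> W" using w by (rule mprodI)
      also have "\<dots> = (X \<star> W) \<star> localization D M" by (simp add: mprod_ac)
      also have "\<dots> \<subseteq> W \<star> localization D M"
      proof (rule mprod_mono[OF _ subset_refl])
        have "X \<star> W \<subseteq> E \<star> W" using XE by (intro mprod_mono) auto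
        also have "\<dots> \<subseteq> W" unfolding E_def by (rule colon_mprod_subset[OF addW])
        finally show "X \<star> W \<subseteq> W" .
      qed
      finally show "z * w \<in> I \<star> localization D M" by (simp add: WL[OF M])
    qed
    then show "z \<in> E" by (auto simp: E_def intro: colonI)
  qed
  moreover have "E \<subseteq> w_closure D X"
  proof -
    have one: "1 \<in> X \<star> localization D M" if M: "M \<in> t_Max D" for M
    proof -
      let ?R = "localization D M"
      interpret loc: local_domain ?R by (rule local_domain_localization[OF M])
      define L where "L = I \<star> ?R"
      have sL: "submod ?R L" unfolding L_def by (rule submod_mprod_localization[OF M])
      have IL: "I \<subseteq> L" unfolding L_def by (rule subset_mprod_localization[OF M])
      have dL: "d * x \<in> ?R" if x: "x \<in> L" for x
      proof -
        obtain s where s: "s \<in> D - M" "s * x \<in> I" using x mem_mprod_localization[OF M d(1)] by (auto simp: L_def)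
        have "s \<noteq> 0" using s submodD(2)[OF t_MaxD(4)[OF M]] by auto
        then have "d * x = (d * (s * x)) / s" by simp
        then show ?thesis using localizationI[OF d(6)[OF s(2)], of s M] s(1) by auto
      qed
      have "L \<in> nz_ideals ?R" using IL d(2) dL by (intro loc.nz_idealI[OF sL _ d(3,5)]) auto
      then have "1 \<in> L \<star> colon (colon L L) L" using st[OF M] by (auto simp: stable_def)
      also have "\<dots> \<subseteq> X \<star> ?R"
      proof (rule mprod_least[OF addsub_mprod])
        fix a b assume a: "a \<in> L" and b: "b \<in> colon (colon L L) L"
        obtain s where s: "s \<in> D - M" "s * a \<in> I" using a mem_mprod_localization[OF M d(1)] by (auto simp: L_def)
        \<comment> \<open>The quotient b/d rather than b is written as p/q: at N other than M the
          spare factor d turns u into an element of D_N.\<close>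
        obtain p q where pq: "p \<in> D" "q \<in> D" "q \<noteq> 0" "b / d = p / q" using fraction by blast
        obtain t where t: "t \<in> D - M" "\<And>N. N \<in> t_Max D \<Longrightarrow> N \<noteq> M \<Longrightarrow> t / q \<in> localization D N"
          using ex_separating[OF fc dim M pq(2,3)] by blast
        have bq: "b = d * (p / q)" using pq(4) d(5) by (simp add: field_simps)
        have "t * b \<in> colon E W"
        proof -
          have "t * b * u * v \<in> W" if uv: "u \<in> W" "v \<in> W" for u v
            unfolding W_iff
          proof
            fix N assume N: "N \<in> t_Max D"
            have uL: "u \<in> I \<star> localization D N" "v \<in> I \<star> localization D N" using uv W_iff N by auto
            have sLN: "submod (localization D N) (I \<star> localization D N)" by (rule submod_mprod_localization[OF N])
            show "t * b * u * v \<in> I \<star> localization D N"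
            proof (cases "N = M")
              case True
              then have "b * u * v \<in> L" using uL b by (auto simp: L_def dest: colonD)
              then have "t * (b * u * v) \<in> L" using t(1) D_subset_localization[OF M] submodD(4)[OF sL] by blast
              then show ?thesis using True by (simp add: L_def mult.assoc)
            next
              case False
              obtain r where r: "r \<in> D - N" "r * u \<in> I" using uL(1) mem_mprod_localization[OF N d(1)] by auto
              have r0: "r \<noteq> 0" using r submodD(2)[OF t_MaxD(4)[OF N]] by auto
              have "(d * (r * u)) / r \<in> localization D N" using localizationI[OF d(6)[OF r(2)], of r N] r(1) by auto
              then have du: "d * u \<in> localization D N" using r0 by simp
              have "p \<in> localization D N" using pq(1) D_subset_localization[OF N] by blast
              then have "t / q * p * (d * u) \<in> localization D N"
                using du t(2)[OF N False] subringD(6)[OF subring_localization[OF N]] by blast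
              then have "t / q * p * (d * u) * v \<in> I \<star> localization D N" by (rule submodD(4)[OF sLN _ uL(2)])
              then show ?thesis by (simp add: bq mult_ac)
            qed
          qed
          then show ?thesis by (auto simp: E_def intro!: colonI)
        qed
        moreover have "s * a \<in> W" using s(2) IW by blast
        ultimately have "(s * a) * (t * b) \<in> X" unfolding X_def by (intro mprodI)
        moreover have "s * t \<in> D - M" using t_Max_mult[OF M, of s t] s t by blast
        ultimately show "a * b \<in> X \<star> ?R" using mem_mprod_localization[OF M sX]
          by (auto intro!: bexI[of _ "s * t"] simp: mult_ac)
      qed
      finally show ?thesis .
    qed
    have "e \<in> X \<star> localization D M" if e: "e \<in> E" and M: "M \<in> t_Max D" for e M
    proof -
      obtain s where s: "s \<in> D - M" "s * 1 \<in> X" using one[OF M] mem_mprod_localization[OF M sX] by blast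
      then have "s * e \<in> X" using submodD(4)[OF EX e, of s] by (simp add: mult.commute)
      then show ?thesis using s mem_mprod_localization[OF M sX] by blast
    qed
    then show ?thesis by (auto simp: w_closure_eq[OF sX])
  qed
  ultimately show "w_stable_ideal D I"
    using w_stable_ideal_eq[OF d(1) W_def E_def] by (auto simp: X_def)
qed

text \<open>The witness is J = (E : W): one has W W J \<subseteq> E W \<subseteq> W, and 1 \<in> W J
  D_M gives the reverse inclusion at every M.\<close>

lemma w_stable_clifford:
  assumes nf: "t_Max D \<noteq> {}" and st: "w_stable D"
  shows "clifford_w_regular D"
  unfolding clifford_w_regular_def
proof
  fix I assume I: "I \<in> nz_ideals D"
  define W where "W = w_closure D I"
  define E where "E = colon W W"
  define J where "J = colon E W"
  have sI: "submod D I" using nz_idealE[OF I] by metis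
  have Wnz: "W \<in> nz_ideals D" unfolding W_def by (rule w_closure_nz_ideal[OF I])
  obtain a where sW: "submod D W" and a: "a \<in> W" "a \<noteq> 0" using nz_idealE[OF Wnz] by metis
  have addW: "addsub W" by (rule submodD[OF sW])
  have addE: "addsub E" unfolding E_def by (rule addsub_colon[OF addW])
  have "w_closure D (W \<star> J) = E"
    using st I w_stable_ideal_eq[OF sI W_def E_def] by (auto simp: w_stable_def J_def)
  moreover have "1 \<in> E" by (auto simp: E_def intro: colonI)
  ultimately have one: "1 \<in> W \<star> J \<star> localization D M" if "M \<in> t_Max D" for M
    using that by (auto simp: w_closure_eq[OF submod_mprod_left[OF sW]])
  have WWJ: "W \<star> (W \<star> J) \<subseteq> W"
  proof -
    have "W \<star> J \<subseteq> E" using colon_mprod_subset[OF addE, of W] by (simp add: J_def mprod_comm)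
    then have "W \<star> (W \<star> J) \<subseteq> E \<star> W" using mprod_mono[of "W \<star> J" E W W] by (simp add: mprod_comm)
    also have "\<dots> \<subseteq> W" unfolding E_def by (rule colon_mprod_subset[OF addW])
    finally show ?thesis .
  qed
  have WL: "W \<star> localization D M = I \<star> localization D M" if "M \<in> t_Max D" for M
    unfolding W_def by (rule w_closure_localization[OF that sI])
  have eq: "I \<star> I \<star> J \<star> localization D M = I \<star> localization D M" if M: "M \<in> t_Max D" for M
  proof -
    let ?R = "localization D M"
    have RR: "?R \<star> ?R = ?R"
      using subring_localization[OF M] by (intro mprod_submod subringD(1) subring_submod)
    have "I \<star> I \<star> J \<star> ?R = (I \<star> ?R) \<star> (I \<star> ?R) \<star> J"
    proof -
      have "(I \<star> ?R) \<star> (I \<star> ?R) \<star> J = I \<star> I \<star> J \<star> (?R \<star> ?R)" by (simp add: mprod_ac)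
      then show ?thesis by (simp add: RR)
    qed
    also have "\<dots> = (W \<star> ?R) \<star> (W \<star> ?R) \<star> J" by (simp add: WL[OF M])
    also have "\<dots> = (W \<star> (W \<star> J)) \<star> (?R \<star> ?R)" by (simp add: mprod_ac)
    also have "\<dots> = (W \<star> (W \<star> J)) \<star> ?R" by (simp add: RR)
    also have "\<dots> = W \<star> ?R"
    proof
      show "(W \<star> (W \<star> J)) \<star> ?R \<subseteq> W \<star> ?R" by (rule mprod_mono[OF WWJ subset_refl])
      have "W \<star> ?R \<subseteq> (W \<star> J \<star> ?R) \<star> (W \<star> ?R)" by (rule mprod_one_subset[OF one[OF M]])
      also have "\<dots> = (W \<star> (W \<star> J)) \<star> (?R \<star> ?R)" by (simp add: mprod_ac)
      finally show "W \<star> ?R \<subseteq> (W \<star> (W \<star> J)) \<star> ?R" by (simp add: RR)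
    qed
    finally show ?thesis by (simp add: WL[OF M])
  qed
  have "J \<in> nz_ideals D"
  proof -
    have sJ: "submod D J" unfolding J_def E_def by (intro submod_colon sW)
    \<comment> \<open>A single t-maximal ideal with 1 \<in> W J D_M shows that J is nonzero.\<close>
    obtain M where "M \<in> t_Max D" using nf by blast
    have "\<not> J \<subseteq> {0}"
    proof
      assume "J \<subseteq> {0}"
      then have "W \<star> J \<star> localization D M \<subseteq> {0} "
        using mprod_least[of "{0}" W J] mprod_least[of "{0}" "W \<star> J" "localization D M"]
        by (force simp: addsub_def)
      then show False using one[OF \<open>M \<in> t_Max D\<close>] by auto
    qed
    then obtain j where j: "j \<in> J" "j \<noteq> 0" by blast
    obtain d where dE: "d \<noteq> 0" "\<forall>x\<in>E. d * x \<in> D"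
      using frac_overring_colon_self[OF D_subring Wnz] by (auto simp: frac_overring_def E_def)
    have "d * a * x \<in> D" if "x \<in> J" for x
    proof -
      have "a * x \<in> E" using that a(1) by (auto simp: J_def dest: colonD')
      then show ?thesis using dE(2) by (simp add: mult.assoc)
    qed
    then show ?thesis using a dE by (intro nz_idealI[OF sJ j, of "d * a"]) auto
  qed
  moreover have "w_closure D I = w_closure D (I \<star> I \<star> J)"
    using eq by (simp add: w_closure_eq[OF sI] w_closure_eq[OF submod_mprod_left[OF submod_mprod_left[OF sI]]])
  ultimately show "w_regular_ideal D I"
    unfolding w_regular_ideal_def
    by (intro bexI[of _ J]) (auto simp: ideal_prod_eq_mprod[OF D_subring] sI submod_mprod_left)
qed

end

theorem theorem4p3:
  fixes D :: "'k::field set"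
  assumes "domain_in_fraction_field D"
    and not_field: "\<not> (\<forall>x\<in>D. x \<noteq> 0 \<longrightarrow> inverse x \<in> D)"
  shows "(w_stable D \<and> t_dimension_one D \<longleftrightarrow> mori D \<and> w_stable D) \<and>
         (mori D \<and> w_stable D \<longleftrightarrow> mori D \<and> clifford_w_regular D)"
proof -
  interpret domain_in_fraction_field D by fact
  have nf: "t_Max D \<noteq> {}" by (rule t_Max_nonempty[OF not_field])
  \<comment> \<open>Shared by both implications that start from a Mori domain; neither of them
    assumes anything about dimension.\<close>
  have mori_dim: "dimension_one (localization D M)"
    if "mori D" "clifford_w_regular D" "M \<in> t_Max D" for M
    using that by (intro local_domain.regular_v_finite_dimension_one local_domain_localization
        v_finite_localization mori_v_finite clifford_localization)
  have "mori D" if st: "w_stable D" and dim: "t_dimension_one D"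
  proof (rule v_finite_localizations_mori)
    show "finite {M \<in> t_Max D. x \<in> M}" if "x \<in> D" "x \<noteq> 0" for x
      by (rule t_finite_character[OF w_stable_isolated[OF st] t_dimension_one_localization[OF dim] that])
    show "v_finite (localization D M)" if M: "M \<in> t_Max D" for M
      by (rule local_domain.stable_v_finite[OF local_domain_localization[OF M]
            t_dimension_one_localization[OF dim M] w_stable_localization[OF st M]])
  qed
  \<comment> \<open>The detour through Clifford regularity makes
    \<open>regular_v_finite_dimension_one\<close> applicable.\<close>
  moreover have "t_dimension_one D" if "mori D" "w_stable D"
    using localization_t_dimension_one mori_dim[OF that(1) w_stable_clifford[OF nf that(2)]] by blast
  moreover have "clifford_w_regular D" if "w_stable D" by (rule w_stable_clifford[OF nf that])
  moreover have "w_stable D" if m: "mori D" and cl: "clifford_w_regular D"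
  proof (rule stable_localizations_w_stable)
    show dim: "dimension_one (localization D M)" if "M \<in> t_Max D" for M by (rule mori_dim[OF m cl that])
    show "finite {M \<in> t_Max D. x \<in> M}" if "x \<in> D" "x \<noteq> 0" for x
      by (rule t_finite_character[OF v_finite_isolated[OF mori_v_finite[OF m]] mori_dim[OF m cl] that])
    show "stable (localization D M)" if M: "M \<in> t_Max D" for M
      by (rule local_domain.regular_v_finite_stable[OF local_domain_localization[OF M] dim[OF M]
            v_finite_localization[OF mori_v_finite[OF m] M] clifford_localization[OF cl M]])
  qed
  ultimately show ?thesis by blast
qed

end
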